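(* Let $(\mathbb{X},\mathcal{X})$ be a Borel space equipped with a finite and diffuse measure $\lambda$. Let $\kappa\colon\mathbb{X}\times\mathbf{N}\to[0,\infty)$ be measurable and satisfy $\kappa(x,\mu)\kappa(y,\mu+\delta_x)=\kappa(y,\mu)\kappa(x,\mu+\delta_y)$ for all $(x,y,\mu)\in\mathbb{X}^2\times\mathbf{N}$. Assume that there is a measurable $\alpha\colon\mathbb{X}\to(0,\infty)$ with $\int\alpha\,\mathrm{d}\lambda<\infty$ and $\kappa(x,\mu)\le\alpha(x)$ for all $(x,\mu)\in\mathbb{X}\times\mathbf{N}$. Then $$\mathbb{Q}_{\kappa,\alpha}:=\iint \mathbf{1}\{\psi\in\cdot\}\,K_{\kappa,\alpha}(\mu,\mathrm{d}\psi)\,\Pi_{\alpha\lambda}(\mathrm{d}\mu)$$ is the distribution of a Gibbs process with Papangelou intensity $\kappa$, where $K_{\kappa,\alpha}$ is the kernel from $\mathbf{N}^*$ to $\mathbf{N}^*$ defined by $$K_{\kappa,\alpha}(\mu,\cdot):=\sum_{\psi\le\mu}\mathbf{1}\{\psi\in\cdot\}\prod_{x\in\psi}\alpha(x)^{-1}p(x,\psi)\prod_{x\in\mu-\psi}\big(1-\alpha(x)^{-1}p(x,\psi)\big),\quad\mu\in\mathbf{N}^*,$$ the sum running over all $\psi\in\mathbf{N}^*$ with $\psi\le\mu$, and $p$ is the function defined in the context.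
   Context: A measure is diffuse if it has no atoms at points. $\mathbf{N}$ is the set of all $\mathbb{N}_0$-valued (hence finite) measures on $\mathbb{X}$, with the $\sigma$-field generated by $\mu\mapsto\mu(B)$, $B\in\mathcal{X}$; $\mathbf{N}^*\subset\mathbf{N}$ is the subset of simple measures ($\mu(\{x\})\le 1$ for all $x$). A point process is a random element of $\mathbf{N}$. Write $x\in\mu$ if $\mu(\{x\})>0$, and $\mu_B:=\mu(B\cap\cdot)$. For a measure $\nu$, $\Pi_\nu$ is the distribution of a Poisson process with intensity measure $\nu$; $\alpha\lambda$ is the measure $\alpha(x)\lambda(\mathrm{d}x)$. A point process $\xi$ is a Gibbs process with Papangelou intensity $\kappa$ if $\mathbb{E}\int f(x,\xi)\,\xi(\mathrm{d}x)=\mathbb{E}\int f(x,\xi+\delta_x)\kappa(x,\xi)\,\lambda(\mathrm{d}x)$ for all measurable $f\colon\mathbb{X}\times\mathbf{N}\to[0,\infty)$. For $m\in\mathbb{N}$ let $\kappa_m(x_1,\ldots,x_m,\mu):=\kappa(x_1,\mu)\kappa(x_2,\mu+\delta_{x_1})\cdots\kappa(x_m,\mu+\delta_{x_1}+\cdots+\delta_{x_{m-1}})$ (symmetric in $x_1,\dots,x_m$ by the assumed cocycle identity). The Hamiltonian is $H(0,\psi):=0$ and $H(\mu,\psi):=-\log\kappa_m(x_1,\ldots,x_m,\psi)$ if $\mu=\delta_{x_1}+\cdots+\delta_{x_m}$. For $B\in\mathcal{X}$ the partition function is $Z_B(\psi):=\int e^{-H(\mu,\psi)}\,\Pi_{\lambda_B}(\mathrm{d}\mu)$,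 $\psi\in\mathbf{N}$. Fix an injective measurable $\varphi\colon\mathbb{X}\to\mathbb{R}$ with measurable image and measurable inverse on its image, and order $\mathbb{X}$ totally by $x\le y:\Leftrightarrow\varphi(x)\le\varphi(y)$. Put $(x,\infty):=\{z\in\mathbb{X}:z>x\}$, $(-\infty,x):=\{z\in\mathbb{X}:z<x\}$ and $\psi_x:=\psi_{(-\infty,x)}$. Define $$p(x,\psi):=\kappa(x,\psi_x)\frac{Z_{(x,\infty)}(\psi_x+\delta_x)}{Z_{(x,\infty)}(\psi_x)},\quad(x,\psi)\in\mathbb{X}\times\mathbf{N}^*,$$ with $\infty/\infty:=0$. *)

theory Defs
  imports "HOL-Probability.Probability"
begin

definition borel_embedding :: "'a measure \<Rightarrow> ('a \<Rightarrow> real) \<Rightarrow> bool" where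
  "borel_embedding M \<phi> \<longleftrightarrow>
     \<phi> \<in> borel_measurable M \<and> inj_on \<phi> (space M) \<and> \<phi> ` space M \<in> sets borel \<and>
     the_inv_into (space M) \<phi> \<in> measurable (restrict_space borel (\<phi> ` space M)) M"

text \<open>Borel space: isomorphic to a Borel subset of the unit interval.\<close>

definition borel_space :: "'a measure \<Rightarrow> bool" where
  "borel_space M \<longleftrightarrow> (\<exists>\<phi>. borel_embedding M \<phi> \<and> \<phi> ` space M \<subseteq> {0..1})"

definition diffuse :: "'a measure \<Rightarrow> bool" where
  "diffuse M \<longleftrightarrow> (\<forall>x\<in>space M. emeasure M {x} = 0)"

definition measure_kernel :: "'a measure \<Rightarrow> 'b measure \<Rightarrow> ('a \<Rightarrow> 'b measure) \<Rightarrow> bool" where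
  "measure_kernel M N K \<longleftrightarrow> (\<forall>x\<in>space M. sets (K x) = sets N) \<and>
     (\<forall>A\<in>sets N. (\<lambda>x. emeasure (K x) A) \<in> borel_measurable M)"

text \<open>The space of \<open>\<nat>\<^sub>0\<close>-valued measures on (the measurable space underlying) \<open>M\<close>, with the
  \<open>\<sigma>\<close>-algebra generated by the evaluations, built in the same way as \<^const>\<open>subprob_algebra\<close>.
  As in the library, only its \<^const>\<open>space\<close> and \<^const>\<open>sets\<close> are meaningful.\<close>

definition counting_algebra :: "'a measure \<Rightarrow> 'a measure measure" where
  "counting_algebra M =
     (SUP B \<in> sets M. vimage_algebra {\<mu>. sets \<mu> = sets M \<and> (\<forall>A\<in>sets M. emeasure \<mu> A \<in> \<nat>)}
        (\<lambda>\<mu>. emeasure \<mu> B) borel)"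

definition simple_counting_algebra :: "'a measure \<Rightarrow> 'a measure measure" where
  "simple_counting_algebra M =
     restrict_space (counting_algebra M) {\<mu>. \<forall>x\<in>space M. emeasure \<mu> {x} \<le> 1}"

lemma space_counting_algebra:
  "space (counting_algebra M) = {\<mu>. sets \<mu> = sets M \<and> (\<forall>A\<in>sets M. emeasure \<mu> A \<in> \<nat>)}"
  by (auto simp add: counting_algebra_def space_Sup_eq_UN)

lemma measurable_emeasure_counting_algebra:
  assumes "B \<in> sets M"
  shows "(\<lambda>\<mu>. emeasure \<mu> B) \<in> borel_measurable (counting_algebra M)"
  unfolding counting_algebra_def
  by (rule measurable_Sup1[OF imageI[OF assms]]) (auto intro: measurable_vimage_algebra1)

definition restrict_meas :: "'a measure \<Rightarrow> 'a set \<Rightarrow> 'a measure" where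
  "restrict_meas \<mu> B = measure_of (space \<mu>) (sets \<mu>) (\<lambda>A. emeasure \<mu> (B \<inter> A))"

definition add_dirac :: "'a measure \<Rightarrow> 'a \<Rightarrow> 'a measure" where
  "add_dirac \<mu> x = measure_of (space \<mu>) (sets \<mu>) (\<lambda>A. emeasure \<mu> A + emeasure (return \<mu> x) A)"

definition atoms :: "'a measure \<Rightarrow> 'a set" where
  "atoms \<mu> = {x \<in> space \<mu>. emeasure \<mu> {x} > 0}"

definition point_process :: "'w measure \<Rightarrow> ('w \<Rightarrow> 'a measure) \<Rightarrow> 'a measure \<Rightarrow> bool" where
  "point_process P \<xi> M \<longleftrightarrow> prob_space P \<and> \<xi> \<in> measurable P (counting_algebra M)"

text \<open>Only finite intensity measures \<open>\<nu>\<close> are used. The formula for the Poisson probabilities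
  (rather than \<^const>\<open>poisson_pmf\<close>) includes the rate \<open>0\<close>.\<close>

definition poisson_process :: "'w measure \<Rightarrow> ('w \<Rightarrow> 'a measure) \<Rightarrow> 'a measure \<Rightarrow> bool" where
  "poisson_process P \<eta> \<nu> \<longleftrightarrow> point_process P \<eta> \<nu> \<and>
     (\<forall>B\<in>sets \<nu>. \<forall>k::nat. measure P {\<omega> \<in> space P. emeasure (\<eta> \<omega>) B = of_nat k} =
        measure \<nu> B ^ k / fact k * exp (- measure \<nu> B)) \<and>
     (\<forall>m::nat. \<forall>B :: nat \<Rightarrow> 'a set. (\<forall>i<m. B i \<in> sets \<nu>) \<and> disjoint_family_on B {..<m} \<longrightarrow>
        prob_space.indep_vars P (\<lambda>_. borel) (\<lambda>i \<omega>. emeasure (\<eta> \<omega>) (B i)) {..<m})"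

text \<open>Here and in \<open>gibbs_distribution\<close>, the sample space may be taken of the type of the space of
  point measures itself: every law of a point process is attained on its canonical space.\<close>

definition poisson_law :: "'a measure \<Rightarrow> 'a measure measure" where
  "poisson_law \<nu> = (THE Q. \<exists>(P :: 'a measure measure) \<eta>.
     poisson_process P \<eta> \<nu> \<and> Q = distr P (counting_algebra \<nu>) \<eta>)"

definition gibbs_process ::
  "'w measure \<Rightarrow> ('w \<Rightarrow> 'a measure) \<Rightarrow> 'a measure \<Rightarrow> ('a \<Rightarrow> 'a measure \<Rightarrow> real) \<Rightarrow> bool" where
  "gibbs_process P \<xi> M \<kappa> \<longleftrightarrow> point_process P \<xi> M \<and>
     (\<forall>f :: 'a \<times> 'a measure \<Rightarrow> real.
        f \<in> borel_measurable (M \<Otimes>\<^sub>M counting_algebra M) \<longrightarrow>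
        (\<forall>z \<in> space (M \<Otimes>\<^sub>M counting_algebra M). 0 \<le> f z) \<longrightarrow>
        (\<integral>\<^sup>+\<omega>. (\<integral>\<^sup>+x. ennreal (f (x, \<xi> \<omega>)) \<partial>\<xi> \<omega>) \<partial>P) =
        (\<integral>\<^sup>+\<omega>. (\<integral>\<^sup>+x. ennreal (f (x, add_dirac (\<xi> \<omega>) x)) * ennreal (\<kappa> x (\<xi> \<omega>)) \<partial>M) \<partial>P))"

definition gibbs_distribution ::
  "'a measure measure \<Rightarrow> 'a measure \<Rightarrow> ('a \<Rightarrow> 'a measure \<Rightarrow> real) \<Rightarrow> bool" where
  "gibbs_distribution Q M \<kappa> \<longleftrightarrow> (\<exists>(P :: 'a measure measure) \<xi>.
     gibbs_process P \<xi> M \<kappa> \<and> Q = distr P (counting_algebra M) \<xi>)"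

text \<open>\<open>\<kappa>\<^sub>m(x\<^sub>1,\<dots>,x\<^sub>m,\<mu>)\<close>, with \<open>m\<close> the length of the list.\<close>

fun kappa_list :: "('a \<Rightarrow> 'a measure \<Rightarrow> real) \<Rightarrow> 'a list \<Rightarrow> 'a measure \<Rightarrow> real" where
  "kappa_list \<kappa> [] \<mu> = 1"
| "kappa_list \<kappa> (x # xs) \<mu> = \<kappa> x \<mu> * kappa_list \<kappa> xs (add_dirac \<mu> x)"

definition enumerates :: "'a list \<Rightarrow> 'a measure \<Rightarrow> bool" where
  "enumerates xs \<mu> \<longleftrightarrow>
     set xs \<subseteq> space \<mu> \<and> \<mu> = fold (\<lambda>x \<nu>. add_dirac \<nu> x) xs (null_measure \<mu>)"

text \<open>The choice of the enumeration is immaterial, by the cocycle identity; the zero measure is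
  enumerated by the empty list only, which gives the value \<open>0\<close>.\<close>

definition hamiltonian ::
  "('a \<Rightarrow> 'a measure \<Rightarrow> real) \<Rightarrow> 'a measure \<Rightarrow> 'a measure \<Rightarrow> ereal" where
  "hamiltonian \<kappa> \<mu> \<psi> =
     (let k = kappa_list \<kappa> (SOME xs. enumerates xs \<mu>) \<psi>
      in if k = 0 then \<infinity> else ereal (- ln k))"

fun exp_minus :: "ereal \<Rightarrow> ennreal" where
  "exp_minus (ereal r) = ennreal (exp (- r))"
| "exp_minus PInfty = 0"
| "exp_minus MInfty = \<infinity>"

definition partition_fun ::
  "'a measure \<Rightarrow> ('a \<Rightarrow> 'a measure \<Rightarrow> real) \<Rightarrow> 'a set \<Rightarrow> 'a measure \<Rightarrow> ennreal" where
  "partition_fun M \<kappa> B \<psi> =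
     (\<integral>\<^sup>+\<mu>. exp_minus (hamiltonian \<kappa> \<mu> \<psi>) \<partial>poisson_law (restrict_meas M B))"

definition above :: "'a measure \<Rightarrow> ('a \<Rightarrow> real) \<Rightarrow> 'a \<Rightarrow> 'a set" where
  "above M \<phi> x = {z \<in> space M. \<phi> x < \<phi> z}"

definition below :: "'a measure \<Rightarrow> ('a \<Rightarrow> real) \<Rightarrow> 'a \<Rightarrow> 'a set" where
  "below M \<phi> x = {z \<in> space M. \<phi> z < \<phi> x}"

text \<open>The function \<open>p\<close>. In \<^typ>\<open>ennreal\<close>, \<open>\<infinity> / \<infinity> = 0\<close>.\<close>

definition retention ::
  "'a measure \<Rightarrow> ('a \<Rightarrow> 'a measure \<Rightarrow> real) \<Rightarrow> ('a \<Rightarrow> real) \<Rightarrow> 'a \<Rightarrow> 'a measure \<Rightarrow> ennreal" where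
  "retention M \<kappa> \<phi> x \<psi> =
     (let \<psi>\<^sub>x = restrict_meas \<psi> (below M \<phi> x)
      in ennreal (\<kappa> x \<psi>\<^sub>x) *
         (partition_fun M \<kappa> (above M \<phi> x) (add_dirac \<psi>\<^sub>x x) / partition_fun M \<kappa> (above M \<phi> x) \<psi>\<^sub>x))"

text \<open>Subtraction on \<^typ>\<open>ennreal\<close> is truncated, but nothing is cut off below: writing \<open>H\<close> for the
  Hamiltonian, the cocycle identity and \<open>\<kappa> \<le> \<alpha>\<close> imply
  \<open>\<kappa>(x, \<psi>) exp(-H(\<mu>, \<psi> + \<delta>\<^sub>x)) = \<kappa>(x, \<psi> + \<mu>) exp(-H(\<mu>, \<psi>)) \<le> \<alpha>(x) exp(-H(\<mu>, \<psi>))\<close>,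
  and hence \<open>p(x, \<psi>) \<le> \<alpha>(x)\<close> for all points \<open>x\<close> and all simple \<open>\<psi>\<close>.\<close>

definition thinning_weight ::
  "'a measure \<Rightarrow> ('a \<Rightarrow> 'a measure \<Rightarrow> real) \<Rightarrow> ('a \<Rightarrow> real) \<Rightarrow> ('a \<Rightarrow> real) \<Rightarrow>
   'a measure \<Rightarrow> 'a measure \<Rightarrow> ennreal" where
  "thinning_weight M \<kappa> \<alpha> \<phi> \<mu> \<psi> =
     (\<Prod>x\<in>atoms \<psi>. inverse (ennreal (\<alpha> x)) * retention M \<kappa> \<phi> x \<psi>) *
     (\<Prod>x\<in>atoms (diff_measure \<mu> \<psi>). 1 - inverse (ennreal (\<alpha> x)) * retention M \<kappa> \<phi> x \<psi>)"

text \<open>The order on \<^typ>\<open>'a measure\<close> is setwise \<open>\<le>\<close> for measures on the same \<open>\<sigma>\<close>-algebra.\<close>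

definition thinning_kernel ::
  "'a measure \<Rightarrow> ('a \<Rightarrow> 'a measure \<Rightarrow> real) \<Rightarrow> ('a \<Rightarrow> real) \<Rightarrow> ('a \<Rightarrow> real) \<Rightarrow>
   'a measure \<Rightarrow> 'a measure measure" where
  "thinning_kernel M \<kappa> \<alpha> \<phi> \<mu> =
     measure_of (space (simple_counting_algebra M)) (sets (simple_counting_algebra M))
       (\<lambda>A. \<Sum>\<psi> | \<psi> \<in> space (simple_counting_algebra M) \<and> \<psi> \<le> \<mu>.
          indicator A \<psi> * thinning_weight M \<kappa> \<alpha> \<phi> \<mu> \<psi>)"

lemma emeasure_thinning_kernel:
  assumes "A \<in> sets (simple_counting_algebra M)"
  shows "emeasure (thinning_kernel M \<kappa> \<alpha> \<phi> \<mu>) A =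
    (\<Sum>\<psi> | \<psi> \<in> space (simple_counting_algebra M) \<and> \<psi> \<le> \<mu>.
       indicator A \<psi> * thinning_weight M \<kappa> \<alpha> \<phi> \<mu> \<psi>)"
  unfolding thinning_kernel_def
proof (rule emeasure_measure_of_sigma)
  show "sigma_algebra (space (simple_counting_algebra M)) (sets (simple_counting_algebra M))" ..
  show "countably_additive (sets (simple_counting_algebra M))
    (\<lambda>A. \<Sum>\<psi> | \<psi> \<in> space (simple_counting_algebra M) \<and> \<psi> \<le> \<mu>.
       indicator A \<psi> * thinning_weight M \<kappa> \<alpha> \<phi> \<mu> \<psi>)"
    by (intro countably_additiveI)
       (simp add: suminf_sum[OF summableI] suminf_indicator ennreal_suminf_multc)
qed (use assms in \<open>auto simp: positive_def\<close>)

text \<open>The outer integral is over the simple measures, where the kernel is defined; for diffuse \<open>M\<close>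
  they carry the whole mass of the Poisson law.\<close>

definition thinned_law ::
  "'a measure \<Rightarrow> ('a \<Rightarrow> 'a measure \<Rightarrow> real) \<Rightarrow> ('a \<Rightarrow> real) \<Rightarrow> ('a \<Rightarrow> real) \<Rightarrow> 'a measure measure"
where
  "thinned_law M \<kappa> \<alpha> \<phi> =
     measure_of (space (counting_algebra M)) (sets (counting_algebra M))
       (\<lambda>A. \<integral>\<^sup>+\<mu>\<in>space (simple_counting_algebra M).
          (\<integral>\<^sup>+\<psi>. indicator A \<psi> \<partial>thinning_kernel M \<kappa> \<alpha> \<phi> \<mu>)
          \<partial>poisson_law (density M (\<lambda>x. ennreal (\<alpha> x))))"

end

theory Submission
  imports Defs
begin

text \<open>
  Integrals with respect to a Poisson law are power series in the operator that adds a point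
  integrated against the intensity. In these terms the points retained by the thinning and
  the deleted points are two independent Poisson processes reweighted by the factors of the
  kernel, and integrating out the deleted points turns \<open>\<bbbQ>\<close> into the law
  with density \<open>\<Prod>p(x, \<psi>) exp (- \<integral> p(x, \<psi>) \<lambda>(dx))\<close>
  with respect to the Poisson process with intensity \<open>\<lambda>\<close>, up to a constant. With
  \<open>G(t, \<psi>) = exp(\<lambda>(t, \<infinity>)) Z(\<psi>)\<close>, where \<open>Z\<close> is the partition
  function of \<open>(t, \<infinity>)\<close>, splitting off the lowest point gives
  \<open>G(t) = 1 + \<integral> 1{z > t} p(z) G(z) \<lambda>(dz)\<close>, so that
  \<open>G(t) = exp (\<integral> 1{z > t} p(z) \<lambda>(dz))\<close> as \<open>\<lambda>\<close> is diffuse. Hence the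
  density telescopes along the points of \<open>\<psi>\<close> to \<open>exp (- H(\<psi>, 0)) / Z(0)\<close>, for which the
  Mecke equation and the cocycle identity give the defining equation of a Gibbs process.
\<close>

section \<open>Counting measures\<close>

text \<open>\<open>poisson_law\<close> is a definite description, so nothing can be computed before
  a Poisson process is constructed and its law shown to be unique. The construction is the power
  series itself: \<open>pois\<close> normalises it by exp(-\<nu>(X)); independence is then the
  binomial theorem and the Mecke equation a product rule for that series. The second obstacle is
  measurability: the kernel sums over subconfigurations and the Hamiltonian chooses an enumeration.
  Both are rewritten through \<open>pts\<close>, the enumeration sorted by \<phi>, which is
  measurable because order statistics can be expressed by counts. The bound \<kappa> \<le> \<alpha>
  acts three times: p / \<alpha> is a probability, the partition functions are finite so that their
  ratios cancel, and the remainder of the iterated integral equation vanishes. Diffuseness also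
  excludes ties among ordered points and makes the Poisson processes simple. The constant
  exp(\<integral> \<alpha> d\<lambda>) left by the deleted points is cancelled by the normalisation
  of the Poisson law with intensity \<alpha>\<lambda>.\<close>

lemma counting_algebra_cong:
  "sets M = sets M' \<Longrightarrow> counting_algebra M = counting_algebra M'"
  unfolding counting_algebra_def by simp

lemma sets_counting_space: "\<mu> \<in> space (counting_algebra M) \<Longrightarrow> sets \<mu> = sets M"
  by (simp add: space_counting_algebra)

lemma space_counting_space: "\<mu> \<in> space (counting_algebra M) \<Longrightarrow> space \<mu> = space M"
  by (rule sets_eq_imp_space_eq[OF sets_counting_space])

lemma emeasure_counting_Nats: "\<mu> \<in> space (counting_algebra M) \<Longrightarrow> emeasure \<mu> A \<in> \<nat>"
  by (cases "A \<in> sets M")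
     (auto simp: space_counting_algebra emeasure_notin_sets)

lemma measurable_counting_algebraI:
  assumes "\<And>y. y \<in> space Y \<Longrightarrow> f y \<in> space (counting_algebra M)"
    and "\<And>B. B \<in> sets M \<Longrightarrow> (\<lambda>y. emeasure (f y) B) \<in> borel_measurable Y"
  shows "f \<in> measurable Y (counting_algebra M)"
  unfolding counting_algebra_def
  by (intro measurable_Sup2 imageI)
     (use assms in \<open>auto simp: space_counting_algebra intro!: measurable_vimage_algebra2\<close>)

lemma ennreal_Nats_E:
  fixes c :: ennreal
  assumes "c \<in> \<nat>"
  obtains n where "c = of_nat n"
  using assms by (auto elim: Nats_cases)

lemma emeasure_counting_finite: "\<mu> \<in> space (counting_algebra M) \<Longrightarrow> emeasure \<mu> A < top"
  by (metis emeasure_counting_Nats ennreal_Nats_E of_nat_less_top)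

lemma finite_measure_counting: "\<mu> \<in> space (counting_algebra M) \<Longrightarrow> finite_measure \<mu>"
  by (rule finite_measureI) (use emeasure_counting_finite[of \<mu> M] in \<open>auto simp: less_top\<close>)

lemma null_measure_cong: "sets M = sets M' \<Longrightarrow> null_measure M = null_measure M'"
  using sets_eq_imp_space_eq[of M M'] by (simp add: null_measure_def)

lemma null_measure_in_counting[simp]: "null_measure M \<in> space (counting_algebra M)"
  by (simp add: space_counting_algebra)

section \<open>Adding a point and restricting to a set\<close>

lemma sets_add_dirac[simp]: "sets (add_dirac \<mu> x) = sets \<mu>"
  and space_add_dirac[simp]: "space (add_dirac \<mu> x) = space \<mu>"
  by (simp_all add: add_dirac_def)

text \<open>A point outside the space lies in no measurable set, so adding it changes no value;
  hence counting measures are closed under adding any \<open>x\<close> of the type.\<close>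

lemma emeasure_add_dirac:
  assumes "A \<in> sets \<mu>"
  shows "emeasure (add_dirac \<mu> x) A = emeasure \<mu> A + indicator A x"
proof -
  have "emeasure (add_dirac \<mu> x) A = emeasure \<mu> A + emeasure (return \<mu> x) A"
    unfolding add_dirac_def
  proof (rule emeasure_measure_of_sigma)
    show "countably_additive (sets \<mu>) (\<lambda>A. emeasure \<mu> A + emeasure (return \<mu> x) A)"
    proof (rule countably_additiveI)
      fix F :: "nat \<Rightarrow> _" assume F: "range F \<subseteq> sets \<mu>" "disjoint_family F"
      then have F': "range F \<subseteq> sets (return \<mu> x)" by simp
      show "(\<Sum>i. emeasure \<mu> (F i) + emeasure (return \<mu> x) (F i)) =
        emeasure \<mu> (\<Union> (range F)) + emeasure (return \<mu> x) (\<Union> (range F))"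
        using suminf_emeasure[OF F] suminf_emeasure[OF F' F(2)]
        by (simp add: suminf_add[symmetric] summableI)
    qed
  qed (use assms in \<open>auto simp: positive_def sets.sigma_algebra_axioms\<close>)
  with assms show ?thesis by simp
qed

lemma sets_restrict_meas[simp]: "sets (restrict_meas \<mu> B) = sets \<mu>"
  and space_restrict_meas[simp]: "space (restrict_meas \<mu> B) = space \<mu>"
  by (simp_all add: restrict_meas_def)

text \<open>Replaces the raw \<open>measure_of\<close> by a \<open>density\<close>, which supplies
  the measure axioms and the integration rule at once.\<close>

lemma restrict_meas_eq_density:
  assumes "B \<in> sets \<mu>"
  shows "restrict_meas \<mu> B = density \<mu> (indicator B)"
proof -
  have "(\<lambda>A. if A \<in> sets \<mu> then emeasure \<mu> (B \<inter> A) else 0) = (\<lambda>A. if A \<in> sets \<mu> then \<integral>\<^sup>+x. indicator B x * indicator A x \<partial>\<mu> else 0)"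
    using assms by (auto simp: fun_eq_iff indicator_inter_arith[symmetric])
  then show ?thesis
    unfolding restrict_meas_def density_def
    by (intro measure_of_eq sets.space_closed) (auto simp: sets.sigma_sets_eq fun_eq_iff split: if_splits)
qed

lemma emeasure_restrict_meas:
  assumes "B \<in> sets \<mu>" "A \<in> sets \<mu>"
  shows "emeasure (restrict_meas \<mu> B) A = emeasure \<mu> (A \<inter> B)"
  using assms by (simp add: restrict_meas_eq_density emeasure_density indicator_inter_arith[symmetric] Int_commute)

lemma nn_integral_restrict_meas:
  assumes "B \<in> sets \<mu>" "f \<in> borel_measurable \<mu>"
  shows "(\<integral>\<^sup>+x. f x \<partial>restrict_meas \<mu> B) = (\<integral>\<^sup>+x\<in>B. f x \<partial>\<mu>)"
  using assms by (simp add: restrict_meas_eq_density nn_integral_density mult.commute)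

lemma add_dirac_in_counting[intro]:
  assumes "\<mu> \<in> space (counting_algebra M)"
  shows "add_dirac \<mu> x \<in> space (counting_algebra M)"
  using assms by (auto simp: space_counting_algebra emeasure_add_dirac indicator_def Nats_add)

lemma restrict_meas_in_counting[intro]:
  assumes "\<mu> \<in> space (counting_algebra M)" "B \<in> sets M"
  shows "restrict_meas \<mu> B \<in> space (counting_algebra M)"
  using assms by (auto simp: space_counting_algebra emeasure_restrict_meas)

lemma measurable_add_dirac[measurable (raw)]:
  assumes "f \<in> measurable Y (counting_algebra M)" "g \<in> measurable Y M"
  shows "(\<lambda>y. add_dirac (f y) (g y)) \<in> measurable Y (counting_algebra M)"
proof (rule measurable_counting_algebraI)
  show "add_dirac (f y) (g y) \<in> space (counting_algebra M)" if "y \<in> space Y" for y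
    using measurable_space[OF assms(1) that] by auto
  fix B assume B[measurable]: "B \<in> sets M"
  note [measurable] = assms measurable_emeasure_counting_algebra[OF B]
  have "(\<lambda>y. emeasure (f y) B + indicator B (g y)) \<in> borel_measurable Y"
    by measurable
  then show "(\<lambda>y. emeasure (add_dirac (f y) (g y)) B) \<in> borel_measurable Y"
    by (rule measurable_cong[THEN iffD1, rotated])
       (use B in \<open>simp add: emeasure_add_dirac sets_counting_space[OF measurable_space[OF assms(1)]]\<close>)
qed

lemma add_dirac_commute: "add_dirac (add_dirac \<mu> x) y = add_dirac (add_dirac \<mu> y) x"
  by (rule measure_eqI) (auto simp: emeasure_add_dirac add_ac)

lemma nn_integral_add_dirac:
  assumes [measurable]: "f \<in> borel_measurable \<mu>" and x: "x \<in> space \<mu>"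
  shows "(\<integral>\<^sup>+z. f z \<partial>add_dirac \<mu> x) = (\<integral>\<^sup>+z. f z \<partial>\<mu>) + f x"
proof -
  have [measurable_cong]: "sets (add_dirac \<mu> x) = sets \<mu>" by simp
  show ?thesis
    using assms(1)
  proof (induction rule: borel_measurable_induct)
    case (cong f g)
    then show ?case using x by (simp cong: nn_integral_cong_simp)
  next
    case (set A)
    then show ?case by (simp add: emeasure_add_dirac)
  next
    case (mult u c)
    then show ?case by (simp add: nn_integral_cmult distrib_left)
  next
    case (add u v)
    then show ?case by (simp add: nn_integral_add add_ac)
  next
    case (seq U)
    have 1: "(\<integral>\<^sup>+z. (SUP i. U i z) \<partial>add_dirac \<mu> x) = (SUP i. \<integral>\<^sup>+z. U i z \<partial>add_dirac \<mu> x)"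
      using seq by (intro nn_integral_monotone_convergence_SUP) auto
    have 2: "(\<integral>\<^sup>+z. (SUP i. U i z) \<partial>\<mu>) = (SUP i. \<integral>\<^sup>+z. U i z \<partial>\<mu>)"
      using seq by (intro nn_integral_monotone_convergence_SUP) auto
    have "(SUP i. \<integral>\<^sup>+z. U i z \<partial>add_dirac \<mu> x) = (SUP i. (\<integral>\<^sup>+z. U i z \<partial>\<mu>) + U i x)"
      using seq by simp
    also have "\<dots> = (SUP i. \<integral>\<^sup>+z. U i z \<partial>\<mu>) + (SUP i. U i x)"
      using seq(3) by (intro ennreal_SUP_add) (auto simp: incseq_def le_fun_def intro!: nn_integral_mono)
    finally show ?case using 1 2 by (simp add: SUP_apply[abs_def])
  qed
qed

section \<open>Configurations built from lists of points\<close>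

text \<open>The fold of \<open>enumerates\<close>, but over an arbitrary start: the weights in
  \<open>kappa_list\<close> add points on top of a boundary configuration.\<close>

definition adds :: "'a measure \<Rightarrow> 'a list \<Rightarrow> 'a measure" where
  "adds \<mu> xs = fold (\<lambda>x \<nu>. add_dirac \<nu> x) xs \<mu>"

lemma adds_Nil[simp]: "adds \<mu> [] = \<mu>"
  and adds_Cons[simp]: "adds \<mu> (x # xs) = adds (add_dirac \<mu> x) xs"
  and adds_append: "adds \<mu> (xs @ ys) = adds (adds \<mu> xs) ys"
  by (simp_all add: adds_def)

lemma sets_adds[simp]: "sets (adds \<mu> xs) = sets \<mu>"
  by (induction xs arbitrary: \<mu>) auto

lemma space_adds[simp]: "space (adds \<mu> xs) = space \<mu>"
  by (induction xs arbitrary: \<mu>) auto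

lemma adds_in_counting[intro]:
  "\<mu> \<in> space (counting_algebra M) \<Longrightarrow> adds \<mu> xs \<in> space (counting_algebra M)"
  by (induction xs arbitrary: \<mu>) auto

lemma emeasure_adds:
  "A \<in> sets \<mu> \<Longrightarrow> emeasure (adds \<mu> xs) A = emeasure \<mu> A + of_nat (length (filter (\<lambda>x. x \<in> A) xs))"
  by (induction xs arbitrary: \<mu>) (auto simp: emeasure_add_dirac add_ac)

lemma nn_integral_adds:
  assumes "f \<in> borel_measurable \<mu>" "set xs \<subseteq> space \<mu>"
  shows "(\<integral>\<^sup>+z. f z \<partial>adds \<mu> xs) = (\<integral>\<^sup>+z. f z \<partial>\<mu>) + (\<Sum>x\<leftarrow>xs. f x)"
  using assms
proof (induction xs arbitrary: \<mu>)
  case (Cons x xs)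
  have "f \<in> borel_measurable (add_dirac \<mu> x)"
    using Cons.prems(1) by (simp cong: measurable_cong_sets)
  with Cons show ?case by (simp add: nn_integral_add_dirac add_ac)
qed simp

lemma adds_eq_mset: "mset xs = mset ys \<Longrightarrow> adds \<mu> xs = adds \<mu> ys"
proof (rule measure_eqI)
  fix A assume "mset xs = mset ys" "A \<in> sets (adds \<mu> xs)"
  moreover from this(1) have "length (filter (\<lambda>x. x \<in> A) xs) = length (filter (\<lambda>x. x \<in> A) ys)"
    by (metis mset_filter size_mset)
  ultimately show "emeasure (adds \<mu> xs) A = emeasure (adds \<mu> ys) A"
    by (simp add: emeasure_adds)
qed simp

lemma enumerates_iff:
  assumes "\<mu> \<in> space (counting_algebra M)"
  shows "enumerates xs \<mu> \<longleftrightarrow> set xs \<subseteq> space M \<and> \<mu> = adds (null_measure M) xs"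
  using assms unfolding enumerates_def adds_def
  by (metis null_measure_cong sets_counting_space space_counting_space)

section \<open>Measurable enumeration of configurations over a Borel space\<close>

text \<open>The map \<phi> has two tasks: it orders the points, and its measurable inverse carries
  the measurability of real order statistics back to points.\<close>

locale borel_emb =
  fixes M :: "'a measure" and \<phi> :: "'a \<Rightarrow> real"
  assumes emb: "borel_embedding M \<phi>"
begin

abbreviation \<N> :: "'a measure measure" where "\<N> \<equiv> counting_algebra M"

lemma phi_measurable[measurable]: "\<phi> \<in> borel_measurable M"
  and inj_phi: "inj_on \<phi> (space M)"
  and the_inv_measurable: "the_inv_into (space M) \<phi> \<in> measurable (restrict_space borel (\<phi> ` space M)) M"
  using emb by (auto simp: borel_embedding_def)

lemma vimage_phi_singleton: "x \<in> space M \<Longrightarrow> \<phi> -` {\<phi> x} \<inter> space M = {x}"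
  using inj_phi by (auto simp: inj_on_def)

lemma singleton_sets[measurable, intro, simp]: assumes "x \<in> space M" shows "{x} \<in> sets M"
proof -
  have "\<phi> -` {\<phi> x} \<inter> space M \<in> sets M" by measurable
  then show ?thesis using assms by (simp add: vimage_phi_singleton)
qed

lemma emeasure_ge_1:
  assumes "\<mu> \<in> space \<N>" "emeasure \<mu> A \<noteq> 0"
  shows "1 \<le> emeasure \<mu> A"
proof -
  obtain n where "emeasure \<mu> A = of_nat n"
    using emeasure_counting_Nats[OF assms(1)] ennreal_Nats_E by metis
  with assms(2) show ?thesis by (cases n) auto
qed

text \<open>Pushed forward by \<phi>, the measure has a distribution function without values
  strictly between 0 and 1. It therefore jumps from 0 to at least 1 at one place, and right
  continuity puts that mass on the place itself.\<close>

lemma ex_atom: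
  assumes \<mu>: "\<mu> \<in> space \<N>" and nz: "emeasure \<mu> (space M) \<noteq> 0"
  shows "\<exists>x\<in>space M. 1 \<le> emeasure \<mu> {x}"
proof -
  have [measurable_cong, simp]: "sets \<mu> = sets M" and sp[simp]: "space \<mu> = space M"
    using \<mu> by (simp_all add: sets_counting_space space_counting_space)
  interpret \<mu>: finite_measure \<mu> using \<mu> by (rule finite_measure_counting)
  let ?D = "distr \<mu> borel \<phi>"
  interpret D: finite_measure ?D by (rule \<mu>.finite_measure_distr) measurable
  interpret finite_borel_measure ?D by standard simp
  have meas: "measure ?D A = measure \<mu> (\<phi> -` A \<inter> space M)" if "A \<in> sets borel" for A
    using that by (subst measure_distr) auto
  have nat: "measure \<mu> A < 1 \<Longrightarrow> measure \<mu> A = 0" for A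
    using emeasure_ge_1[OF \<mu>, of A] by (force simp: \<mu>.emeasure_eq_measure)
  have cdf0: "cdf ?D t < 1 \<Longrightarrow> cdf ?D t = 0" for t
    using nat by (simp add: cdf_def meas)
  \<comment> \<open>The jump is at the infimum of this set: \<open>t1\<close> shows that it is
    nonempty and \<open>t2\<close> bounds it below, both by the limits of the distribution
    function.\<close>
  define S where "S = {t. cdf ?D t \<ge> 1}"
  have tot: "measure ?D (space ?D) \<ge> 1"
    using nat[of "space M"] nz by (force simp: meas \<mu>.emeasure_eq_measure)
  have "eventually (\<lambda>t. cdf ?D t > 1/2) at_top"
    using order_tendstoD(1)[OF cdf_lim_at_top, of "1/2"] tot by simp
  then obtain t1 where "cdf ?D t1 > 1/2" by (auto simp: eventually_at_top_linorder)
  then have "t1 \<in> S" using cdf0[of t1] by (force simp: S_def)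
  have "eventually (\<lambda>t. cdf ?D t < 1) at_bot"
    using order_tendstoD(2)[OF cdf_lim_at_bot, of 1] by simp
  then obtain t2 where t2: "\<And>t. t \<le> t2 \<Longrightarrow> cdf ?D t < 1" by (auto simp: eventually_at_bot_linorder)
  have bdd: "bdd_below S"
    proof (rule bdd_belowI[of _ t2])
    show "t2 \<le> s" if "s \<in> S" for s by (rule ccontr) (use that t2[of s] in \<open>auto simp: S_def\<close>)
  qed
  define t0 where "t0 = Inf S"
  have below: "cdf ?D t = 0" if "t < t0" for t
    using that cInf_lower[OF _ bdd, of t] cdf0[of t] by (force simp: t0_def S_def)
  have above: "cdf ?D t \<ge> 1" if t: "t0 < t" for t
  proof -
    obtain s where "s \<in> S" "s < t"
      using cInf_less_iff[of S t] t \<open>t1 \<in> S\<close> bdd unfolding t0_def by blast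
    then show ?thesis using cdf_nondecreasing[of s t] by (simp add: S_def)
  qed
  \<comment> \<open>The left limit of the distribution function is the mass strictly below
    \<open>t0\<close>.\<close>
  have "measure ?D {..<t0} = 0"
  proof (rule tendsto_unique[OF _ cdf_at_left])
    show "(cdf ?D \<longlongrightarrow> 0) (at_left t0)"
      by (rule tendsto_eventually) (auto simp: eventually_at_left_field intro!: exI[of _ "t0 - 1"] below)
  qed simp
  moreover have "cdf ?D t0 \<ge> 1"
  proof (rule tendsto_lowerbound)
    show "(cdf ?D \<longlongrightarrow> cdf ?D t0) (at_right t0)"
      using cdf_is_right_cont[of t0] by (simp add: continuous_within)
    show "\<forall>\<^sub>F t in at_right t0. 1 \<le> cdf ?D t"
      by (auto simp: eventually_at_right_field intro!: exI[of _ "t0 + 1"] above)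
  qed simp
  moreover have "cdf ?D t0 = measure ?D {..<t0} + measure ?D {t0}"
    unfolding cdf_def by (subst D.finite_measure_Union[symmetric]) (auto intro!: arg_cong[where f="measure ?D"])
  ultimately have m: "measure ?D {t0} \<ge> 1" by simp
  then have m': "measure \<mu> (\<phi> -` {t0} \<inter> space M) \<ge> 1" by (simp add: meas)
  \<comment> \<open>Positive mass forces \<open>t0\<close> into the image of \<phi>, and injectivity
    makes its preimage a single point.\<close>
  then have "\<phi> -` {t0} \<inter> space M \<noteq> {}" by force
  then obtain x where x: "x \<in> space M" "\<phi> x = t0" by auto
  then have "measure \<mu> {x} \<ge> 1" using m' vimage_phi_singleton[of x] by simp
  with x show ?thesis by (auto simp: \<mu>.emeasure_eq_measure)
qed

text \<open>Induction on the total mass, a natural number: \<open>ex_atom\<close> supplies a point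
  that can be subtracted.\<close>

lemma ex_enumeration:
  assumes "\<mu> \<in> space \<N>"
  shows "\<exists>xs. set xs \<subseteq> space M \<and> \<mu> = adds (null_measure M) xs"
proof -
  obtain n where "emeasure \<mu> (space M) = of_nat n"
    using emeasure_counting_Nats[OF assms(1)] ennreal_Nats_E by metis
  with assms show ?thesis
  proof (induction n arbitrary: \<mu>)
    case 0
    then have "\<mu> = null_measure M"
      by (intro measure_eqI) (auto simp: space_counting_algebra intro: emeasure_eq_0[of "space M"] dest: sets.sets_into_space)
    then show ?case by (intro exI[of _ "[]"]) auto
  next
    case (Suc n)
    note \<mu> = \<open>\<mu> \<in> space \<N>\<close>
    have sets[measurable_cong, simp]: "sets \<mu> = sets M" and sp[simp]: "space \<mu> = space M"
      using \<mu> by (simp_all add: sets_counting_space space_counting_space)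
    interpret \<mu>: finite_measure \<mu> using \<mu> by (rule finite_measure_counting)
    obtain x where x: "x \<in> space M" "1 \<le> emeasure \<mu> {x}"
      using ex_atom[OF \<mu>] Suc.prems by auto
    interpret r: finite_measure "return M x"
      using x by (intro prob_space.finite_measure prob_space_return)
    \<comment> \<open>Makes the truncated subtraction below exact.\<close>
    have ge: "indicator A x \<le> emeasure \<mu> A" if "A \<in> sets M" for A
      using emeasure_mono[of "{x}" A \<mu>] x that by (auto simp: indicator_def)
    define \<mu>' where "\<mu>' = diff_measure \<mu> (return M x)"
    have em: "emeasure \<mu>' A = emeasure \<mu> A - indicator A x" if "A \<in> sets M" for A
      unfolding \<mu>'_def using that ge
      by (subst emeasure_diff_measure) (auto simp: \<mu>.finite_measure_axioms r.finite_measure_axioms)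
    have sets': "sets \<mu>' = sets M" by (simp add: \<mu>'_def)
    have eq: "\<mu> = add_dirac \<mu>' x"
      by (rule measure_eqI) (auto simp: sets' em emeasure_add_dirac ge diff_add_cancel_ennreal)
    have nat: "emeasure \<mu>' A \<in> \<nat>" if A: "A \<in> sets M" for A
    proof -
      obtain k where "emeasure \<mu> A = of_nat k" using emeasure_counting_Nats[OF \<mu>] ennreal_Nats_E by metis
      then have "emeasure \<mu>' A = of_nat (k - indicator A x)"
        using em[OF A] ge[OF A] by (cases k) (auto simp: indicator_def)
      then show ?thesis by simp
    qed
    have \<mu>': "\<mu>' \<in> space \<N>"
      using nat sets' by (simp add: space_counting_algebra)
    have "emeasure \<mu>' (space M) = of_nat n"
      using Suc.prems(2) x em[of "space M"] by simp
    from Suc.IH[OF \<mu>' this] obtain xs where xs: "set xs \<subseteq> space M" "\<mu>' = adds (null_measure M) xs"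
      by blast
    show ?case
      by (intro exI[of _ "xs @ [x]"]) (use xs x eq in \<open>auto simp: adds_append\<close>)
  qed
qed

text \<open>The multiplicity of a point is the mass of its singleton, and singletons are measurable
  through \<phi>.\<close>

lemma adds_mset_eq:
  assumes "set xs \<subseteq> space M" "set ys \<subseteq> space M" "adds (null_measure M) xs = adds (null_measure M) ys"
  shows "mset xs = mset ys"
proof (rule multiset_eqI)
  fix x
  show "count (mset xs) x = count (mset ys) x"
  proof (cases "x \<in> space M")
    case True
    have "count (mset zs) x = length (filter (\<lambda>z. z \<in> {x}) zs)" for zs
      by (induction zs) auto
    with True arg_cong[OF assms(3), of "\<lambda>\<mu>. emeasure \<mu> {x}"] show ?thesis
      by (simp add: emeasure_adds)
  next
    case False
    with assms show ?thesis by (metis count_mset_0_iff subsetD)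
  qed
qed

text \<open>As \<phi> is injective, only equal points are tied after sorting. The list is therefore
  unique, and unlike a choice by SOME it can be shown to depend measurably on the
  configuration.\<close>

definition pts :: "'a measure \<Rightarrow> 'a list" where
  "pts \<mu> = (THE xs. set xs \<subseteq> space M \<and> sorted (map \<phi> xs) \<and> \<mu> = adds (null_measure M) xs)"

lemma sorted_phi_unique:
  assumes "set xs \<subseteq> space M" "set ys \<subseteq> space M" "sorted (map \<phi> xs)" "sorted (map \<phi> ys)" "mset xs = mset ys"
  shows "xs = ys"
proof -
  have "map \<phi> xs = map \<phi> ys"
    using assms by (metis mset_map properties_for_sort)
  then show ?thesis
    using assms inj_phi by (intro map_inj_on[of \<phi>]) (auto intro: inj_on_subset)
qed

lemma pts_unique:
  assumes "set xs \<subseteq> space M" "sorted (map \<phi> xs)"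
  shows "pts (adds (null_measure M) xs) = xs"
  unfolding pts_def using assms
  by (intro the_equality) (auto intro!: sorted_phi_unique adds_mset_eq)

lemma pts:
  assumes "\<mu> \<in> space \<N>"
  shows set_pts: "set (pts \<mu>) \<subseteq> space M" and sorted_pts: "sorted (map \<phi> (pts \<mu>))"
    and adds_pts: "adds (null_measure M) (pts \<mu>) = \<mu>"
proof -
  obtain xs where xs: "set xs \<subseteq> space M" "\<mu> = adds (null_measure M) xs"
    using ex_enumeration[OF assms] by blast
  let ?ys = "sort_key \<phi> xs"
  have "\<mu> = adds (null_measure M) ?ys" using xs by (auto intro: adds_eq_mset)
  moreover have "set ?ys \<subseteq> space M" "sorted (map \<phi> ?ys)" using xs by auto
  ultimately show "set (pts \<mu>) \<subseteq> space M" "sorted (map \<phi> (pts \<mu>))" "adds (null_measure M) (pts \<mu>) = \<mu>"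
    using pts_unique[of ?ys] by auto
qed

lemma emeasure_pts:
  assumes "\<mu> \<in> space \<N>" "A \<in> sets M"
  shows "emeasure \<mu> A = of_nat (length (filter (\<lambda>x. x \<in> A) (pts \<mu>)))"
  using emeasure_adds[of A "null_measure M" "pts \<mu>"] assms by (simp add: adds_pts)

lemma emeasure_space_pts:
  assumes "\<mu> \<in> space \<N>"
  shows "emeasure \<mu> (space M) = of_nat (length (pts \<mu>))"
proof -
  have "filter (\<lambda>x. x \<in> space M) (pts \<mu>) = pts \<mu>"
    using set_pts[OF assms] by (auto simp: filter_id_conv)
  then show ?thesis using emeasure_pts[OF assms, of "space M"] by simp
qed

lemma nn_integral_pts:
  assumes "\<mu> \<in> space \<N>" "f \<in> borel_measurable M"
  shows "(\<integral>\<^sup>+z. f z \<partial>\<mu>) = (\<Sum>x\<leftarrow>pts \<mu>. f x)"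
  using nn_integral_adds[of f "null_measure M" "pts \<mu>"] assms set_pts[OF assms(1)]
  by (simp add: adds_pts cong: measurable_cong_sets)

text \<open>Turns an order statistic into a count; counts are the evaluations that generate the
  \<sigma>-field, which is how \<open>pts\<close> becomes measurable. The index starts at 0, hence
  \<open>Suc i\<close>.\<close>

lemma sorted_nth_le_iff:
  fixes xs :: "real list"
  assumes "sorted xs" "i < length xs"
  shows "xs ! i \<le> t \<longleftrightarrow> Suc i \<le> length (filter (\<lambda>x. x \<le> t) xs)"
  using assms
proof (induction xs arbitrary: i)
  case (Cons a xs)
  show ?case
  proof (cases "a \<le> t")
    case True
    with Cons show ?thesis by (cases i) auto
  next
    case False
    have "\<forall>x\<in>set (a # xs). \<not> x \<le> t" using False Cons.prems by force
    then have "filter (\<lambda>x. x \<le> t) (a # xs) = []" "\<not> (a # xs) ! i \<le> t"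
      using Cons.prems nth_mem by (blast intro: filter_False)+
    then show ?thesis by simp
  qed
qed simp

lemma emeasure_measurable[measurable]:
  "B \<in> sets M \<Longrightarrow> (\<lambda>\<mu>. emeasure \<mu> B) \<in> borel_measurable \<N>"
  by (rule measurable_emeasure_counting_algebra)

lemma length_pts_measurable[measurable]:
  "{\<mu> \<in> space \<N>. length (pts \<mu>) = n} \<in> sets \<N>"
proof -
  have "{\<mu> \<in> space \<N>. length (pts \<mu>) = n} =
      {\<mu> \<in> space \<N>. emeasure \<mu> (space M) = of_nat n}"
    by (auto simp: emeasure_space_pts)
  also have "\<dots> \<in> sets \<N>"
    by measurable
  finally show ?thesis .
qed

lemma pts_nth_measurable:
  assumes "i < n"
  shows "(\<lambda>\<mu>. pts \<mu> ! i) \<in> measurable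
     (restrict_space \<N> {\<mu> \<in> space \<N>. length (pts \<mu>) = n}) M"
    (is "_ \<in> measurable ?R M")
proof -
  have sp: "space ?R = {\<mu> \<in> space \<N>. length (pts \<mu>) = n}"
    by (auto simp: space_restrict_space)
  have inM: "pts \<mu> ! i \<in> space M" if "\<mu> \<in> space ?R" for \<mu>
    using that assms set_pts[of \<mu>] nth_mem[of i "pts \<mu>"] by (auto simp: sp)
  have "(\<lambda>\<mu>. \<phi> (pts \<mu> ! i)) \<in> borel_measurable ?R"
  proof (rule borel_measurable_iff_le[THEN iffD2], rule allI)
    fix t
    have eq: "\<phi> (pts \<mu> ! i) \<le> t \<longleftrightarrow> of_nat (Suc i) \<le> emeasure \<mu> {x\<in>space M. \<phi> x \<le> t}" if "\<mu> \<in> space ?R" for \<mu>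
    proof -
      have \<mu>: "\<mu> \<in> space \<N>" "length (pts \<mu>) = n" using that sp by auto
      have "filter (\<lambda>x. x \<in> {x\<in>space M. \<phi> x \<le> t}) (pts \<mu>) = filter (\<lambda>x. \<phi> x \<le> t) (pts \<mu>)"
        using set_pts[OF \<mu>(1)] by (intro filter_cong) auto
      then have "emeasure \<mu> {x\<in>space M. \<phi> x \<le> t} = of_nat (length (filter (\<lambda>x. x \<le> t) (map \<phi> (pts \<mu>))))"
        using emeasure_pts[OF \<mu>(1), of "{x\<in>space M. \<phi> x \<le> t}"] by (simp add: filter_map o_def)
      moreover have "\<phi> (pts \<mu> ! i) = map \<phi> (pts \<mu>) ! i" using assms \<mu> by simp
      ultimately show ?thesis
        using sorted_nth_le_iff[OF sorted_pts[OF \<mu>(1)], of i t] assms \<mu>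
        by (simp only: of_nat_le_iff) simp
    qed
    have "{\<mu> \<in> space ?R. \<phi> (pts \<mu> ! i) \<le> t} = {\<mu> \<in> space ?R. of_nat (Suc i) \<le> emeasure \<mu> {x\<in>space M. \<phi> x \<le> t}}"
      using eq by auto
    also have "\<dots> = {\<mu> \<in> space \<N>. of_nat (Suc i) \<le> emeasure \<mu> {x\<in>space M. \<phi> x \<le> t}} \<inter> space ?R"
      by (auto simp: sp)
    also have "\<dots> \<in> sets ?R"
    proof -
      have "{\<mu> \<in> space \<N>. of_nat (Suc i) \<le> emeasure \<mu> {x\<in>space M. \<phi> x \<le> t}} \<in> sets \<N>"
        by measurable
      then show ?thesis unfolding sets_restrict_space sp by (subst Int_commute) (rule imageI)
    qed
    finally show "{\<mu> \<in> space ?R. \<phi> (pts \<mu> ! i) \<le> t} \<in> sets ?R" .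
  qed
  \<comment> \<open>The measurable image and inverse of \<phi> turn the real order statistic into a
    point of the space.\<close>
  then have "(\<lambda>\<mu>. \<phi> (pts \<mu> ! i)) \<in> measurable ?R (restrict_space borel (\<phi> ` space M))"
    using inM by (intro measurable_restrict_space2) auto
  from measurable_compose[OF this the_inv_measurable]
  show ?thesis
    by (rule measurable_cong[THEN iffD1, rotated])
       (use inM inj_phi in \<open>simp add: the_inv_into_f_f\<close>)
qed

text \<open>The number of points splits the configurations into countably many measurable pieces; on
  each of them the list comes from a measurable vector in a finite product. All measurability of
  functions of the enumerated points is derived from this.\<close>

lemma measurable_pts:
  assumes F: "\<And>n. (\<lambda>(y, \<omega>). F y (map \<omega> [0..<n])) \<in> measurable (Y \<Otimes>\<^sub>M PiM {..<n} (\<lambda>_. M)) Z"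
  shows "(\<lambda>(y, \<mu>). F y (pts \<mu>)) \<in> measurable (Y \<Otimes>\<^sub>M \<N>) Z"
proof -
  define C where "C n = {\<mu> \<in> space \<N>. length (pts \<mu>) = n}" for n
  have C[measurable]: "C n \<in> sets \<N>" for n unfolding C_def by measurable
  show ?thesis
  proof (rule measurable_piecewise_restrict[of "range (\<lambda>n. space Y \<times> C n)"])
    show "space (Y \<Otimes>\<^sub>M \<N>) \<subseteq> \<Union> (range (\<lambda>n. space Y \<times> C n))"
      by (auto simp: space_pair_measure C_def)
    fix \<Omega> assume "\<Omega> \<in> range (\<lambda>n. space Y \<times> C n)"
    then obtain n where \<Omega>: "\<Omega> = space Y \<times> C n" by auto
    show "\<Omega> \<inter> space (Y \<Otimes>\<^sub>M \<N>) \<in> sets (Y \<Otimes>\<^sub>M \<N>)"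
      unfolding \<Omega> by (intro sets.Int) auto
    let ?R = "restrict_space (Y \<Otimes>\<^sub>M \<N>) \<Omega>"
    have spR: "space ?R = space Y \<times> C n"
      by (auto simp: space_restrict_space \<Omega> space_pair_measure C_def)
    have snd: "snd \<in> measurable ?R (restrict_space \<N> (C n))"
      by (intro measurable_restrict_space2 measurable_restrict_space1 measurable_snd) (auto simp: spR)
    have "(\<lambda>w. \<lambda>i\<in>{..<n}. pts (snd w) ! i) \<in> measurable ?R (PiM {..<n} (\<lambda>_. M))"
      using measurable_compose[OF snd pts_nth_measurable[folded C_def]]
      by (intro measurable_restrict) auto
    then have "(\<lambda>w. (fst w, \<lambda>i\<in>{..<n}. pts (snd w) ! i)) \<in> measurable ?R (Y \<Otimes>\<^sub>M PiM {..<n} (\<lambda>_. M))"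
      by (rule measurable_Pair[OF measurable_restrict_space1[OF measurable_fst]])
    from measurable_compose[OF this F[of n]]
    show "(\<lambda>(y, \<mu>). F y (pts \<mu>)) \<in> measurable ?R Z"
    proof (rule measurable_cong[THEN iffD1, rotated])
      fix w assume "w \<in> space ?R"
      then have "length (pts (snd w)) = n" by (auto simp: spR C_def)
      then have "map (\<lambda>i\<in>{..<n}. pts (snd w) ! i) [0..<n] = pts (snd w)"
        by (intro nth_equalityI) auto
      then show "(case (fst w, \<lambda>i\<in>{..<n}. pts (snd w) ! i) of (y, \<omega>) \<Rightarrow> F y (map \<omega> [0..<n])) =
          (case w of (y, \<mu>) \<Rightarrow> F y (pts \<mu>))"
        by (simp add: case_prod_beta)
    qed
  qed simp
qed

text \<open>The integrating measure itself is the variable; as a finite sum over \<open>pts\<close>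
  the integral falls under \<open>measurable_pts\<close>.\<close>

lemma measurable_nn_integral_counting:
  assumes f: "(\<lambda>(y, x). f y x) \<in> borel_measurable (Y \<Otimes>\<^sub>M M)"
  shows "(\<lambda>(y, \<mu>). \<integral>\<^sup>+x. f y x \<partial>\<mu>) \<in> borel_measurable (Y \<Otimes>\<^sub>M \<N>)"
proof -
  note [measurable (raw)] = measurable_compose[OF measurable_Pair f, simplified]
  have "(\<lambda>(y, \<mu>). \<Sum>x\<leftarrow>pts \<mu>. f y x) \<in> borel_measurable (Y \<Otimes>\<^sub>M \<N>)"
  proof (rule measurable_pts)
    fix n :: nat
    have "(\<lambda>w. \<Sum>i<n. f (fst w) (snd w i)) \<in> borel_measurable (Y \<Otimes>\<^sub>M PiM {..<n} (\<lambda>_. M))"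
      by measurable
    then show "(\<lambda>(y, \<omega>). \<Sum>x\<leftarrow>map \<omega> [0..<n]. f y x) \<in> borel_measurable (Y \<Otimes>\<^sub>M PiM {..<n} (\<lambda>_. M))"
      by (simp add: case_prod_beta o_def interv_sum_list_conv_sum_set_nat atLeast0LessThan)
  qed
  then show ?thesis
    by (rule measurable_cong[THEN iffD1, rotated])
       (auto simp: space_pair_measure intro!: nn_integral_pts[symmetric])
qed

text \<open>The set may vary with the parameter, because \<open>\<psi>\<^sub>x\<close> depends
  jointly on x and \<psi>.\<close>

lemma measurable_restrict_meas:
  assumes [measurable]: "{w \<in> space (Y \<Otimes>\<^sub>M M). snd w \<in> B (fst w)} \<in> sets (Y \<Otimes>\<^sub>M M)"
    and B: "\<And>y. y \<in> space Y \<Longrightarrow> B y \<in> sets M"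
  shows "(\<lambda>(y, \<mu>). restrict_meas \<mu> (B y)) \<in> measurable (Y \<Otimes>\<^sub>M \<N>) \<N>"
proof (rule measurable_counting_algebraI)
  fix w assume "w \<in> space (Y \<Otimes>\<^sub>M \<N>)"
  then show "(case w of (y, \<mu>) \<Rightarrow> restrict_meas \<mu> (B y)) \<in> space \<N>"
    by (auto simp: space_pair_measure B)
next
  fix A assume A[measurable]: "A \<in> sets M"
  have "(\<lambda>w. indicator A (snd w) * indicator {w \<in> space (Y \<Otimes>\<^sub>M M). snd w \<in> B (fst w)} w :: ennreal) \<in> borel_measurable (Y \<Otimes>\<^sub>M M)"
    by measurable
  then have "(\<lambda>(y, x). indicator (A \<inter> B y) x :: ennreal) \<in> borel_measurable (Y \<Otimes>\<^sub>M M)"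
    by (rule measurable_cong[THEN iffD1, rotated]) (auto simp: space_pair_measure indicator_def)
  from measurable_nn_integral_counting[OF this]
  show "(\<lambda>w. emeasure (case w of (y, \<mu>) \<Rightarrow> restrict_meas \<mu> (B y)) A) \<in> borel_measurable (Y \<Otimes>\<^sub>M \<N>)"
    by (rule measurable_cong[THEN iffD1, rotated])
       (use A B in \<open>auto simp: space_pair_measure emeasure_restrict_meas sets_counting_space\<close>)
qed

section \<open>Simple configurations\<close>

definition simple :: "'a measure set" where
  "simple = {\<mu> \<in> space \<N>. \<forall>x\<in>space M. emeasure \<mu> {x} \<le> 1}"

lemma space_simple: "space (simple_counting_algebra M) = simple"
  by (auto simp: simple_counting_algebra_def simple_def space_restrict_space)

lemma simple_in_counting: "\<mu> \<in> simple \<Longrightarrow> \<mu> \<in> space \<N>"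
  by (simp add: simple_def)

lemma emeasure_singleton_pts:
  assumes "\<mu> \<in> space \<N>" "x \<in> space M"
  shows "emeasure \<mu> {x} = of_nat (count (mset (pts \<mu>)) x)"
proof -
  have "length (filter (\<lambda>z. z \<in> {x}) zs) = count (mset zs) x" for zs
    by (induction zs) auto
  with emeasure_pts[OF assms(1), of "{x}"] assms(2) show ?thesis by simp
qed

lemma simple_iff_distinct:
  assumes "\<mu> \<in> space \<N>"
  shows "\<mu> \<in> simple \<longleftrightarrow> distinct (pts \<mu>)"
proof
  assume "\<mu> \<in> simple"
  then have "count (mset (pts \<mu>)) x \<le> 1" if "x \<in> set (pts \<mu>)" for x
  proof -
    have x: "x \<in> space M" using that set_pts[OF assms] by auto
    then have "of_nat (count (mset (pts \<mu>)) x) \<le> (1 :: ennreal)"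
      using \<open>\<mu> \<in> simple\<close> emeasure_singleton_pts[OF assms x] by (auto simp: simple_def)
    then show ?thesis using of_nat_le_iff[of _ 1] by simp
  qed
  then show "distinct (pts \<mu>)"
    unfolding distinct_count_atmost_1
    using count_greater_zero_iff[of "mset (pts \<mu>)"]
    by (auto simp: count_mset_0_iff intro!: le_antisym Suc_leI)
next
  assume "distinct (pts \<mu>)"
  then have "count (mset (pts \<mu>)) x \<le> 1" for x
    by (auto simp: distinct_count_atmost_1)
  then show "\<mu> \<in> simple"
    using assms by (simp add: simple_def emeasure_singleton_pts)
qed

lemma simple_measurable[measurable]: "simple \<in> sets \<N>"
proof -
  \<comment> \<open>The one-point space fills the parameter slot of
    \<open>measurable_pts\<close>.\<close>
  have "(\<lambda>(y, \<mu>). distinct (pts \<mu>)) \<in> measurable (count_space (UNIV :: unit set) \<Otimes>\<^sub>M \<N>) (count_space UNIV)"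
  proof (rule measurable_pts)
    fix n :: nat
    let ?P = "count_space (UNIV :: unit set) \<Otimes>\<^sub>M PiM {..<n} (\<lambda>_. M)"
    \<comment> \<open>Points are compared through \<phi>, since equality of real values is a
      measurable condition.\<close>
    have "Measurable.pred ?P (\<lambda>w. \<forall>i\<in>{..<n}. \<forall>j\<in>{..<n}. i \<noteq> j \<longrightarrow> \<phi> (snd w i) \<noteq> \<phi> (snd w j))"
    proof (intro pred_intros_finite)
      fix i j assume [measurable]: "i \<in> {..<n}" "j \<in> {..<n}"
      show "Measurable.pred ?P (\<lambda>w. i \<noteq> j \<longrightarrow> \<phi> (snd w i) \<noteq> \<phi> (snd w j))"
        by measurable
    qed auto
    then show "(\<lambda>(y, \<omega>). distinct (map \<omega> [0..<n])) \<in> measurable ?P (count_space UNIV)"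
    proof (rule measurable_cong[THEN iffD1, rotated])
      fix w assume "w \<in> space ?P"
      then have "snd w i \<in> space M" if "i < n" for i
        using that by (auto simp: space_pair_measure space_PiM PiE_iff mem_Times_iff)
      then have "\<phi> (snd w i) = \<phi> (snd w j) \<longleftrightarrow> snd w i = snd w j" if "i < n" "j < n" for i j
        using that inj_on_eq_iff[OF inj_phi] by blast
      then show "(\<forall>i\<in>{..<n}. \<forall>j\<in>{..<n}. i \<noteq> j \<longrightarrow> \<phi> (snd w i) \<noteq> \<phi> (snd w j)) =
          (case w of (y, \<omega>) \<Rightarrow> distinct (map \<omega> [0..<n]))"
        by (auto simp: case_prod_beta distinct_conv_nth)
    qed
  qed
  from measurable_compose[OF measurable_Pair1' this, of "()"]
  have "Measurable.pred \<N> (\<lambda>\<mu>. distinct (pts \<mu>))" by simp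
  then have "{\<mu> \<in> space \<N>. distinct (pts \<mu>)} \<in> sets \<N>" by measurable
  also have "{\<mu> \<in> space \<N>. distinct (pts \<mu>)} = simple"
    using simple_iff_distinct simple_in_counting by auto
  finally show ?thesis .
qed

lemma atoms_eq:
  assumes "\<mu> \<in> space \<N>"
  shows "atoms \<mu> = set (pts \<mu>)"
proof -
  have "atoms \<mu> = {x \<in> space M. 0 < count (mset (pts \<mu>)) x}"
    unfolding atoms_def using assms
    by (auto simp: space_counting_space emeasure_singleton_pts)
  then show ?thesis using set_pts[OF assms] by (auto simp: count_greater_zero_iff)
qed

lemma null_measure_simple[simp]: "null_measure M \<in> simple"
  by (simp add: simple_def)

lemma pts_null[simp]: "pts (null_measure M) = []"
  using pts_unique[of "[]"] by simp

lemma add_dirac_simple: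
  assumes "\<mu> \<in> simple" "x \<in> space M" "x \<notin> atoms \<mu>"
  shows "add_dirac \<mu> x \<in> simple"
proof -
  note \<mu> = simple_in_counting[OF assms(1)]
  have "emeasure (add_dirac \<mu> x) {y} \<le> 1" if "y \<in> space M" for y
    using assms that \<mu> by (auto simp: emeasure_add_dirac sets_counting_space simple_def atoms_def
        space_counting_space indicator_def)
  then show ?thesis using \<mu> by (auto simp: simple_def)
qed

lemma atoms_add_dirac:
  assumes "\<mu> \<in> space \<N>" "x \<in> space M"
  shows "atoms (add_dirac \<mu> x) = insert x (atoms \<mu>)"
  using assms
  by (auto simp: atoms_def emeasure_add_dirac sets_counting_space space_counting_space indicator_def
      zero_less_iff_neq_zero)

lemma finite_atoms: "\<mu> \<in> space \<N> \<Longrightarrow> finite (atoms \<mu>)"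
  by (simp add: atoms_eq)

end

section \<open>Exponential functionals and the Poisson law\<close>

text \<open>If \<open>T f \<psi> = \<integral> f(\<psi> + \<delta>\<^sub>x) \<nu>(dx)\<close>, then \<open>pins \<nu> n\<close> is \<open>T\<^sup>n / n!\<close> and \<open>pexp \<nu>\<close> is \<open>exp T\<close>.\<close>

fun pins :: "'a measure \<Rightarrow> nat \<Rightarrow> ('a measure \<Rightarrow> ennreal) \<Rightarrow> 'a measure \<Rightarrow> ennreal" where
  "pins \<nu> 0 f \<psi> = f \<psi>"
| "pins \<nu> (Suc n) f \<psi> = inverse (of_nat (Suc n)) * (\<integral>\<^sup>+x. pins \<nu> n f (add_dirac \<psi> x) \<partial>\<nu>)"

declare pins.simps(2)[simp del]

lemma ennreal_of_nat_Suc_inverse: "of_nat (Suc n) * inverse (of_nat (Suc n) :: ennreal) = 1"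
  using ennreal_divide_self[of "of_nat (Suc n)"] of_nat_less_top[of "Suc n"]
  by (simp add: divide_ennreal_def del: of_nat_Suc)

lemma of_nat_Suc_inverse_cancel: "of_nat (Suc n) * (inverse (of_nat (Suc n)) * (a::ennreal)) = a"
  by (simp only: mult.assoc[symmetric] ennreal_of_nat_Suc_inverse mult_1)

text \<open>Recurrences for \<open>pins\<close> are proved after multiplication by n + 1, where the
  integral stands alone; this removes the factor, which is finite and nonzero.\<close>

lemma of_nat_Suc_cancel: "of_nat (Suc n) * a = of_nat (Suc n) * (b::ennreal) \<Longrightarrow> a = b"
proof -
  assume *: "of_nat (Suc n) * a = of_nat (Suc n) * b"
  have "inverse (of_nat (Suc n)) * (of_nat (Suc n) * c) = c" for c :: ennreal
    by (subst mult.left_commute) (rule of_nat_Suc_inverse_cancel)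
  from this[of a] this[of b] * show ?thesis by metis
qed

lemma pins_Suc_mult:
  "of_nat (Suc n) * pins \<nu> (Suc n) f \<psi> = (\<integral>\<^sup>+x. pins \<nu> n f (add_dirac \<psi> x) \<partial>\<nu>)"
  by (simp only: pins.simps of_nat_Suc_inverse_cancel)

text \<open>Adding a fixed point commutes with adding the integrated ones.\<close>

lemma pins_shift: "pins \<nu> n (\<lambda>\<mu>. f (add_dirac \<mu> x)) \<psi> = pins \<nu> n f (add_dirac \<psi> x)"
  by (induction n arbitrary: \<psi>) (auto simp: pins.simps add_dirac_commute[of _ x])

definition pexp :: "'a measure \<Rightarrow> ('a measure \<Rightarrow> ennreal) \<Rightarrow> 'a measure \<Rightarrow> ennreal" where
  "pexp \<nu> f \<psi> = (\<Sum>n. pins \<nu> n f \<psi>)"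

text \<open>If T1 and T2 add a point, integrated against \<open>\<nu>1\<close> or
  \<open>\<nu>2\<close>, to the first or the second configuration, this is (T1 + T2)^n / n!.\<close>

fun pins2 :: "'a measure \<Rightarrow> 'a measure \<Rightarrow> nat \<Rightarrow> ('a measure \<Rightarrow> 'a measure \<Rightarrow> ennreal) \<Rightarrow>
    'a measure \<Rightarrow> 'a measure \<Rightarrow> ennreal" where
  "pins2 \<nu>1 \<nu>2 0 g \<sigma> \<tau> = g \<sigma> \<tau>"
| "pins2 \<nu>1 \<nu>2 (Suc n) g \<sigma> \<tau> = inverse (of_nat (Suc n)) *
     ((\<integral>\<^sup>+x. pins2 \<nu>1 \<nu>2 n g (add_dirac \<sigma> x) \<tau> \<partial>\<nu>1) + (\<integral>\<^sup>+x. pins2 \<nu>1 \<nu>2 n g \<sigma> (add_dirac \<tau> x) \<partial>\<nu>2))"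

declare pins2.simps(2)[simp del]

lemma pins2_Suc_mult:
  "of_nat (Suc n) * pins2 \<nu>1 \<nu>2 (Suc n) g \<sigma> \<tau> =
     (\<integral>\<^sup>+x. pins2 \<nu>1 \<nu>2 n g (add_dirac \<sigma> x) \<tau> \<partial>\<nu>1) + (\<integral>\<^sup>+x. pins2 \<nu>1 \<nu>2 n g \<sigma> (add_dirac \<tau> x) \<partial>\<nu>2)"
  by (simp only: pins2.simps of_nat_Suc_inverse_cancel)

lemma suminf_nat_swap:
  fixes f :: "nat \<Rightarrow> nat \<Rightarrow> ennreal"
  shows "(\<Sum>i. \<Sum>j. f i j) = (\<Sum>j. \<Sum>i. f i j)"
proof -
  have "(\<Sum>i. \<Sum>j. f i j) = (\<integral>\<^sup>+i. (\<Sum>j. f i j) \<partial>count_space UNIV)"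
    by (simp add: nn_integral_count_space_nat)
  also have "\<dots> = (\<Sum>j. \<integral>\<^sup>+i. f i j \<partial>count_space UNIV)"
    by (intro nn_integral_suminf) auto
  finally show ?thesis by (simp add: nn_integral_count_space_nat)
qed

lemma suminf_Cauchy_product:
  fixes a :: "nat \<Rightarrow> nat \<Rightarrow> ennreal"
  shows "(\<Sum>n. \<Sum>k\<le>n. a k (n - k)) = (\<Sum>k. \<Sum>l. a k l)"
proof -
  have "(\<Sum>n. \<Sum>k\<le>n. a k (n - k)) = (\<Sum>n. \<Sum>k. if k \<le> n then a k (n - k) else 0)"
    by (intro suminf_cong) (subst suminf_finite[of "{..n}" for n], auto)
  also have "\<dots> = (\<Sum>k. \<Sum>n. if k \<le> n then a k (n - k) else 0)"
    by (rule suminf_nat_swap)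
  also have "\<dots> = (\<Sum>k. \<Sum>l. a k l)"
  proof (rule suminf_cong)
    fix k
    show "(\<Sum>n. if k \<le> n then a k (n - k) else 0) = (\<Sum>l. a k l)"
      using suminf_offset[OF summableI, of "\<lambda>n. if k \<le> n then a k (n - k) else 0" k] by simp
  qed
  finally show ?thesis .
qed

lemma suminf_ennreal_exp:
  assumes "0 \<le> x"
  shows "(\<Sum>n. ennreal (x ^ n / fact n)) = ennreal (exp x)"
proof -
  have "(\<lambda>n. x ^ n / fact n) sums exp x"
    using exp_converges[of x] by (simp add: divide_inverse mult.commute)
  then show ?thesis
    using assms by (intro suminf_ennreal_eq) auto
qed

lemma ennreal_mult_power_fact:
  assumes "0 \<le> m"
  shows "inverse (of_nat (Suc n)) * (ennreal m * ennreal (m ^ n / fact n)) = ennreal (m ^ Suc n / fact (Suc n))"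
proof (rule of_nat_Suc_cancel)
  have "of_nat (Suc n) * ennreal (m ^ Suc n / fact (Suc n)) = ennreal (real (Suc n) * (m ^ Suc n / fact (Suc n)))"
    unfolding ennreal_of_nat_eq_real_of_nat by (rule ennreal_mult[symmetric]) (use assms in auto)
  also have "real (Suc n) * (m ^ Suc n / fact (Suc n)) = m * (m ^ n / fact n)"
    by (simp add: field_simps del: of_nat_Suc)
  also have "ennreal \<dots> = ennreal m * ennreal (m ^ n / fact n)"
    using assms by (intro ennreal_mult) auto
  finally show "of_nat (Suc n) * (inverse (of_nat (Suc n)) * (ennreal m * ennreal (m ^ n / fact n))) =
      of_nat (Suc n) * ennreal (m ^ Suc n / fact (Suc n))"
    by (simp only: of_nat_Suc_inverse_cancel)
qed

context borel_emb
begin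

section \<open>Measurability, linearity and continuity of the power series\<close>

text \<open>All intensities share the measurable sets of \<open>M\<close>, so that they define one
  and the same configuration space.\<close>

definition intens :: "'a measure \<Rightarrow> bool" where
  "intens \<nu> \<longleftrightarrow> finite_measure \<nu> \<and> sets \<nu> = sets M"

lemma intens_finite: "intens \<nu> \<Longrightarrow> finite_measure \<nu>"
  and intens_sigma_finite: "intens \<nu> \<Longrightarrow> sigma_finite_measure \<nu>"
  and intens_sets[measurable_cong]: "intens \<nu> \<Longrightarrow> sets \<nu> = sets M"
  by (auto simp: intens_def finite_measure.axioms)

lemma intens_space: "intens \<nu> \<Longrightarrow> space \<nu> = space M"
  by (auto simp: intens_def dest: sets_eq_imp_space_eq)

lemma intens_restrict: "intens \<nu> \<Longrightarrow> B \<in> sets M \<Longrightarrow> intens (restrict_meas \<nu> B)"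
  using emeasure_restrict_meas[of B \<nu> "space \<nu>"] sets.top[of \<nu>]
  by (auto simp: intens_def finite_measure.emeasure_finite intro!: finite_measureI)

text \<open>Function and configuration both depend on the parameter: Tonelli is applied to
  integrands in which the integrated point occurs in both places.\<close>

lemma pins_measurable[measurable (raw)]:
  assumes \<nu>: "intens \<nu>"
    and f: "(\<lambda>(w, \<psi>). f w \<psi>) \<in> borel_measurable (W \<Otimes>\<^sub>M \<N>)"
    and k: "k \<in> measurable W \<N>"
  shows "(\<lambda>w. pins \<nu> n (f w) (k w)) \<in> borel_measurable W"
proof -
  interpret sigma_finite_measure \<nu> using \<nu> by (rule intens_sigma_finite)
  note [measurable_cong] = intens_sets[OF \<nu>]
  have "(\<lambda>(w, \<psi>). pins \<nu> n (f w) \<psi>) \<in> borel_measurable (W \<Otimes>\<^sub>M \<N>)"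
  proof (induction n)
    case 0
    then show ?case using f by simp
  next
    case (Suc n)
    have [measurable]: "snd \<in> measurable ((W \<Otimes>\<^sub>M \<N>) \<Otimes>\<^sub>M \<nu>) M"
      using measurable_snd[of "W \<Otimes>\<^sub>M \<N>" \<nu>] measurable_cong_sets[OF refl intens_sets[OF \<nu>]] by blast
    have "(\<lambda>w. (fst (fst w), add_dirac (snd (fst w)) (snd w))) \<in>
        measurable ((W \<Otimes>\<^sub>M \<N>) \<Otimes>\<^sub>M \<nu>) (W \<Otimes>\<^sub>M \<N>)"
      by measurable
    from measurable_compose[OF this Suc]
    have "(\<lambda>(w, x). pins \<nu> n (f (fst w)) (add_dirac (snd w) x)) \<in>
        borel_measurable ((W \<Otimes>\<^sub>M \<N>) \<Otimes>\<^sub>M \<nu>)"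
      by (simp add: case_prod_beta)
    then have "(\<lambda>w. \<integral>\<^sup>+x. pins \<nu> n (f (fst w)) (add_dirac (snd w) x) \<partial>\<nu>) \<in>
        borel_measurable (W \<Otimes>\<^sub>M \<N>)"
      by (rule borel_measurable_nn_integral)
    then show ?case
      by (simp add: pins.simps case_prod_beta)
  qed
  from measurable_compose[OF measurable_Pair[OF measurable_ident k] this]
  show ?thesis by simp
qed

lemma pins_measurable1[measurable]:
  "intens \<nu> \<Longrightarrow> f \<in> borel_measurable \<N> \<Longrightarrow>
    pins \<nu> n f \<in> borel_measurable \<N>"
  by (rule pins_measurable[of \<nu> "\<lambda>_. f" _ "\<lambda>x. x"]) auto

lemma add_dirac_measurable_nu:
  assumes "intens \<nu>" "\<psi> \<in> space \<N>" "f \<in> borel_measurable \<N>" "intens \<nu>'"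
  shows "(\<lambda>x. pins \<nu>' n f (add_dirac \<psi> x)) \<in> borel_measurable \<nu>"
proof -
  have "(\<lambda>x. add_dirac \<psi> x) \<in> measurable \<nu> \<N>"
    using assms by (intro measurable_add_dirac measurable_ident_sets intens_sets) auto
  from measurable_compose[OF this pins_measurable1[OF assms(4,3)]] show ?thesis .
qed

text \<open>Started in a set that adding a point leaves only on a null set of points, the expansion
  sees a function on that set alone. The sets used are all configurations and the simple
  ones.\<close>

lemma pins_cong:
  assumes "\<And>\<psi>. \<psi> \<in> S \<Longrightarrow> AE x in \<nu>. add_dirac \<psi> x \<in> S" "\<And>\<psi>. \<psi> \<in> S \<Longrightarrow> f \<psi> = g \<psi>" "\<psi> \<in> S"
  shows "pins \<nu> n f \<psi> = pins \<nu> n g \<psi>"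
  using assms(3)
proof (induction n arbitrary: \<psi>)
  case (Suc n)
  have "AE x in \<nu>. pins \<nu> n f (add_dirac \<psi> x) = pins \<nu> n g (add_dirac \<psi> x)"
    using assms(1)[OF Suc.prems] by eventually_elim (rule Suc.IH)
  then show ?case by (auto simp: pins.simps intro!: arg_cong2[where f="(*)"] nn_integral_cong_AE)
qed (simp add: assms)

lemma pexp_cong:
  assumes "\<And>\<psi>. \<psi> \<in> S \<Longrightarrow> AE x in \<nu>. add_dirac \<psi> x \<in> S" "\<And>\<psi>. \<psi> \<in> S \<Longrightarrow> f \<psi> = g \<psi>" "\<psi> \<in> S"
  shows "pexp \<nu> f \<psi> = pexp \<nu> g \<psi>"
  unfolding pexp_def by (intro suminf_cong pins_cong[OF assms])

lemma AE_add_dirac_counting: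
  "\<psi> \<in> space \<N> \<Longrightarrow> AE x in \<nu>. add_dirac \<psi> x \<in> space \<N>"
  by auto

text \<open>A configuration has finitely many atoms, and a diffuse measure does not charge them.
  With \<open>pexp_cong\<close> this restricts integrands to simple configurations.\<close>

lemma AE_add_dirac_simple:
  assumes \<nu>: "intens \<nu>" "diffuse \<nu>" and \<psi>: "\<psi> \<in> simple"
  shows "AE x in \<nu>. add_dirac \<psi> x \<in> simple"
proof -
  have at: "finite (atoms \<psi>)" "atoms \<psi> \<subseteq> space M"
    using finite_atoms[OF simple_in_counting[OF \<psi>]] simple_in_counting[OF \<psi>]
    by (auto simp: atoms_def space_counting_space)
  have "AE x in \<nu>. x \<notin> atoms \<psi>"
  proof (rule AE_I')
    have "(\<Union>x\<in>atoms \<psi>. {x}) \<in> null_sets \<nu>"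
      using at \<nu> by (intro null_sets_UN') (auto simp: countable_finite null_sets_def diffuse_def intens_sets intens_space)
    then show "atoms \<psi> \<in> null_sets \<nu>" by simp
  qed auto
  then show ?thesis
    using AE_space by eventually_elim (auto intro!: add_dirac_simple \<psi> simp: intens_space[OF \<nu>(1)])
qed

lemma pins_cmult:
  assumes \<nu>: "intens \<nu>" and f: "f \<in> borel_measurable \<N>"
    and \<psi>: "\<psi> \<in> space \<N>"
  shows "pins \<nu> n (\<lambda>\<mu>. c * f \<mu>) \<psi> = c * pins \<nu> n f \<psi>"
  using \<psi>
proof (induction n arbitrary: \<psi>)
  case (Suc n)
  have "(\<integral>\<^sup>+x. pins \<nu> n (\<lambda>\<mu>. c * f \<mu>) (add_dirac \<psi> x) \<partial>\<nu>) = (\<integral>\<^sup>+x. c * pins \<nu> n f (add_dirac \<psi> x) \<partial>\<nu>)"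
    by (intro nn_integral_cong Suc.IH add_dirac_in_counting Suc.prems)
  also have "\<dots> = c * (\<integral>\<^sup>+x. pins \<nu> n f (add_dirac \<psi> x) \<partial>\<nu>)"
    by (intro nn_integral_cmult add_dirac_measurable_nu \<nu> Suc.prems f)
  finally show ?case by (simp add: pins.simps mult_ac)
qed simp

lemma pexp_cmult:
  assumes "intens \<nu>" "f \<in> borel_measurable \<N>" "\<psi> \<in> space \<N>"
  shows "pexp \<nu> (\<lambda>\<mu>. c * f \<mu>) \<psi> = c * pexp \<nu> f \<psi>"
  unfolding pexp_def by (simp add: pins_cmult[OF assms])

text \<open>Tonelli, one added point at a time. Taking \<rho> to be counting measure gives the
  exchange with series in \<open>pins_suminf\<close>.\<close>

lemma pins_nn_integral:
  assumes \<nu>: "intens \<nu>" and \<rho>: "sigma_finite_measure \<rho>"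
    and f: "(\<lambda>(y, \<psi>). f y \<psi>) \<in> borel_measurable (\<rho> \<Otimes>\<^sub>M \<N>)"
    and \<psi>: "\<psi> \<in> space \<N>"
  shows "(\<integral>\<^sup>+y. pins \<nu> n (f y) \<psi> \<partial>\<rho>) = pins \<nu> n (\<lambda>\<psi>. \<integral>\<^sup>+y. f y \<psi> \<partial>\<rho>) \<psi>"
  using \<psi>
proof (induction n arbitrary: \<psi>)
  case (Suc n)
  interpret \<nu>: sigma_finite_measure \<nu> using \<nu> by (rule intens_sigma_finite)
  interpret \<rho>: sigma_finite_measure \<rho> by (rule \<rho>)
  interpret P: pair_sigma_finite \<rho> \<nu> ..
  note [measurable_cong] = intens_sets[OF \<nu>]
  note [measurable] = \<nu> f Suc.prems
  have [measurable]: "snd \<in> measurable (\<rho> \<Otimes>\<^sub>M \<nu>) M"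
    using measurable_snd[of \<rho> \<nu>] measurable_cong_sets[OF refl intens_sets[OF \<nu>]] by blast
  have m: "(\<lambda>(y, x). pins \<nu> n (f y) (add_dirac \<psi> x)) \<in> borel_measurable (\<rho> \<Otimes>\<^sub>M \<nu>)"
    unfolding case_prod_beta
    by (rule pins_measurable[OF \<nu>]) measurable
  have m': "(\<lambda>y. \<integral>\<^sup>+x. pins \<nu> n (f y) (add_dirac \<psi> x) \<partial>\<nu>) \<in> borel_measurable \<rho>"
    using m by measurable
  have "(\<integral>\<^sup>+y. pins \<nu> (Suc n) (f y) \<psi> \<partial>\<rho>) =
      inverse (of_nat (Suc n)) * (\<integral>\<^sup>+y. \<integral>\<^sup>+x. pins \<nu> n (f y) (add_dirac \<psi> x) \<partial>\<nu> \<partial>\<rho>)"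
    unfolding pins.simps by (rule nn_integral_cmult[OF m'])
  also have "(\<integral>\<^sup>+y. \<integral>\<^sup>+x. pins \<nu> n (f y) (add_dirac \<psi> x) \<partial>\<nu> \<partial>\<rho>) =
      (\<integral>\<^sup>+x. \<integral>\<^sup>+y. pins \<nu> n (f y) (add_dirac \<psi> x) \<partial>\<rho> \<partial>\<nu>)"
    by (rule P.Fubini'[symmetric, OF m])
  also have "\<dots> = (\<integral>\<^sup>+x. pins \<nu> n (\<lambda>\<psi>. \<integral>\<^sup>+y. f y \<psi> \<partial>\<rho>) (add_dirac \<psi> x) \<partial>\<nu>)"
    by (intro nn_integral_cong Suc.IH add_dirac_in_counting Suc.prems)
  finally show ?case by (simp add: pins.simps)
qed simp

lemma pins_suminf:
  assumes \<nu>: "intens \<nu>" and f: "\<And>i. f i \<in> borel_measurable \<N>"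
    and \<psi>: "\<psi> \<in> space \<N>"
  shows "(\<Sum>i::nat. pins \<nu> n (f i) \<psi>) = pins \<nu> n (\<lambda>\<psi>. \<Sum>i. f i \<psi>) \<psi>"
proof -
  have "(\<lambda>(i, \<psi>). f i \<psi>) \<in> borel_measurable (count_space UNIV \<Otimes>\<^sub>M \<N>)"
    by (rule measurable_pair_measure_countable1) (auto simp: f)
  from pins_nn_integral[OF \<nu> sigma_finite_measure_count_space this \<psi>, of n]
  show ?thesis by (simp add: nn_integral_count_space_nat)
qed

lemma pexp_nn_integral:
  assumes \<nu>: "intens \<nu>" and \<rho>: "sigma_finite_measure \<rho>"
    and f: "(\<lambda>(y, \<psi>). f y \<psi>) \<in> borel_measurable (\<rho> \<Otimes>\<^sub>M \<N>)"
    and \<psi>: "\<psi> \<in> space \<N>"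
  shows "(\<integral>\<^sup>+y. pexp \<nu> (f y) \<psi> \<partial>\<rho>) = pexp \<nu> (\<lambda>\<psi>. \<integral>\<^sup>+y. f y \<psi> \<partial>\<rho>) \<psi>"
proof -
  have "(\<lambda>y. pins \<nu> n (f y) \<psi>) \<in> borel_measurable \<rho>" for n
    by (rule pins_measurable[OF \<nu> f]) (use \<psi> in auto)
  then show ?thesis
    unfolding pexp_def by (subst nn_integral_suminf) (auto simp: pins_nn_integral[OF assms])
qed

lemma pexp_suminf:
  assumes \<nu>: "intens \<nu>" and f: "\<And>i. f i \<in> borel_measurable \<N>"
    and \<psi>: "\<psi> \<in> space \<N>"
  shows "(\<Sum>i::nat. pexp \<nu> (f i) \<psi>) = pexp \<nu> (\<lambda>\<psi>. \<Sum>i. f i \<psi>) \<psi>"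
  unfolding pexp_def by (subst suminf_nat_swap) (simp add: pins_suminf[OF assms])

lemma pins_add:
  assumes \<nu>: "intens \<nu>" and fg: "f \<in> borel_measurable \<N>" "g \<in> borel_measurable \<N>"
    and \<psi>: "\<psi> \<in> space \<N>"
  shows "pins \<nu> n (\<lambda>\<mu>. f \<mu> + g \<mu>) \<psi> = pins \<nu> n f \<psi> + pins \<nu> n g \<psi>"
  using \<psi>
proof (induction n arbitrary: \<psi>)
  case (Suc n)
  have "(\<integral>\<^sup>+x. pins \<nu> n (\<lambda>\<mu>. f \<mu> + g \<mu>) (add_dirac \<psi> x) \<partial>\<nu>) =
      (\<integral>\<^sup>+x. pins \<nu> n f (add_dirac \<psi> x) + pins \<nu> n g (add_dirac \<psi> x) \<partial>\<nu>)"
    by (intro nn_integral_cong Suc.IH add_dirac_in_counting Suc.prems)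
  also have "\<dots> = (\<integral>\<^sup>+x. pins \<nu> n f (add_dirac \<psi> x) \<partial>\<nu>) + (\<integral>\<^sup>+x. pins \<nu> n g (add_dirac \<psi> x) \<partial>\<nu>)"
    by (intro nn_integral_add add_dirac_measurable_nu \<nu> Suc.prems fg)
  finally show ?case by (simp add: pins.simps distrib_left)
qed simp

lemma pexp_add:
  assumes "intens \<nu>" "f \<in> borel_measurable \<N>" "g \<in> borel_measurable \<N>"
    and "\<psi> \<in> space \<N>"
  shows "pexp \<nu> (\<lambda>\<mu>. f \<mu> + g \<mu>) \<psi> = pexp \<nu> f \<psi> + pexp \<nu> g \<psi>"
  unfolding pexp_def pins_add[OF assms] by (intro suminf_add[symmetric] summableI)

lemma pins_mono:
  assumes "\<And>\<mu>. f \<mu> \<le> g \<mu>"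
  shows "pins \<nu> n f \<psi> \<le> pins \<nu> n g \<psi>"
  by (induction n arbitrary: \<psi>) (auto simp: pins.simps assms intro!: mult_left_mono nn_integral_mono)

lemma pins_SUP:
  assumes \<nu>: "intens \<nu>" and U: "\<And>i::nat. U i \<in> borel_measurable \<N>" "incseq U"
    and \<psi>: "\<psi> \<in> space \<N>"
  shows "pins \<nu> n (\<lambda>\<mu>. SUP i. U i \<mu>) \<psi> = (SUP i. pins \<nu> n (U i) \<psi>)"
  using \<psi>
proof (induction n arbitrary: \<psi>)
  case (Suc n)
  have "(\<integral>\<^sup>+x. pins \<nu> n (\<lambda>\<mu>. SUP i. U i \<mu>) (add_dirac \<psi> x) \<partial>\<nu>) =
      (\<integral>\<^sup>+x. (SUP i. pins \<nu> n (U i) (add_dirac \<psi> x)) \<partial>\<nu>)"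
    by (intro nn_integral_cong Suc.IH add_dirac_in_counting Suc.prems)
  also have "\<dots> = (SUP i. \<integral>\<^sup>+x. pins \<nu> n (U i) (add_dirac \<psi> x) \<partial>\<nu>)"
    using U(2)
    by (intro nn_integral_monotone_convergence_SUP add_dirac_measurable_nu \<nu> Suc.prems U(1))
       (auto simp: incseq_def le_fun_def intro!: pins_mono)
  finally show ?case by (simp add: pins.simps SUP_mult_left_ennreal)
qed simp

lemma pexp_SUP:
  assumes "intens \<nu>" and U: "\<And>i::nat. U i \<in> borel_measurable \<N>" "incseq U"
    and "\<psi> \<in> space \<N>"
  shows "pexp \<nu> (\<lambda>\<mu>. SUP i. U i \<mu>) \<psi> = (SUP i. pexp \<nu> (U i) \<psi>)"
  unfolding pexp_def pins_SUP[OF assms]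
  using U(2) by (intro ennreal_suminf_SUP_eq) (auto simp: incseq_def le_fun_def intro!: pins_mono)

lemma pins_const:
  assumes \<nu>: "intens \<nu>"
  shows "pins \<nu> n (\<lambda>_. c) \<psi> = ennreal (measure \<nu> (space M) ^ n / fact n) * c"
proof (induction n arbitrary: \<psi>)
  case (Suc n)
  interpret finite_measure \<nu> using \<nu> by (rule intens_finite)
  show ?case
    unfolding pins.simps Suc
    using ennreal_mult_power_fact[of "measure \<nu> (space M)" n, symmetric]
    by (simp add: intens_space[OF \<nu>] emeasure_eq_measure mult_ac)
qed simp

lemma pexp_const:
  assumes \<nu>: "intens \<nu>"
  shows "pexp \<nu> (\<lambda>_. c) \<psi> = ennreal (exp (measure \<nu> (space M))) * c"
  unfolding pexp_def pins_const[OF \<nu>]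
  by (simp only: ennreal_suminf_multc suminf_ennreal_exp[OF measure_nonneg])

section \<open>The Poisson law as a normalised exponential\<close>

text \<open>An explicit candidate: with n points added to the empty configuration, the n-th term is
  the part of the Poisson law on n points. \<open>poisson_law_eq_pois\<close> identifies it with the
  definite description.\<close>

definition pois :: "'a measure \<Rightarrow> 'a measure measure" where
  "pois \<nu> = measure_of (space \<N>) (sets \<N>)
     (\<lambda>A. ennreal (exp (- measure \<nu> (space M))) * pexp \<nu> (indicator A) (null_measure M))"

lemma sets_pois[simp, measurable_cong]: "sets (pois \<nu>) = sets \<N>"
  and space_pois[simp]: "space (pois \<nu>) = space \<N>"
  by (simp_all add: pois_def)

lemma emeasure_pois:
  assumes \<nu>: "intens \<nu>" and A: "A \<in> sets \<N>"
  shows "emeasure (pois \<nu>) A = ennreal (exp (- measure \<nu> (space M))) * pexp \<nu> (indicator A) (null_measure M)"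
  unfolding pois_def
proof (rule emeasure_measure_of_sigma)
  show "sigma_algebra (space \<N>) (sets \<N>)" ..
  show "positive (sets \<N>)
     (\<lambda>A. ennreal (exp (- measure \<nu> (space M))) * pexp \<nu> (indicator A) (null_measure M))"
    using pexp_const[OF \<nu>, of 0] by (simp add: positive_def indicator_def[abs_def])
  show "countably_additive (sets \<N>)
     (\<lambda>A. ennreal (exp (- measure \<nu> (space M))) * pexp \<nu> (indicator A) (null_measure M))"
  proof (rule countably_additiveI)
    fix F :: "nat \<Rightarrow> _" assume F: "range F \<subseteq> sets \<N>" "disjoint_family F"
    have "(\<Sum>i. pexp \<nu> (indicator (F i)) (null_measure M)) = pexp \<nu> (\<lambda>\<psi>. \<Sum>i. indicator (F i) \<psi>) (null_measure M)"
      using F by (intro pexp_suminf \<nu>) auto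
    then show "(\<Sum>i. ennreal (exp (- measure \<nu> (space M))) * pexp \<nu> (indicator (F i)) (null_measure M)) =
        ennreal (exp (- measure \<nu> (space M))) * pexp \<nu> (indicator (\<Union> (range F))) (null_measure M)"
      by (simp add: suminf_indicator[OF F(2)])
  qed
qed fact

lemma nn_integral_pois:
  assumes \<nu>: "intens \<nu>" and f: "f \<in> borel_measurable \<N>"
  shows "(\<integral>\<^sup>+\<mu>. f \<mu> \<partial>pois \<nu>) = ennreal (exp (- measure \<nu> (space M))) * pexp \<nu> f (null_measure M)"
proof -
  let ?c = "ennreal (exp (- measure \<nu> (space M)))"
  have e: "pexp \<nu> f (null_measure M) = pexp \<nu> g (null_measure M)"
    if "\<And>\<psi>. \<psi> \<in> space \<N> \<Longrightarrow> f \<psi> = g \<psi>" for f g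
    by (rule pexp_cong[OF AE_add_dirac_counting that]) auto
  have "(\<integral>\<^sup>+\<mu>. f \<mu> \<partial>pois \<nu>) = ?c * pexp \<nu> f (null_measure M)"
    using f
  proof (induction rule: borel_measurable_induct)
    case (cong f g)
    have "(\<integral>\<^sup>+\<mu>. f \<mu> \<partial>pois \<nu>) = (\<integral>\<^sup>+\<mu>. g \<mu> \<partial>pois \<nu>)"
      using cong by (intro nn_integral_cong) auto
    with e[of f g] cong show ?case by simp
  next
    case (set A)
    then show ?case by (simp add: emeasure_pois[OF \<nu>])
  next
    case (mult u c)
    then show ?case by (simp add: nn_integral_cmult pexp_cmult[OF \<nu>] mult_ac)
  next
    case (add u v)
    have "pexp \<nu> (\<lambda>\<psi>. v \<psi> + u \<psi>) (null_measure M) = pexp \<nu> v (null_measure M) + pexp \<nu> u (null_measure M)"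
      using add by (intro pexp_add \<nu>) auto
    with add show ?case by (simp add: nn_integral_add distrib_left)
  next
    case (seq U)
    have "(\<integral>\<^sup>+\<mu>. (SUP i. U i \<mu>) \<partial>pois \<nu>) = (SUP i. \<integral>\<^sup>+\<mu>. U i \<mu> \<partial>pois \<nu>)"
      using seq by (intro nn_integral_monotone_convergence_SUP) auto
    also have "\<dots> = (SUP i. ?c * pexp \<nu> (U i) (null_measure M))"
      using seq by simp
    also have "\<dots> = ?c * pexp \<nu> (\<lambda>\<mu>. SUP i. U i \<mu>) (null_measure M)"
      using seq by (subst pexp_SUP[OF \<nu>]) (auto simp: SUP_mult_left_ennreal)
    finally show ?case by (simp add: SUP_apply[abs_def])
  qed
  then show ?thesis .
qed

section \<open>Binomial expansion and complete independence\<close>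

text \<open>The binomial theorem for the commuting operators T1 and T2, with n! divided out.\<close>

lemma pins2_eq_sum:
  assumes \<nu>1: "intens \<nu>1" and \<nu>2: "intens \<nu>2"
    and g: "(\<lambda>(\<sigma>, \<tau>). g \<sigma> \<tau>) \<in> borel_measurable (\<N> \<Otimes>\<^sub>M \<N>)"
    and \<sigma>: "\<sigma> \<in> space \<N>" and \<tau>: "\<tau> \<in> space \<N>"
  shows "pins2 \<nu>1 \<nu>2 n g \<sigma> \<tau> = (\<Sum>k\<le>n. pins \<nu>1 k (\<lambda>\<sigma>. pins \<nu>2 (n - k) (g \<sigma>) \<tau>) \<sigma>)"
  using \<sigma> \<tau>
proof (induction n arbitrary: \<sigma> \<tau>)
  case (Suc n)
  define A where "A k l \<sigma> \<tau> = pins \<nu>1 k (\<lambda>\<sigma>. pins \<nu>2 l (g \<sigma>) \<tau>) \<sigma>" for k l \<sigma> \<tau>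
  note [measurable_cong] = intens_sets[OF \<nu>1] intens_sets[OF \<nu>2]
  have [measurable]: "snd \<in> measurable (\<nu>2 \<Otimes>\<^sub>M \<N>) \<N>"
    "fst \<in> measurable (\<nu>2 \<Otimes>\<^sub>M \<N>) M"
    using measurable_fst[of \<nu>2 "\<N>"] measurable_cong_sets[OF refl intens_sets[OF \<nu>2]] by blast+
  have ad: "(\<lambda>x. add_dirac \<tau> x) \<in> measurable \<nu>2 \<N>"
    using Suc.prems by (intro measurable_add_dirac measurable_ident_sets intens_sets \<nu>2) auto
  have m2: "(\<lambda>\<sigma>. pins \<nu>2 l (g \<sigma>) \<tau>) \<in> borel_measurable \<N>" if "\<tau> \<in> space \<N>" for l \<tau>
    by (rule pins_measurable[OF \<nu>2 g]) (use that in auto)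
  have m1: "(\<lambda>x. A k l (add_dirac \<sigma> x) \<tau>) \<in> borel_measurable \<nu>1" for k l
    unfolding A_def by (rule add_dirac_measurable_nu[OF \<nu>1 Suc.prems(1) m2[OF Suc.prems(2)] \<nu>1])
  have m4: "(\<lambda>(x, \<sigma>). pins \<nu>2 l (g \<sigma>) (add_dirac \<tau> x)) \<in> borel_measurable (\<nu>2 \<Otimes>\<^sub>M \<N>)" for l
    unfolding case_prod_beta
  proof (rule pins_measurable[OF \<nu>2])
    have "(\<lambda>w. (snd (fst w), snd w)) \<in>
        measurable ((\<nu>2 \<Otimes>\<^sub>M \<N>) \<Otimes>\<^sub>M \<N>) (\<N> \<Otimes>\<^sub>M \<N>)"
      by measurable
    from measurable_compose[OF this g]
    show "(\<lambda>(w, \<psi>). g (snd w) \<psi>) \<in> borel_measurable ((\<nu>2 \<Otimes>\<^sub>M \<N>) \<Otimes>\<^sub>M \<N>)"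
      by (simp add: case_prod_beta)
    show "(\<lambda>w. add_dirac \<tau> (fst w)) \<in> measurable (\<nu>2 \<Otimes>\<^sub>M \<N>) \<N>"
      by (rule measurable_compose[OF measurable_fst ad])
  qed
  have m3: "(\<lambda>x. A k l \<sigma> (add_dirac \<tau> x)) \<in> borel_measurable \<nu>2" for k l
    unfolding A_def
    by (rule pins_measurable[OF \<nu>1 m4]) (use Suc.prems in auto)
  have 1: "(\<integral>\<^sup>+x. A k l (add_dirac \<sigma> x) \<tau> \<partial>\<nu>1) = of_nat (Suc k) * A (Suc k) l \<sigma> \<tau>" for k l
    unfolding A_def by (rule pins_Suc_mult[symmetric])
  \<comment> \<open>Adding to the second component acts below the operator of the first; Tonelli
    lets the two commute.\<close>
  have 2: "(\<integral>\<^sup>+x. A k l \<sigma> (add_dirac \<tau> x) \<partial>\<nu>2) = of_nat (Suc l) * A k (Suc l) \<sigma> \<tau>" for k l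
  proof -
    have "(\<integral>\<^sup>+x. A k l \<sigma> (add_dirac \<tau> x) \<partial>\<nu>2) =
        pins \<nu>1 k (\<lambda>\<sigma>. \<integral>\<^sup>+x. pins \<nu>2 l (g \<sigma>) (add_dirac \<tau> x) \<partial>\<nu>2) \<sigma>"
      unfolding A_def by (rule pins_nn_integral[OF \<nu>1 intens_sigma_finite[OF \<nu>2] m4 Suc.prems(1)])
    also have "\<dots> = pins \<nu>1 k (\<lambda>\<sigma>. of_nat (Suc l) * pins \<nu>2 (Suc l) (g \<sigma>) \<tau>) \<sigma>"
      by (simp only: pins_Suc_mult)
    also have "\<dots> = of_nat (Suc l) * A k (Suc l) \<sigma> \<tau>"
      unfolding A_def by (rule pins_cmult[OF \<nu>1 m2[OF Suc.prems(2)] Suc.prems(1)])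
    finally show ?thesis .
  qed
  have "of_nat (Suc n) * pins2 \<nu>1 \<nu>2 (Suc n) g \<sigma> \<tau> =
      (\<integral>\<^sup>+x. (\<Sum>k\<le>n. A k (n - k) (add_dirac \<sigma> x) \<tau>) \<partial>\<nu>1) + (\<integral>\<^sup>+x. (\<Sum>k\<le>n. A k (n - k) \<sigma> (add_dirac \<tau> x)) \<partial>\<nu>2)"
    unfolding pins2_Suc_mult A_def
    by (intro arg_cong2[where f="(+)"] nn_integral_cong Suc.IH add_dirac_in_counting Suc.prems)
  also have "\<dots> = (\<Sum>k\<le>n. of_nat (Suc k) * A (Suc k) (n - k) \<sigma> \<tau>) + (\<Sum>k\<le>n. of_nat (Suc (n - k)) * A k (Suc (n - k)) \<sigma> \<tau>)"
    by (subst (1 2) nn_integral_sum) (simp_all only: m1 m3 1 2)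
  \<comment> \<open>Both sums are extended to k \<le> n + 1 by a vanishing term, so that the
    coefficients k and n + 1 - k add up to n + 1.\<close>
  also have "(\<Sum>k\<le>n. of_nat (Suc k) * A (Suc k) (n - k) \<sigma> \<tau>) = (\<Sum>k\<le>Suc n. of_nat k * A k (Suc n - k) \<sigma> \<tau>)"
    by (subst sum.atMost_Suc_shift) simp
  also have "(\<Sum>k\<le>n. of_nat (Suc (n - k)) * A k (Suc (n - k)) \<sigma> \<tau>) = (\<Sum>k\<le>Suc n. of_nat (Suc n - k) * A k (Suc n - k) \<sigma> \<tau>)"
    by (simp add: Suc_diff_le)
  also have "(\<Sum>k\<le>Suc n. of_nat k * A k (Suc n - k) \<sigma> \<tau>) + (\<Sum>k\<le>Suc n. of_nat (Suc n - k) * A k (Suc n - k) \<sigma> \<tau>) =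
      (\<Sum>k\<le>Suc n. of_nat (Suc n) * A k (Suc n - k) \<sigma> \<tau>)"
    unfolding sum.distrib[symmetric] distrib_right[symmetric] of_nat_add[symmetric]
    by (intro sum.cong refl) simp
  also have "\<dots> = of_nat (Suc n) * (\<Sum>k\<le>Suc n. A k (Suc n - k) \<sigma> \<tau>)"
    by (rule sum_distrib_left[symmetric])
  finally show ?case
    unfolding A_def by (rule of_nat_Suc_cancel)
qed simp

lemma pins2_measurable[measurable (raw)]:
  assumes \<nu>1: "intens \<nu>1" and \<nu>2: "intens \<nu>2"
    and g: "(\<lambda>(\<sigma>, \<tau>). g \<sigma> \<tau>) \<in> borel_measurable (\<N> \<Otimes>\<^sub>M \<N>)"
    and f: "f \<in> measurable W \<N>" and h: "h \<in> measurable W \<N>"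
  shows "(\<lambda>w. pins2 \<nu>1 \<nu>2 n g (f w) (h w)) \<in> borel_measurable W"
proof -
  let ?NN = "\<N> \<Otimes>\<^sub>M \<N>"
  interpret \<nu>1: sigma_finite_measure \<nu>1 using \<nu>1 by (rule intens_sigma_finite)
  interpret \<nu>2: sigma_finite_measure \<nu>2 using \<nu>2 by (rule intens_sigma_finite)
  have [measurable]: "snd \<in> measurable (?NN \<Otimes>\<^sub>M \<nu>1) M" "snd \<in> measurable (?NN \<Otimes>\<^sub>M \<nu>2) M"
    using measurable_snd[of ?NN \<nu>1] measurable_cong_sets[OF refl intens_sets[OF \<nu>1]]
      measurable_snd[of ?NN \<nu>2] measurable_cong_sets[OF refl intens_sets[OF \<nu>2]] by blast+
  have "(\<lambda>w. pins2 \<nu>1 \<nu>2 n g (fst w) (snd w)) \<in> borel_measurable ?NN"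
  proof (induction n)
    case 0
    then show ?case using g by (simp add: case_prod_beta)
  next
    case (Suc n)
    have "(\<lambda>w. (add_dirac (fst (fst w)) (snd w), snd (fst w))) \<in> measurable (?NN \<Otimes>\<^sub>M \<nu>1) ?NN"
      by measurable
    from measurable_compose[OF this Suc]
    have 1: "(\<lambda>w. \<integral>\<^sup>+x. pins2 \<nu>1 \<nu>2 n g (add_dirac (fst w) x) (snd w) \<partial>\<nu>1) \<in> borel_measurable ?NN"
      by (intro \<nu>1.borel_measurable_nn_integral) (simp add: case_prod_beta)
    have "(\<lambda>w. (fst (fst w), add_dirac (snd (fst w)) (snd w))) \<in> measurable (?NN \<Otimes>\<^sub>M \<nu>2) ?NN"
      by measurable
    from measurable_compose[OF this Suc]
    have 2: "(\<lambda>w. \<integral>\<^sup>+x. pins2 \<nu>1 \<nu>2 n g (fst w) (add_dirac (snd w) x) \<partial>\<nu>2) \<in> borel_measurable ?NN"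
      by (intro \<nu>2.borel_measurable_nn_integral) (simp add: case_prod_beta)
    show ?case
      unfolding pins2.simps using 1 2 by measurable
  qed
  from measurable_compose[OF measurable_Pair[OF f h] this] show ?thesis by simp
qed

text \<open>exp(T1 + T2) = exp(T1) exp(T2), as a Cauchy product.\<close>

lemma suminf_pins2:
  assumes \<nu>1: "intens \<nu>1" and \<nu>2: "intens \<nu>2"
    and g: "(\<lambda>(\<sigma>, \<tau>). g \<sigma> \<tau>) \<in> borel_measurable (\<N> \<Otimes>\<^sub>M \<N>)"
    and \<sigma>: "\<sigma> \<in> space \<N>" and \<tau>: "\<tau> \<in> space \<N>"
  shows "(\<Sum>n. pins2 \<nu>1 \<nu>2 n g \<sigma> \<tau>) = pexp \<nu>1 (\<lambda>\<sigma>. pexp \<nu>2 (g \<sigma>) \<tau>) \<sigma>"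
proof -
  have m2: "(\<lambda>\<sigma>. pins \<nu>2 l (g \<sigma>) \<tau>) \<in> borel_measurable \<N>" for l
    by (rule pins_measurable[OF \<nu>2 g]) (use \<tau> in auto)
  have "(\<Sum>n. pins2 \<nu>1 \<nu>2 n g \<sigma> \<tau>) = (\<Sum>k. \<Sum>l. pins \<nu>1 k (\<lambda>\<sigma>. pins \<nu>2 l (g \<sigma>) \<tau>) \<sigma>)"
    unfolding pins2_eq_sum[OF assms] by (rule suminf_Cauchy_product)
  also have "\<dots> = (\<Sum>k. pins \<nu>1 k (\<lambda>\<sigma>. pexp \<nu>2 (g \<sigma>) \<tau>) \<sigma>)"
    unfolding pexp_def by (intro suminf_cong pins_suminf[OF \<nu>1 m2 \<sigma>])
  finally show ?thesis by (simp add: pexp_def)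
qed

lemma restrict_meas_add_dirac:
  assumes "B \<in> sets \<mu>"
  shows "restrict_meas (add_dirac \<mu> x) B =
    (if x \<in> B then add_dirac (restrict_meas \<mu> B) x else restrict_meas \<mu> B)"
  using assms by (auto intro!: measure_eqI simp: emeasure_restrict_meas emeasure_add_dirac indicator_def)

lemma restrict_meas_null[simp]: "B \<in> sets M \<Longrightarrow> restrict_meas (null_measure M) B = null_measure M"
  by (rule measure_eqI) (auto simp: emeasure_restrict_meas)

text \<open>Each added point falls into \<open>B\<close> or into its complement, so on functions of
  the two restrictions T acts as T1 + T2.\<close>

lemma pins_eq_pins2_restrict:
  assumes \<nu>: "intens \<nu>" and B[measurable]: "B \<in> sets M"
    and g: "(\<lambda>(\<sigma>, \<tau>). g \<sigma> \<tau>) \<in> borel_measurable (\<N> \<Otimes>\<^sub>M \<N>)"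
    and \<psi>: "\<psi> \<in> space \<N>"
  defines "f \<equiv> \<lambda>\<psi>. g (restrict_meas \<psi> B) (restrict_meas \<psi> (space M - B))"
  shows "pins \<nu> n f \<psi> =
    pins2 (restrict_meas \<nu> B) (restrict_meas \<nu> (space M - B)) n g (restrict_meas \<psi> B) (restrict_meas \<psi> (space M - B))"
  using \<psi>
proof (induction n arbitrary: \<psi>)
  case (Suc n)
  let ?\<nu>1 = "restrict_meas \<nu> B" and ?\<nu>2 = "restrict_meas \<nu> (space M - B)"
  let ?\<sigma> = "restrict_meas \<psi> B" and ?\<tau> = "restrict_meas \<psi> (space M - B)"
  have \<nu>1: "intens ?\<nu>1" and \<nu>2: "intens ?\<nu>2" using \<nu> by (auto intro: intens_restrict)
  have in_N: "?\<sigma> \<in> space \<N>" "?\<tau> \<in> space \<N>"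
    using Suc.prems by auto
  have sB: "B \<in> sets \<nu>" "space M - B \<in> sets \<nu>" using intens_sets[OF \<nu>] B by auto
  have s\<psi>: "B \<in> sets \<psi>" "space M - B \<in> sets \<psi>" using sets_counting_space[OF Suc.prems] B by auto
  have ad: "(\<lambda>x. add_dirac \<mu> x) \<in> measurable \<nu> \<N>" if "\<mu> \<in> space \<N>" for \<mu>
    using that by (intro measurable_add_dirac measurable_ident_sets intens_sets \<nu>) auto
  have m2: "(\<lambda>x. pins2 ?\<nu>1 ?\<nu>2 n g ?\<sigma> (add_dirac ?\<tau> x)) \<in> borel_measurable \<nu>"
    and m1: "(\<lambda>x. pins2 ?\<nu>1 ?\<nu>2 n g (add_dirac ?\<sigma> x) ?\<tau>) \<in> borel_measurable \<nu>"
    using in_N by (auto intro!: pins2_measurable[OF \<nu>1 \<nu>2 g] ad)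
  have "(\<integral>\<^sup>+x. pins \<nu> n f (add_dirac \<psi> x) \<partial>\<nu>) =
      (\<integral>\<^sup>+x. pins2 ?\<nu>1 ?\<nu>2 n g (add_dirac ?\<sigma> x) ?\<tau> * indicator B x +
        pins2 ?\<nu>1 ?\<nu>2 n g ?\<sigma> (add_dirac ?\<tau> x) * indicator (space M - B) x \<partial>\<nu>)"
  proof (rule nn_integral_cong)
    fix x assume "x \<in> space \<nu>"
    then have x: "x \<in> space M" by (simp add: intens_space[OF \<nu>])
    have "pins \<nu> n f (add_dirac \<psi> x) = pins2 ?\<nu>1 ?\<nu>2 n g (restrict_meas (add_dirac \<psi> x) B) (restrict_meas (add_dirac \<psi> x) (space M - B))"
      by (intro Suc.IH add_dirac_in_counting Suc.prems)
    then show "pins \<nu> n f (add_dirac \<psi> x) = pins2 ?\<nu>1 ?\<nu>2 n g (add_dirac ?\<sigma> x) ?\<tau> * indicator B x +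
        pins2 ?\<nu>1 ?\<nu>2 n g ?\<sigma> (add_dirac ?\<tau> x) * indicator (space M - B) x"
      using x s\<psi> by (simp add: restrict_meas_add_dirac indicator_def)
  qed
  also have "\<dots> = (\<integral>\<^sup>+x. pins2 ?\<nu>1 ?\<nu>2 n g (add_dirac ?\<sigma> x) ?\<tau> \<partial>?\<nu>1) +
      (\<integral>\<^sup>+x. pins2 ?\<nu>1 ?\<nu>2 n g ?\<sigma> (add_dirac ?\<tau> x) \<partial>?\<nu>2)"
    by (subst nn_integral_add)
       (use m1 m2 sB in \<open>auto simp: nn_integral_restrict_meas intro!: borel_measurable_times borel_measurable_indicator\<close>)
  finally show ?case
    by (simp add: pins.simps pins2.simps)
qed (simp add: f_def)

text \<open>The exponential factorises over \<open>B\<close> and its complement, and so does the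
  normalising constant: the restrictions are independent and Poisson.\<close>

lemma pois_restrict_indep:
  assumes \<nu>: "intens \<nu>" and B[measurable]: "B \<in> sets M"
    and [measurable]: "u \<in> borel_measurable \<N>" "v \<in> borel_measurable \<N>"
  shows "(\<integral>\<^sup>+\<mu>. u (restrict_meas \<mu> B) * v (restrict_meas \<mu> (space M - B)) \<partial>pois \<nu>) =
     (\<integral>\<^sup>+\<mu>. u \<mu> \<partial>pois (restrict_meas \<nu> B)) * (\<integral>\<^sup>+\<mu>. v \<mu> \<partial>pois (restrict_meas \<nu> (space M - B)))"
proof -
  let ?\<nu>1 = "restrict_meas \<nu> B" and ?\<nu>2 = "restrict_meas \<nu> (space M - B)"
  interpret finite_measure \<nu> using \<nu> by (rule intens_finite)
  have \<nu>1: "intens ?\<nu>1" and \<nu>2: "intens ?\<nu>2" using \<nu> by (auto intro: intens_restrict)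
  have sB: "B \<in> sets \<nu>" "space M - B \<in> sets \<nu>" using intens_sets[OF \<nu>] B by auto
  have r: "(\<lambda>\<mu>. restrict_meas \<mu> C) \<in> measurable \<N> \<N>" if "C \<in> sets M" for C
  proof -
    have [measurable]: "C \<in> sets M" by fact
    have "(\<lambda>(y, \<mu>). restrict_meas \<mu> C) \<in> measurable (count_space {()} \<Otimes>\<^sub>M \<N>) \<N>"
      by (rule measurable_restrict_meas) measurable
    from measurable_compose[OF measurable_Pair1' this, of "()"] show ?thesis by simp
  qed
  have [measurable]: "(\<lambda>\<mu>. restrict_meas \<mu> B) \<in> measurable \<N> \<N>"
    "(\<lambda>\<mu>. restrict_meas \<mu> (space M - B)) \<in> measurable \<N> \<N>"
    by (auto intro: r)
  have g: "(\<lambda>(\<sigma>, \<tau>). u \<sigma> * v \<tau>) \<in> borel_measurable (\<N> \<Otimes>\<^sub>M \<N>)"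
    by measurable
  let ?f = "\<lambda>\<mu>. u (restrict_meas \<mu> B) * v (restrict_meas \<mu> (space M - B))"
  have "measure \<nu> (space M) = measure ?\<nu>1 (space M) + measure ?\<nu>2 (space M)"
  proof -
    have "measure ?\<nu>1 (space M) = measure \<nu> B" "measure ?\<nu>2 (space M) = measure \<nu> (space M - B)"
      using sB intens_sets[OF \<nu>] sets.sets_into_space[OF B]
      by (auto simp: measure_def emeasure_restrict_meas Int_absorb1)
    then show ?thesis
      using finite_measure_compl[OF sB(1)] by (simp add: intens_space[OF \<nu>])
  qed
  then have e: "ennreal (exp (- measure \<nu> (space M))) = ennreal (exp (- measure ?\<nu>1 (space M))) * ennreal (exp (- measure ?\<nu>2 (space M)))"
    by (simp add: mult_exp_exp ennreal_mult[symmetric])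
  have "pexp \<nu> ?f (null_measure M) = (\<Sum>n. pins2 ?\<nu>1 ?\<nu>2 n (\<lambda>\<sigma> \<tau>. u \<sigma> * v \<tau>) (null_measure M) (null_measure M))"
    unfolding pexp_def
    by (subst pins_eq_pins2_restrict[OF \<nu> B g]) auto
  also have "\<dots> = pexp ?\<nu>1 (\<lambda>\<sigma>. pexp ?\<nu>2 (\<lambda>\<tau>. u \<sigma> * v \<tau>) (null_measure M)) (null_measure M)"
    by (rule suminf_pins2[OF \<nu>1 \<nu>2 g]) auto
  also have "\<dots> = pexp ?\<nu>1 (\<lambda>\<sigma>. pexp ?\<nu>2 v (null_measure M) * u \<sigma>) (null_measure M)"
    by (subst pexp_cmult[OF \<nu>2]) (auto simp: mult.commute)
  also have "\<dots> = pexp ?\<nu>1 u (null_measure M) * pexp ?\<nu>2 v (null_measure M)"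
    by (subst pexp_cmult[OF \<nu>1]) (auto simp: mult.commute)
  finally show ?thesis
    by (simp add: nn_integral_pois \<nu> \<nu>1 \<nu>2 e mult_ac)
qed

lemma prob_space_pois: "intens \<nu> \<Longrightarrow> prob_space (pois \<nu>)"
  by (rule prob_spaceI)
     (use nn_integral_pois[of \<nu> "\<lambda>_. 1"] pexp_const[of \<nu> 1] in \<open>simp add: ennreal_mult[symmetric] exp_minus\<close>)

text \<open>\<open>pois_restrict_indep\<close> for functions that look only at the points inside or
  only at the points outside \<open>B\<close>; constants give the marginal statement.\<close>

lemma pois_indep:
  assumes \<nu>: "intens \<nu>" and B[measurable]: "B \<in> sets M"
    and uv: "u \<in> borel_measurable \<N>" "v \<in> borel_measurable \<N>"
    and u: "\<And>\<mu>. \<mu> \<in> space \<N> \<Longrightarrow> u (restrict_meas \<mu> B) = u \<mu>"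
    and v: "\<And>\<mu>. \<mu> \<in> space \<N> \<Longrightarrow> v (restrict_meas \<mu> (space M - B)) = v \<mu>"
  shows "(\<integral>\<^sup>+\<mu>. u \<mu> * v \<mu> \<partial>pois \<nu>) = (\<integral>\<^sup>+\<mu>. u \<mu> \<partial>pois \<nu>) * (\<integral>\<^sup>+\<mu>. v \<mu> \<partial>pois \<nu>)"
    and "(\<integral>\<^sup>+\<mu>. u \<mu> \<partial>pois \<nu>) = (\<integral>\<^sup>+\<mu>. u \<mu> \<partial>pois (restrict_meas \<nu> B))"
proof -
  let ?\<nu>1 = "restrict_meas \<nu> B" and ?\<nu>2 = "restrict_meas \<nu> (space M - B)"
  have \<nu>1: "intens ?\<nu>1" and \<nu>2: "intens ?\<nu>2" using \<nu> by (auto intro: intens_restrict)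
  interpret \<nu>1: prob_space "pois ?\<nu>1" by (rule prob_space_pois[OF \<nu>1])
  interpret \<nu>2: prob_space "pois ?\<nu>2" by (rule prob_space_pois[OF \<nu>2])
  have "(\<integral>\<^sup>+\<mu>. u \<mu> * v \<mu> \<partial>pois \<nu>) = (\<integral>\<^sup>+\<mu>. u (restrict_meas \<mu> B) * v (restrict_meas \<mu> (space M - B)) \<partial>pois \<nu>)"
    by (intro nn_integral_cong) (simp add: u v)
  also have "\<dots> = (\<integral>\<^sup>+\<mu>. u \<mu> \<partial>pois ?\<nu>1) * (\<integral>\<^sup>+\<mu>. v \<mu> \<partial>pois ?\<nu>2)"
    by (rule pois_restrict_indep[OF \<nu> B uv])
  finally have uv': "(\<integral>\<^sup>+\<mu>. u \<mu> * v \<mu> \<partial>pois \<nu>) = (\<integral>\<^sup>+\<mu>. u \<mu> \<partial>pois ?\<nu>1) * (\<integral>\<^sup>+\<mu>. v \<mu> \<partial>pois ?\<nu>2)" .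
  have "(\<integral>\<^sup>+\<mu>. u \<mu> \<partial>pois \<nu>) = (\<integral>\<^sup>+\<mu>. u (restrict_meas \<mu> B) * 1 \<partial>pois \<nu>)"
    by (intro nn_integral_cong) (simp add: u)
  also have "\<dots> = (\<integral>\<^sup>+\<mu>. u \<mu> \<partial>pois ?\<nu>1)"
    using pois_restrict_indep[OF \<nu> B uv(1), of "\<lambda>_. 1"] \<nu>2.emeasure_space_1 by simp
  finally show u': "(\<integral>\<^sup>+\<mu>. u \<mu> \<partial>pois \<nu>) = (\<integral>\<^sup>+\<mu>. u \<mu> \<partial>pois ?\<nu>1)" .
  have "(\<integral>\<^sup>+\<mu>. v \<mu> \<partial>pois \<nu>) = (\<integral>\<^sup>+\<mu>. 1 * v (restrict_meas \<mu> (space M - B)) \<partial>pois \<nu>)"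
    by (intro nn_integral_cong) (simp add: v)
  also have "\<dots> = (\<integral>\<^sup>+\<mu>. v \<mu> \<partial>pois ?\<nu>2)"
    using pois_restrict_indep[OF \<nu> B _ uv(2), of "\<lambda>_. 1"] \<nu>1.emeasure_space_1 by simp
  finally show "(\<integral>\<^sup>+\<mu>. u \<mu> * v \<mu> \<partial>pois \<nu>) = (\<integral>\<^sup>+\<mu>. u \<mu> \<partial>pois \<nu>) * (\<integral>\<^sup>+\<mu>. v \<mu> \<partial>pois \<nu>)"
    using uv' u' by simp
qed

section \<open>The Mecke equation\<close>

text \<open>A product rule: the integral over \<mu> marks one point, which was either present at the
  start or is one of the n points added. From the empty configuration only the second possibility
  remains, and the marked point leaves n - 1 others.\<close>

lemma pexp_Mecke:
  assumes \<nu>: "intens \<nu>"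
    and f[measurable]: "(\<lambda>(x, \<mu>). f x \<mu>) \<in> borel_measurable (M \<Otimes>\<^sub>M \<N>)"
  shows "pexp \<nu> (\<lambda>\<mu>. \<integral>\<^sup>+x. f x \<mu> \<partial>\<mu>) (null_measure M) =
    (\<integral>\<^sup>+x. pexp \<nu> (\<lambda>\<mu>. f x (add_dirac \<mu> x)) (null_measure M) \<partial>\<nu>)"
proof -
  note [measurable_cong] = intens_sets[OF \<nu>]
  interpret \<nu>: sigma_finite_measure \<nu> using \<nu> by (rule intens_sigma_finite)
  have fv: "(\<lambda>(x, \<mu>). f x \<mu>) \<in> borel_measurable (\<rho> \<Otimes>\<^sub>M \<N>)" if "sets \<rho> = sets M" for \<rho>
    using f measurable_cong_sets[OF sets_pair_measure_cong[OF that refl] refl] by blast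
  have fa: "(\<lambda>(x, \<mu>). f x (add_dirac \<mu> x)) \<in> borel_measurable (\<rho> \<Otimes>\<^sub>M \<N>)" if "sets \<rho> = sets M" for \<rho>
  proof -
    have "(\<lambda>w. (fst w, add_dirac (snd w) (fst w))) \<in> measurable (M \<Otimes>\<^sub>M \<N>) (M \<Otimes>\<^sub>M \<N>)"
      by measurable
    from measurable_compose[OF this f]
    have "(\<lambda>(x, \<mu>). f x (add_dirac \<mu> x)) \<in> borel_measurable (M \<Otimes>\<^sub>M \<N>)"
      by (simp add: case_prod_beta)
    then show ?thesis
      using measurable_cong_sets[OF sets_pair_measure_cong[OF that refl] refl] by blast
  qed
  have fx[measurable]: "f x \<in> borel_measurable \<N>" if "x \<in> space M" for x
    using measurable_compose[OF measurable_Pair1'[OF that] f] by simp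
  let ?g = "\<lambda>\<mu>. \<integral>\<^sup>+x. f x \<mu> \<partial>\<mu>"
  \<comment> \<open>The contribution in which the marked point is an added one; for n = 0 there is
    none.\<close>
  define R where "R n \<psi> = (case n of 0 \<Rightarrow> 0 | Suc m \<Rightarrow> \<integral>\<^sup>+x. pins \<nu> m (\<lambda>\<mu>. f x (add_dirac \<mu> x)) \<psi> \<partial>\<nu>)" for n \<psi>
  have "pins \<nu> n ?g \<psi> = (\<integral>\<^sup>+x. pins \<nu> n (f x) \<psi> \<partial>\<psi>) + R n \<psi>" if "\<psi> \<in> space \<N>" for n \<psi>
    using that
  proof (induction n arbitrary: \<psi>)
    case 0
    then show ?case by (simp add: R_def)
  next
    case (Suc n)
    note \<psi> = Suc.prems
    have s\<psi>[measurable_cong]: "sets \<psi> = sets M" using \<psi> by (rule sets_counting_space)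
    interpret \<psi>: finite_measure \<psi> using \<psi> by (rule finite_measure_counting)
    interpret P: pair_sigma_finite \<psi> \<nu> ..
    have ad: "(\<lambda>x. add_dirac \<psi> x) \<in> measurable M \<N>"
      using \<psi> by (intro measurable_add_dirac) auto
    have [measurable]: "snd \<in> measurable (\<psi> \<Otimes>\<^sub>M \<nu>) M" "fst \<in> measurable (\<psi> \<Otimes>\<^sub>M \<nu>) M"
      using measurable_snd[of \<psi> \<nu>] measurable_cong_sets[OF refl intens_sets[OF \<nu>]]
        measurable_fst[of \<psi> \<nu>] measurable_cong_sets[OF refl s\<psi>] by blast+
    have m2: "(\<lambda>(x, y). pins \<nu> n (f x) (add_dirac \<psi> y)) \<in> borel_measurable (\<psi> \<Otimes>\<^sub>M \<nu>)"
      unfolding case_prod_beta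
    proof (rule pins_measurable[OF \<nu>])
      have "(\<lambda>w. (fst (fst w), snd w)) \<in>
          measurable ((\<psi> \<Otimes>\<^sub>M \<nu>) \<Otimes>\<^sub>M \<N>) (M \<Otimes>\<^sub>M \<N>)"
        by measurable
      from measurable_compose[OF this f]
      show "(\<lambda>(w, \<mu>). f (fst w) \<mu>) \<in> borel_measurable ((\<psi> \<Otimes>\<^sub>M \<nu>) \<Otimes>\<^sub>M \<N>)"
        by (simp add: case_prod_beta)
      show "(\<lambda>w. add_dirac \<psi> (snd w)) \<in> measurable (\<psi> \<Otimes>\<^sub>M \<nu>) \<N>"
        by (rule measurable_compose[OF _ ad]) measurable
    qed
    have m3: "(\<lambda>y. pins \<nu> n (f y) (add_dirac \<psi> y)) \<in> borel_measurable M"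
      by (rule pins_measurable[OF \<nu> f ad])
    then have m3': "(\<lambda>y. pins \<nu> n (f y) (add_dirac \<psi> y)) \<in> borel_measurable \<nu>"
      using measurable_cong_sets[OF intens_sets[OF \<nu>] refl] by blast
    have m4: "(\<lambda>x. pins \<nu> n (f x) (add_dirac \<psi> y)) \<in> borel_measurable M" if "y \<in> space M" for y
      by (rule pins_measurable[OF \<nu> f measurable_const]) (rule add_dirac_in_counting[OF \<psi>])
    then have m4': "(\<lambda>x. pins \<nu> n (f x) (add_dirac \<psi> y)) \<in> borel_measurable \<psi>" if "y \<in> space M" for y
      using that measurable_cong_sets[OF s\<psi> refl] by blast
    have m5: "(\<lambda>y. \<integral>\<^sup>+x. pins \<nu> n (f x) (add_dirac \<psi> y) \<partial>\<psi>) \<in> borel_measurable \<nu>"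
      using m2 by measurable
    have mR: "(\<lambda>y. R n (add_dirac \<psi> y)) \<in> borel_measurable \<nu>"
    proof (cases n)
      case (Suc m)
      have "(\<lambda>\<mu>. \<integral>\<^sup>+x. pins \<nu> m (\<lambda>\<mu>. f x (add_dirac \<mu> x)) \<mu> \<partial>\<nu>) \<in> borel_measurable \<N>"
      proof (rule \<nu>.borel_measurable_nn_integral)
        have "(\<lambda>w. pins \<nu> m (\<lambda>\<mu>. f (snd w) (add_dirac \<mu> (snd w))) (fst w)) \<in> borel_measurable (\<N> \<Otimes>\<^sub>M \<nu>)"
        proof (rule pins_measurable[OF \<nu>])
          have "(\<lambda>w. (snd (fst w), snd w)) \<in>
              measurable ((\<N> \<Otimes>\<^sub>M \<nu>) \<Otimes>\<^sub>M \<N>) (\<nu> \<Otimes>\<^sub>M \<N>)"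
            by measurable
          from measurable_compose[OF this fa[OF intens_sets[OF \<nu>]]]
          show "(\<lambda>(w, \<mu>). f (snd w) (add_dirac \<mu> (snd w))) \<in> borel_measurable ((\<N> \<Otimes>\<^sub>M \<nu>) \<Otimes>\<^sub>M \<N>)"
            by (simp add: case_prod_beta)
        qed measurable
        then show "(\<lambda>(\<mu>, x). pins \<nu> m (\<lambda>\<mu>. f x (add_dirac \<mu> x)) \<mu>) \<in> borel_measurable (\<N> \<Otimes>\<^sub>M \<nu>)"
          by (simp add: case_prod_beta)
      qed
      from measurable_compose[OF ad this] show ?thesis
        unfolding R_def Suc by (simp cong: measurable_cong_sets add: intens_sets[OF \<nu>])
    qed (simp add: R_def)
    have a: "(\<integral>\<^sup>+y. \<integral>\<^sup>+x. pins \<nu> n (f x) (add_dirac \<psi> y) \<partial>\<psi> \<partial>\<nu>) = of_nat (Suc n) * (\<integral>\<^sup>+x. pins \<nu> (Suc n) (f x) \<psi> \<partial>\<psi>)"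
    proof -
      have mS: "(\<lambda>x. pins \<nu> (Suc n) (f x) \<psi>) \<in> borel_measurable M"
        by (rule pins_measurable[OF \<nu> f]) (use \<psi> in auto)
      have "(\<integral>\<^sup>+y. \<integral>\<^sup>+x. pins \<nu> n (f x) (add_dirac \<psi> y) \<partial>\<psi> \<partial>\<nu>) =
          (\<integral>\<^sup>+x. \<integral>\<^sup>+y. pins \<nu> n (f x) (add_dirac \<psi> y) \<partial>\<nu> \<partial>\<psi>)"
        by (rule P.Fubini'[OF m2])
      also have "\<dots> = (\<integral>\<^sup>+x. of_nat (Suc n) * pins \<nu> (Suc n) (f x) \<psi> \<partial>\<psi>)"
        by (simp only: pins_Suc_mult)
      finally show ?thesis
        using mS by (subst (asm) nn_integral_cmult) (auto cong: measurable_cong_sets simp: s\<psi>)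
    qed
    have b: "(\<integral>\<^sup>+y. pins \<nu> n (f y) (add_dirac \<psi> y) \<partial>\<nu>) = R (Suc n) \<psi>"
      by (simp add: R_def pins_shift)
    have c: "(\<integral>\<^sup>+y. R n (add_dirac \<psi> y) \<partial>\<nu>) = of_nat n * R (Suc n) \<psi>"
    proof (cases n)
      case (Suc m)
      interpret N2: pair_sigma_finite \<nu> \<nu> ..
      have mp: "(\<lambda>(x, y). pins \<nu> m (\<lambda>\<mu>. f x (add_dirac \<mu> x)) (add_dirac \<psi> y)) \<in> borel_measurable (\<nu> \<Otimes>\<^sub>M \<nu>)"
        unfolding case_prod_beta
      proof (rule pins_measurable[OF \<nu>])
        have "(\<lambda>w. (fst (fst w), snd w)) \<in>
            measurable ((\<nu> \<Otimes>\<^sub>M \<nu>) \<Otimes>\<^sub>M \<N>) (\<nu> \<Otimes>\<^sub>M \<N>)"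
          by measurable
        from measurable_compose[OF this fa[OF intens_sets[OF \<nu>]]]
        show "(\<lambda>(w, \<mu>). f (fst w) (add_dirac \<mu> (fst w))) \<in> borel_measurable ((\<nu> \<Otimes>\<^sub>M \<nu>) \<Otimes>\<^sub>M \<N>)"
          by (simp add: case_prod_beta)
        have "snd \<in> measurable (\<nu> \<Otimes>\<^sub>M \<nu>) M"
          using measurable_snd[of \<nu> \<nu>] measurable_cong_sets[OF refl intens_sets[OF \<nu>]] by blast
        from measurable_compose[OF this ad]
        show "(\<lambda>w. add_dirac \<psi> (snd w)) \<in> measurable (\<nu> \<Otimes>\<^sub>M \<nu>) \<N>" .
      qed
      have mS: "(\<lambda>x. pins \<nu> (Suc m) (\<lambda>\<mu>. f x (add_dirac \<mu> x)) \<psi>) \<in> borel_measurable \<nu>"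
        by (rule pins_measurable[OF \<nu> fa[OF intens_sets[OF \<nu>]]]) (use \<psi> in auto)
      have "(\<integral>\<^sup>+y. R n (add_dirac \<psi> y) \<partial>\<nu>) =
          (\<integral>\<^sup>+x. \<integral>\<^sup>+y. pins \<nu> m (\<lambda>\<mu>. f x (add_dirac \<mu> x)) (add_dirac \<psi> y) \<partial>\<nu> \<partial>\<nu>)"
        unfolding R_def Suc by (simp add: N2.Fubini'[OF mp])
      also have "\<dots> = (\<integral>\<^sup>+x. of_nat (Suc m) * pins \<nu> (Suc m) (\<lambda>\<mu>. f x (add_dirac \<mu> x)) \<psi> \<partial>\<nu>)"
        by (simp only: pins_Suc_mult)
      also have "\<dots> = of_nat n * R (Suc n) \<psi>"
        by (subst nn_integral_cmult[OF mS]) (simp add: R_def Suc)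
      finally show ?thesis .
    qed (simp add: R_def)
    \<comment> \<open>The newly added point \<open>y\<close> is itself marked (once,
      \<open>b\<close>) or an earlier added one is (n times, \<open>c\<close>); the two coefficients
      make the n + 1 that \<open>a\<close> has for the old points.\<close>
    have "of_nat (Suc n) * pins \<nu> (Suc n) ?g \<psi> = (\<integral>\<^sup>+y. pins \<nu> n ?g (add_dirac \<psi> y) \<partial>\<nu>)"
      by (rule pins_Suc_mult)
    also have "\<dots> = (\<integral>\<^sup>+y. (\<integral>\<^sup>+x. pins \<nu> n (f x) (add_dirac \<psi> y) \<partial>\<psi>) + pins \<nu> n (f y) (add_dirac \<psi> y) + R n (add_dirac \<psi> y) \<partial>\<nu>)"
    proof (rule nn_integral_cong)
      fix y assume "y \<in> space \<nu>"
      then have y: "y \<in> space M" by (simp add: intens_space[OF \<nu>])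
      show "pins \<nu> n ?g (add_dirac \<psi> y) =
          (\<integral>\<^sup>+x. pins \<nu> n (f x) (add_dirac \<psi> y) \<partial>\<psi>) + pins \<nu> n (f y) (add_dirac \<psi> y) + R n (add_dirac \<psi> y)"
        using m4'[OF y] y space_counting_space[OF \<psi>]
        by (subst Suc.IH[OF add_dirac_in_counting[OF \<psi>]]) (simp add: nn_integral_add_dirac)
    qed
    also have "\<dots> = (\<integral>\<^sup>+y. \<integral>\<^sup>+x. pins \<nu> n (f x) (add_dirac \<psi> y) \<partial>\<psi> \<partial>\<nu>) +
        (\<integral>\<^sup>+y. pins \<nu> n (f y) (add_dirac \<psi> y) \<partial>\<nu>) + (\<integral>\<^sup>+y. R n (add_dirac \<psi> y) \<partial>\<nu>)"
      using m5 m3' mR by (simp add: nn_integral_add)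
    also have "\<dots> = of_nat (Suc n) * ((\<integral>\<^sup>+x. pins \<nu> (Suc n) (f x) \<psi> \<partial>\<psi>) + R (Suc n) \<psi>)"
      unfolding a b c by (simp add: algebra_simps)
    finally show ?case by (rule of_nat_Suc_cancel)
  qed
  from this[of "null_measure M"]
  have p: "pins \<nu> n ?g (null_measure M) = R n (null_measure M)" for n
    by simp
  have "pexp \<nu> ?g (null_measure M) = (\<Sum>n. R (Suc n) (null_measure M))"
    unfolding pexp_def p using suminf_offset[OF summableI, of "\<lambda>n. R n (null_measure M)" 1]
    by (simp add: R_def)
  also have "\<dots> = (\<integral>\<^sup>+x. pexp \<nu> (\<lambda>\<mu>. f x (add_dirac \<mu> x)) (null_measure M) \<partial>\<nu>)"
    unfolding R_def pexp_def
    by (simp, rule nn_integral_suminf[symmetric])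
       (rule pins_measurable[OF \<nu> fa[OF intens_sets[OF \<nu>]]], auto)
  finally show ?thesis .
qed

section \<open>Existence of the Poisson process\<close>

text \<open>Almost every added point lies in \<open>B\<close>, so n additions raise the count by
  exactly n.\<close>

lemma pins_count:
  assumes \<rho>: "intens \<rho>" and B: "B \<in> sets M" and AE: "AE x in \<rho>. x \<in> B"
    and \<psi>: "\<psi> \<in> space \<N>"
  shows "pins \<rho> n (\<lambda>\<mu>. h (emeasure \<mu> B)) \<psi> =
    ennreal (measure \<rho> (space M) ^ n / fact n) * h (emeasure \<psi> B + of_nat n)"
  using \<psi>
proof (induction n arbitrary: \<psi>)
  case (Suc n)
  interpret finite_measure \<rho> using \<rho> by (rule intens_finite)
  have "(\<integral>\<^sup>+x. pins \<rho> n (\<lambda>\<mu>. h (emeasure \<mu> B)) (add_dirac \<psi> x) \<partial>\<rho>) =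
      (\<integral>\<^sup>+x. ennreal (measure \<rho> (space M) ^ n / fact n) * h (emeasure \<psi> B + of_nat (Suc n)) \<partial>\<rho>)"
  proof (rule nn_integral_cong_AE)
    show "AE x in \<rho>. pins \<rho> n (\<lambda>\<mu>. h (emeasure \<mu> B)) (add_dirac \<psi> x) =
        ennreal (measure \<rho> (space M) ^ n / fact n) * h (emeasure \<psi> B + of_nat (Suc n))"
      using AE
    proof eventually_elim
      case (elim x)
      then have "emeasure (add_dirac \<psi> x) B = emeasure \<psi> B + 1"
        using B by (simp add: emeasure_add_dirac sets_counting_space[OF Suc.prems])
      then show ?case
        by (subst Suc.IH[OF add_dirac_in_counting[OF Suc.prems]]) (simp add: add_ac)
    qed
  qed
  also have "\<dots> = ennreal (measure \<rho> (space M)) *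
      (ennreal (measure \<rho> (space M) ^ n / fact n) * h (emeasure \<psi> B + of_nat (Suc n)))"
    by (simp add: intens_space[OF \<rho>] emeasure_eq_measure mult_ac del: of_nat_Suc)
  finally show ?case
    using ennreal_mult_power_fact[of "measure \<rho> (space M)" n, symmetric]
    by (simp only: pins.simps measure_nonneg mult.assoc)
qed simp

text \<open>Only points in \<open>B\<close> matter, so the intensity is first restricted to
  \<open>B\<close>. The n-th term of the series then sees the count n, and the indicator selects n =
  k.\<close>

lemma pois_count:
  assumes \<nu>: "intens \<nu>" and B[measurable]: "B \<in> sets M"
  shows "measure (pois \<nu>) {\<mu> \<in> space \<N>. emeasure \<mu> B = of_nat k} =
    measure \<nu> B ^ k / fact k * exp (- measure \<nu> B)"
proof -
  let ?\<rho> = "restrict_meas \<nu> B"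
  have \<rho>: "intens ?\<rho>" by (rule intens_restrict[OF \<nu> B])
  have B\<nu>: "B \<in> sets \<nu>" using B intens_sets[OF \<nu>] by simp
  have m\<rho>: "measure ?\<rho> (space M) = measure \<nu> B"
    using B\<nu> intens_sets[OF \<nu>] sets.sets_into_space[OF B]
    by (auto simp: measure_def emeasure_restrict_meas Int_absorb1)
  have AE: "AE x in ?\<rho>. x \<in> B"
    unfolding restrict_meas_eq_density[OF B\<nu>]
    using B\<nu> by (subst AE_density) (auto simp: indicator_def)
  let ?u = "\<lambda>\<mu>. indicator {of_nat k} (emeasure \<mu> B) :: ennreal"
  have u[measurable]: "?u \<in> borel_measurable \<N>" by measurable
  have "emeasure (pois \<nu>) {\<mu> \<in> space \<N>. emeasure \<mu> B = of_nat k} =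
      (\<integral>\<^sup>+\<mu>. indicator {\<mu> \<in> space \<N>. emeasure \<mu> B = of_nat k} \<mu> \<partial>pois \<nu>)"
    by simp
  also have "\<dots> = (\<integral>\<^sup>+\<mu>. ?u \<mu> \<partial>pois \<nu>)"
    by (intro nn_integral_cong) (auto simp: indicator_def)
  also have "\<dots> = (\<integral>\<^sup>+\<mu>. ?u \<mu> \<partial>pois ?\<rho>)"
    by (rule pois_indep(2)[OF \<nu> B u, of "\<lambda>_. 1"])
       (auto simp: emeasure_restrict_meas sets_counting_space)
  also have "\<dots> = ennreal (exp (- measure \<nu> B)) * pexp ?\<rho> ?u (null_measure M)"
    by (simp add: nn_integral_pois[OF \<rho> u] m\<rho>)
  also have "pexp ?\<rho> ?u (null_measure M) = (\<Sum>n. ennreal (measure \<nu> B ^ n / fact n) * indicator {of_nat k} (of_nat n :: ennreal))"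
    unfolding pexp_def by (subst pins_count[OF \<rho> B AE]) (simp_all add: m\<rho>)
  also have "\<dots> = (\<Sum>n. if n = k then ennreal (measure \<nu> B ^ n / fact n) else 0)"
    by (intro suminf_cong) (auto simp: indicator_def)
  also have "\<dots> = ennreal (measure \<nu> B ^ k / fact k)"
    by (subst suminf_finite[of "{k}"]) auto
  finally show ?thesis
    by (simp add: measure_def ennreal_mult[symmetric] mult.commute)
qed

text \<open>One set is split off at a time: by disjointness the others lie in its complement, where
  \<open>pois_indep\<close> applies.\<close>

lemma pois_prod_indep:
  assumes \<nu>: "intens \<nu>" and "finite J" and B: "\<And>j. j \<in> J \<Longrightarrow> B j \<in> sets M" and disj: "disjoint_family_on B J"
    and h: "\<And>j. j \<in> J \<Longrightarrow> h j \<in> borel_measurable (borel :: ennreal measure)"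
  shows "(\<integral>\<^sup>+\<mu>. (\<Prod>j\<in>J. h j (emeasure \<mu> (B j)) :: ennreal) \<partial>pois \<nu>) =
     (\<Prod>j\<in>J. \<integral>\<^sup>+\<mu>. h j (emeasure \<mu> (B j)) \<partial>pois \<nu>)"
  using \<open>finite J\<close> B disj h
proof (induction J rule: finite_induct)
  case empty
  show ?case using prob_space.emeasure_space_1[OF prob_space_pois[OF \<nu>]] by simp
next
  case (insert i J)
  have Bi[measurable]: "B i \<in> sets M" and BJ: "\<And>j. j \<in> J \<Longrightarrow> B j \<in> sets M" using insert.prems by auto
  have m: "(\<lambda>\<mu>. h j (emeasure \<mu> (B j))) \<in> borel_measurable \<N>" if "j \<in> insert i J" for j
    using measurable_compose[OF emeasure_measurable insert.prems(3)[OF that]] insert.prems(1)[OF that] by blast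
  have disj: "B j \<inter> (space M - B i) = B j" if "j \<in> J" for j
    using insert.prems(2) insert.hyps that sets.sets_into_space[OF BJ[OF that]]
    by (fastforce simp: disjoint_family_on_def)
  have "(\<integral>\<^sup>+\<mu>. (\<Prod>j\<in>insert i J. h j (emeasure \<mu> (B j))) \<partial>pois \<nu>) =
      (\<integral>\<^sup>+\<mu>. h i (emeasure \<mu> (B i)) * (\<Prod>j\<in>J. h j (emeasure \<mu> (B j))) \<partial>pois \<nu>)"
    using insert.hyps by simp
  also have "\<dots> = (\<integral>\<^sup>+\<mu>. h i (emeasure \<mu> (B i)) \<partial>pois \<nu>) * (\<integral>\<^sup>+\<mu>. (\<Prod>j\<in>J. h j (emeasure \<mu> (B j))) \<partial>pois \<nu>)"
  proof (rule pois_indep(1)[OF \<nu> Bi])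
    show "(\<lambda>\<mu>. \<Prod>j\<in>J. h j (emeasure \<mu> (B j))) \<in> borel_measurable \<N>"
      using m by (intro borel_measurable_prod_ennreal) auto
    fix \<mu> assume \<mu>: "\<mu> \<in> space \<N>"
    show "h i (emeasure (restrict_meas \<mu> (B i)) (B i)) = h i (emeasure \<mu> (B i))"
      using Bi by (simp add: emeasure_restrict_meas sets_counting_space[OF \<mu>])
    show "(\<Prod>j\<in>J. h j (emeasure (restrict_meas \<mu> (space M - B i)) (B j))) = (\<Prod>j\<in>J. h j (emeasure \<mu> (B j)))"
      using BJ Bi disj by (intro prod.cong refl) (simp add: emeasure_restrict_meas sets_counting_space[OF \<mu>])
  qed (use m in auto)
  also have "\<dots> = (\<integral>\<^sup>+\<mu>. h i (emeasure \<mu> (B i)) \<partial>pois \<nu>) * (\<Prod>j\<in>J. \<integral>\<^sup>+\<mu>. h j (emeasure \<mu> (B j)) \<partial>pois \<nu>)"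
    using insert.prems by (subst insert.IH) (auto simp: disjoint_family_on_def)
  finally show ?case using insert.hyps by simp
qed

text \<open>The existence half for the definite description: the identity on configurations is the
  canonical process.\<close>

lemma poisson_process_pois:
  assumes \<nu>: "intens \<nu>"
  shows "poisson_process (pois \<nu>) (\<lambda>\<mu>. \<mu>) \<nu>"
proof -
  interpret prob_space "pois \<nu>" by (rule prob_space_pois[OF \<nu>])
  have c: "counting_algebra \<nu> = \<N>" by (rule counting_algebra_cong[OF intens_sets[OF \<nu>]])
  have "indep_vars (\<lambda>_. borel) (\<lambda>i \<mu>. emeasure \<mu> (B i)) {..<m}"
    if B: "\<forall>i<m. B i \<in> sets M" and disj: "disjoint_family_on B {..<m}" for m :: nat and B
    unfolding indep_vars_def2
  proof (intro conjI ballI)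
    show rv: "random_variable borel (\<lambda>\<mu>. emeasure \<mu> (B i))" if "i \<in> {..<m}" for i
      using B that emeasure_measurable[of "B i"] by (simp cong: measurable_cong_sets)
    show "indep_sets (\<lambda>i. {(\<lambda>\<mu>. emeasure \<mu> (B i)) -` A \<inter> space (pois \<nu>) |A. A \<in> sets borel}) {..<m}"
      unfolding indep_sets_def
    proof (intro conjI ballI allI impI)
      fix i assume "i \<in> {..<m}"
      then show "{(\<lambda>\<mu>. emeasure \<mu> (B i)) -` A \<inter> space (pois \<nu>) |A. A \<in> sets borel} \<subseteq> events"
        using rv by (auto dest: measurable_sets)
    next
      fix J and A :: "nat \<Rightarrow> 'a measure set"
      assume J: "J \<subseteq> {..<m}" "J \<noteq> {}" "finite J"
        and A: "A \<in> (\<Pi> j\<in>J. {(\<lambda>\<mu>. emeasure \<mu> (B j)) -` A \<inter> space (pois \<nu>) |A. A \<in> sets borel})"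
      have "\<forall>j\<in>J. \<exists>C. C \<in> sets borel \<and> A j = (\<lambda>\<mu>. emeasure \<mu> (B j)) -` C \<inter> space (pois \<nu>)"
        using Pi_mem[OF A] by blast
      then obtain C where C: "\<And>j. j \<in> J \<Longrightarrow> C j \<in> sets borel"
        and AC: "\<And>j. j \<in> J \<Longrightarrow> A j = (\<lambda>\<mu>. emeasure \<mu> (B j)) -` C j \<inter> space (pois \<nu>)"
        by metis
      have Aev: "A j \<in> events" if "j \<in> J" for j
        using AC[OF that] C[OF that] rv J that by (auto intro: measurable_sets)
      have "(\<integral>\<^sup>+\<mu>. (\<Prod>j\<in>J. indicator (C j) (emeasure \<mu> (B j)) :: ennreal) \<partial>pois \<nu>) =
          (\<Prod>j\<in>J. \<integral>\<^sup>+\<mu>. indicator (C j) (emeasure \<mu> (B j)) \<partial>pois \<nu>)"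
        using J B C disjoint_family_on_mono[OF J(1) disj]
        by (intro pois_prod_indep[OF \<nu>]) auto
      moreover have "(\<integral>\<^sup>+\<mu>. indicator (C j) (emeasure \<mu> (B j)) \<partial>pois \<nu>) = emeasure (pois \<nu>) (A j)" if "j \<in> J" for j
      proof -
        have "(\<integral>\<^sup>+\<mu>. indicator (C j) (emeasure \<mu> (B j)) \<partial>pois \<nu>) = (\<integral>\<^sup>+\<mu>. indicator (A j) \<mu> \<partial>pois \<nu>)"
          by (rule nn_integral_cong) (simp add: AC[OF that] indicator_def)
        then show ?thesis by (simp only: nn_integral_indicator[OF Aev[OF that]])
      qed
      moreover have "(\<integral>\<^sup>+\<mu>. (\<Prod>j\<in>J. indicator (C j) (emeasure \<mu> (B j)) :: ennreal) \<partial>pois \<nu>) = emeasure (pois \<nu>) (\<Inter> (A ` J))"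
      proof -
        have "(\<Prod>j\<in>J. indicator (C j) (emeasure \<mu> (B j)) :: ennreal) = indicator (\<Inter> (A ` J)) \<mu>" if "\<mu> \<in> space (pois \<nu>)" for \<mu>
        proof (cases "\<mu> \<in> \<Inter> (A ` J)")
          case True
          have "emeasure \<mu> (B j) \<in> C j" if "j \<in> J" for j
          proof -
            have "\<mu> \<in> A j" using True that by blast
            then show ?thesis by (simp add: AC[OF that])
          qed
          then have "(\<Prod>j\<in>J. indicator (C j) (emeasure \<mu> (B j)) :: ennreal) = 1"
            by (intro prod.neutral) simp
          then show ?thesis using True by (simp only: indicator_simps)
        next
          case False
          then obtain j where j: "j \<in> J" "\<mu> \<notin> A j" by auto
          then have "indicator (C j) (emeasure \<mu> (B j)) = (0 :: ennreal)" using AC[OF j(1)] that by simp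
          then have "(\<Prod>j\<in>J. indicator (C j) (emeasure \<mu> (B j)) :: ennreal) = 0"
            using j J(3) by (intro prod_zero) auto
          then show ?thesis using False by (simp only: indicator_def of_bool_eq if_False simp_thms)
        qed
        then have "(\<integral>\<^sup>+\<mu>. (\<Prod>j\<in>J. indicator (C j) (emeasure \<mu> (B j)) :: ennreal) \<partial>pois \<nu>) =
            (\<integral>\<^sup>+\<mu>. indicator (\<Inter> (A ` J)) \<mu> \<partial>pois \<nu>)"
          by (intro nn_integral_cong) simp
        also have "\<Inter> (A ` J) \<in> events" using J Aev by (intro sets.finite_INT) auto
        then have "(\<integral>\<^sup>+\<mu>. indicator (\<Inter> (A ` J)) \<mu> \<partial>pois \<nu>) = emeasure (pois \<nu>) (\<Inter> (A ` J))"
          by (rule nn_integral_indicator)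
        finally show ?thesis .
      qed
      ultimately show "prob (\<Inter> (A ` J)) = (\<Prod>j\<in>J. prob (A j))"
        by (simp add: emeasure_eq_measure prod_ennreal prod_nonneg cong: prod.cong)
    qed
  qed
  then show ?thesis
    unfolding poisson_process_def point_process_def c
    using pois_count[OF \<nu>] prob_space_axioms
    by (auto simp: intens_sets[OF \<nu>])
qed

section \<open>Uniqueness of the Poisson law\<close>

text \<open>Counts take values in the natural numbers, so the prescribed point probabilities
  determine their law.\<close>

lemma poisson_process_count_law:
  fixes P :: "'w measure" and P' :: "'v measure"
  assumes P: "poisson_process P \<eta> \<nu>" and P': "poisson_process P' \<eta>' \<nu>" and \<nu>: "intens \<nu>" and B: "B \<in> sets M"
  shows "distr P borel (\<lambda>\<omega>. emeasure (\<eta> \<omega>) B) = distr P' borel (\<lambda>\<omega>. emeasure (\<eta>' \<omega>) B)"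
proof (rule measure_eqI)
  have *: "emeasure (distr P borel (\<lambda>\<omega>. emeasure (\<eta> \<omega>) B)) A =
      (\<Sum>k. indicator A (of_nat k :: ennreal) * ennreal (measure \<nu> B ^ k / fact k * exp (- measure \<nu> B)))"
    if P: "poisson_process P \<eta> \<nu>" and A: "A \<in> sets borel" for P :: "'u measure" and \<eta> A
  proof -
    from P have "prob_space P" and \<eta>: "\<eta> \<in> measurable P \<N>"
      unfolding poisson_process_def point_process_def counting_algebra_cong[OF intens_sets[OF \<nu>]] by auto
    then interpret prob_space P by simp
    have [measurable]: "(\<lambda>\<omega>. emeasure (\<eta> \<omega>) B) \<in> borel_measurable P"
      by (rule measurable_compose[OF \<eta> emeasure_measurable[OF B]])
    have [measurable]: "A \<in> sets borel" by fact
    have k: "emeasure P {\<omega> \<in> space P. emeasure (\<eta> \<omega>) B = of_nat k} = ennreal (measure \<nu> B ^ k / fact k * exp (- measure \<nu> B))" for k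
      using P B unfolding poisson_process_def by (simp add: intens_sets[OF \<nu>] emeasure_eq_measure)
    have "emeasure (distr P borel (\<lambda>\<omega>. emeasure (\<eta> \<omega>) B)) A = (\<integral>\<^sup>+\<omega>. indicator A (emeasure (\<eta> \<omega>) B) \<partial>P)"
      using A by (simp add: nn_integral_distr flip: nn_integral_indicator)
    also have "\<dots> = (\<integral>\<^sup>+\<omega>. (\<Sum>k. indicator A (of_nat k :: ennreal) * indicator {\<omega> \<in> space P. emeasure (\<eta> \<omega>) B = of_nat k} \<omega>) \<partial>P)"
    proof (rule nn_integral_cong)
      fix \<omega> assume \<omega>: "\<omega> \<in> space P"
      obtain n where n: "emeasure (\<eta> \<omega>) B = of_nat n"
        using emeasure_counting_Nats[OF measurable_space[OF \<eta> \<omega>]] ennreal_Nats_E by metis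
      show "indicator A (emeasure (\<eta> \<omega>) B) = (\<Sum>k. indicator A (of_nat k :: ennreal) * indicator {\<omega> \<in> space P. emeasure (\<eta> \<omega>) B = of_nat k} \<omega> :: ennreal)"
        using \<omega> n by (subst suminf_finite[of "{n}"]) auto
    qed
    also have "\<dots> = (\<Sum>k. indicator A (of_nat k :: ennreal) * emeasure P {\<omega> \<in> space P. emeasure (\<eta> \<omega>) B = of_nat k})"
      by (subst nn_integral_suminf) (simp_all add: nn_integral_cmult)
    finally show ?thesis by (simp only: k)
  qed
  fix A assume "A \<in> sets (distr P borel (\<lambda>\<omega>. emeasure (\<eta> \<omega>) B))"
  then have "A \<in> sets borel" by simp
  from *[OF P this] *[OF P' this]
  show "emeasure (distr P borel (\<lambda>\<omega>. emeasure (\<eta> \<omega>) B)) A = emeasure (distr P' borel (\<lambda>\<omega>. emeasure (\<eta>' \<omega>) B)) A"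
    by simp
qed simp

text \<open>Independence makes the joint law a product of the laws of the counts. A nonempty index
  set is what the description of independence by product measures asks for.\<close>

lemma poisson_process_joint_law:
  fixes P :: "'w measure" and P' :: "'v measure" and m :: nat
  assumes P: "poisson_process P \<eta> \<nu>" and P': "poisson_process P' \<eta>' \<nu>" and \<nu>: "intens \<nu>"
    and C: "\<And>i. i < m \<Longrightarrow> C i \<in> sets M" and disj: "disjoint_family_on C {..<m}" and "0 < m"
  shows "distr P (PiM {..<m} (\<lambda>_. borel)) (\<lambda>\<omega>. \<lambda>i\<in>{..<m}. emeasure (\<eta> \<omega>) (C i)) =
    distr P' (PiM {..<m} (\<lambda>_. borel)) (\<lambda>\<omega>. \<lambda>i\<in>{..<m}. emeasure (\<eta>' \<omega>) (C i))"
proof -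
  have *: "distr P (PiM {..<m} (\<lambda>_. borel)) (\<lambda>\<omega>. \<lambda>i\<in>{..<m}. emeasure (\<eta> \<omega>) (C i)) =
      PiM {..<m} (\<lambda>i. distr P borel (\<lambda>\<omega>. emeasure (\<eta> \<omega>) (C i)))"
    if P: "poisson_process P \<eta> \<nu>" for P :: "'u measure" and \<eta>
  proof -
    from P have "prob_space P" and \<eta>: "\<eta> \<in> measurable P \<N>"
      unfolding poisson_process_def point_process_def counting_algebra_cong[OF intens_sets[OF \<nu>]] by auto
    then interpret prob_space P by simp
    have "indep_vars (\<lambda>_. borel) (\<lambda>i \<omega>. emeasure (\<eta> \<omega>) (C i)) {..<m}"
    proof -
      have "\<forall>m::nat. \<forall>B. (\<forall>i<m. B i \<in> sets \<nu>) \<and> disjoint_family_on B {..<m} \<longrightarrow>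
          indep_vars (\<lambda>_. borel) (\<lambda>i \<omega>. emeasure (\<eta> \<omega>) (B i)) {..<m}"
        using P unfolding poisson_process_def by blast
      then show ?thesis using C disj by (simp add: intens_sets[OF \<nu>])
    qed
    then show ?thesis
      using \<open>0 < m\<close> C
      by (subst (asm) indep_vars_iff_distr_eq_PiM')
         (auto intro: measurable_compose[OF \<eta> emeasure_measurable])
  qed
  show ?thesis
    unfolding *[OF P] *[OF P']
    by (intro PiM_cong refl poisson_process_count_law[OF P P' \<nu>] C) auto
qed

text \<open>The cells are the atoms of the finite algebra generated by the sets: one, possibly
  empty, for each pattern of membership.\<close>

lemma ex_disjoint_refinement:
  fixes B :: "nat \<Rightarrow> 'a set"
  assumes B[measurable]: "\<And>i. i < m \<Longrightarrow> B i \<in> sets M"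
  obtains n C S where "0 < n" "\<And>j. j < n \<Longrightarrow> C j \<in> sets M" "disjoint_family_on C {..<n::nat}"
    "\<And>i. i < m \<Longrightarrow> S i \<subseteq> {..<n}" "\<And>i. i < m \<Longrightarrow> B i = (\<Union>j\<in>S i. C j)"
proof -
  obtain h where h: "bij_betw h {..<card (Pow {..<m})} (Pow {..<m})"
    using ex_bij_betw_nat_finite[of "Pow {..<m}"] by (auto simp: atLeast0LessThan)
  define n where "n = card (Pow {..<m})"
  define C where "C j = {x \<in> space M. \<forall>i\<in>{..<m}. x \<in> B i \<longleftrightarrow> i \<in> h j}" for j
  define S where "S i = {j \<in> {..<n}. i \<in> h j}" for i
  have inj: "inj_on h {..<n}" and im: "h ` {..<n} = Pow {..<m}"
    using h by (auto simp: bij_betw_def n_def)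
  show thesis
  proof
    \<comment> \<open>The empty pattern counts even if m = 0, so there is always a cell.\<close>
    show "0 < n" by (simp add: n_def card_Pow)
    show "C j \<in> sets M" for j
    proof -
      have "{x \<in> space M. x \<in> B i \<longleftrightarrow> i \<in> h j} \<in> sets M" if "i \<in> {..<m}" for i
      proof -
        have [measurable]: "B i \<in> sets M" using that by simp
        show ?thesis
        proof (cases "i \<in> h j")
          case True
          have "{x \<in> space M. x \<in> B i} \<in> sets M" by measurable
          with True show ?thesis by simp
        next
          case False
          have "{x \<in> space M. x \<notin> B i} \<in> sets M" by measurable
          with False show ?thesis by simp
        qed
      qed
      then show ?thesis unfolding C_def by (intro sets.sets_Collect_finite_All) auto
    qed
    show "disjoint_family_on C {..<n}"
    proof (unfold disjoint_family_on_def, intro ballI impI)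
      fix j k assume jk: "j \<in> {..<n}" "k \<in> {..<n}" "j \<noteq> k"
      have "h j = h k" if "x \<in> C j" "x \<in> C k" for x
        using that jk im by (auto simp: C_def)
      with jk inj show "C j \<inter> C k = {}" by (auto simp: inj_on_def)
    qed
    show "S i \<subseteq> {..<n}" for i by (auto simp: S_def)
    show "B i = (\<Union>j\<in>S i. C j)" if i: "i < m" for i
    proof (intro equalityI subsetI)
      fix x assume x: "x \<in> B i"
      then have "x \<in> space M" using sets.sets_into_space[OF B[OF i]] by auto
      have "{k \<in> {..<m}. x \<in> B k} \<in> h ` {..<n}" unfolding im by auto
      then obtain j where "j < n" "h j = {k \<in> {..<m}. x \<in> B k}" by auto
      with x i \<open>x \<in> space M\<close> show "x \<in> (\<Union>j\<in>S i. C j)" by (auto simp: S_def C_def)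
    qed (use i in \<open>auto simp: S_def C_def\<close>)
  qed
qed

text \<open>Generator for the uniqueness argument; finitely many evaluations are allowed so that
  concatenating two index ranges expresses an intersection.\<close>

lemma sets_counting_algebra_cylinders:
  defines "E \<equiv> {{\<mu> \<in> space \<N>. \<forall>i<m. emeasure \<mu> (B i) \<in> A i} | (m :: nat) B A.
      (\<forall>i<m. B i \<in> sets M) \<and> (\<forall>i<m. A i \<in> sets (borel :: ennreal measure))}"
  shows "sets \<N> = sigma_sets (space \<N>) E" "Int_stable E"
proof -
  let ?N = "space \<N>"
  show "sets \<N> = sigma_sets ?N E"
  proof (intro equalityI)
    have "sets \<N> = sigma_sets ?N (\<Union>B\<in>sets M. sets (vimage_algebra ?N (\<lambda>\<mu>. emeasure \<mu> B) borel))"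
      unfolding space_counting_algebra unfolding counting_algebra_def
      by (subst sets_Sup_eq) (auto intro!: arg_cong2[where f=sigma_sets])
    also have "\<dots> \<subseteq> sigma_sets ?N E"
    proof (rule sigma_sets_mono, safe)
      fix B X assume B: "B \<in> sets M" and "X \<in> sets (vimage_algebra ?N (\<lambda>\<mu>. emeasure \<mu> B) borel)"
      then obtain A where A: "A \<in> sets borel" "X = (\<lambda>\<mu>. emeasure \<mu> B) -` A \<inter> ?N"
        by (auto simp: sets_vimage_algebra2)
      then have "X = {\<mu> \<in> ?N. \<forall>i<Suc 0. emeasure \<mu> ((\<lambda>_. B) i) \<in> (\<lambda>_. A) i}" by auto
      then have "X \<in> E" unfolding E_def mem_Collect_eq
        by (intro exI[of _ "Suc 0"] exI[of _ "\<lambda>_. B"] exI[of _ "\<lambda>_. A"] conjI) (auto simp: A(1) B)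
      then show "X \<in> sigma_sets ?N E" by auto
    qed
    finally show "sets \<N> \<subseteq> sigma_sets ?N E" .
  next
    show "sigma_sets ?N E \<subseteq> sets \<N>"
    proof (rule sets.sigma_sets_subset, safe)
      fix X assume "X \<in> E"
      then obtain m :: nat and B A where BA: "\<And>i. i < m \<Longrightarrow> B i \<in> sets M" "\<And>i. i < m \<Longrightarrow> A i \<in> sets (borel :: ennreal measure)"
        and X: "X = {\<mu> \<in> ?N. \<forall>i\<in>{..<m}. emeasure \<mu> (B i) \<in> A i}" by (auto simp: E_def)
      have "{\<mu> \<in> ?N. emeasure \<mu> (B i) \<in> A i} \<in> sets \<N>" if "i \<in> {..<m}" for i
        using measurable_sets[OF emeasure_measurable BA(2), of "B i" i] that BA(1)[of i]
        by (simp add: vimage_def Int_def conj_commute)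
      then show "X \<in> sets \<N>" unfolding X by (intro sets.sets_Collect_finite_All) auto
    qed
  qed
  show "Int_stable E"
  proof (rule Int_stableI)
    fix X Y assume "X \<in> E" "Y \<in> E"
    from \<open>X \<in> E\<close> obtain m :: nat and B A
      where BA: "\<And>i. i < m \<Longrightarrow> B i \<in> sets M" "\<And>i. i < m \<Longrightarrow> A i \<in> sets (borel :: ennreal measure)"
      and X: "X = {\<mu> \<in> ?N. \<forall>i<m. emeasure \<mu> (B i) \<in> A i}"
      by (auto simp: E_def)
    from \<open>Y \<in> E\<close> obtain m' :: nat and B' A'
      where BA': "\<And>i. i < m' \<Longrightarrow> B' i \<in> sets M" "\<And>i. i < m' \<Longrightarrow> A' i \<in> sets (borel :: ennreal measure)"
      and Y: "Y = {\<mu> \<in> ?N. \<forall>i<m'. emeasure \<mu> (B' i) \<in> A' i}"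
      by (auto simp: E_def)
    let ?B = "\<lambda>i. if i < m then B i else B' (i - m)" and ?A = "\<lambda>i. if i < m then A i else A' (i - m)"
    have "(\<forall>i<m + m'. emeasure \<mu> (?B i) \<in> ?A i) \<longleftrightarrow> (\<forall>i<m. emeasure \<mu> (B i) \<in> A i) \<and> (\<forall>i<m'. emeasure \<mu> (B' i) \<in> A' i)" for \<mu>
    proof safe
      fix i assume "\<forall>i<m + m'. emeasure \<mu> (?B i) \<in> ?A i" "i < m'"
      then show "emeasure \<mu> (B' i) \<in> A' i" by (auto dest: spec[of _ "m + i"])
    next
      fix i assume "\<forall>i<m + m'. emeasure \<mu> (?B i) \<in> ?A i" "i < m"
      then show "emeasure \<mu> (B i) \<in> A i" by (auto dest: spec[of _ i])
    qed auto
    then have "X \<inter> Y = {\<mu> \<in> ?N. \<forall>i<m + m'. emeasure \<mu> (?B i) \<in> ?A i}"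
      unfolding X Y by (simp only:) blast
    moreover have "(\<forall>i<m + m'. ?B i \<in> sets M) \<and> (\<forall>i<m + m'. ?A i \<in> sets (borel :: ennreal measure))"
      using BA BA' by auto
    ultimately show "X \<inter> Y \<in> E" unfolding E_def mem_Collect_eq
      by (intro exI[of _ "m + m'"] exI[of _ ?B] exI[of _ ?A] conjI) auto
  qed
qed

text \<open>It suffices to compare cylinders. Their sets may overlap, whereas independence speaks of
  disjoint ones, so a cylinder is rewritten as an event in the counts of the cells of a disjoint
  refinement.\<close>

lemma poisson_process_law_unique:
  fixes P :: "'w measure" and P' :: "'v measure"
  assumes P: "poisson_process P \<eta> \<nu>" and P': "poisson_process P' \<eta>' \<nu>" and \<nu>: "intens \<nu>"
  shows "distr P \<N> \<eta> = distr P' \<N> \<eta>'"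
proof -
  let ?N = "space \<N>"
  define E where "E = {{\<mu> \<in> ?N. \<forall>i<m. emeasure \<mu> (B i) \<in> A i} | (m :: nat) B A.
      (\<forall>i<m. B i \<in> sets M) \<and> (\<forall>i<m. A i \<in> sets (borel :: ennreal measure))}"
  note sigma = sets_counting_algebra_cylinders[folded E_def]
  from P have "prob_space P" and \<eta>: "\<eta> \<in> measurable P \<N>"
    unfolding poisson_process_def point_process_def counting_algebra_cong[OF intens_sets[OF \<nu>]] by auto
  then interpret D: prob_space "distr P \<N> \<eta>" by (intro prob_space.prob_space_distr)
  from P' have \<eta>': "\<eta>' \<in> measurable P' \<N>"
    unfolding poisson_process_def point_process_def counting_algebra_cong[OF intens_sets[OF \<nu>]] by auto
  show ?thesis
  proof (rule measure_eqI_generator_eq[OF sigma(2), of ?N _ _ "\<lambda>_. ?N"])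
    show "E \<subseteq> Pow ?N" by (auto simp: E_def)
    show "sets (distr P \<N> \<eta>) = sigma_sets ?N E" "sets (distr P' \<N> \<eta>') = sigma_sets ?N E"
      by (simp_all add: sigma(1))
    have "?N = {\<mu> \<in> ?N. \<forall>i<0::nat. emeasure \<mu> ((\<lambda>_. {}) i) \<in> (\<lambda>_. {}) i}" by simp
    then have "?N \<in> E" unfolding E_def mem_Collect_eq by blast
    then show "range (\<lambda>_::nat. ?N) \<subseteq> E" by simp
    show "emeasure (distr P \<N> \<eta>) ?N \<noteq> \<infinity>" by simp
    fix X assume XE: "X \<in> E"
    then obtain m :: nat and B A where B: "\<And>i. i < m \<Longrightarrow> B i \<in> sets M" and A: "\<And>i. i < m \<Longrightarrow> A i \<in> sets (borel :: ennreal measure)"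
      and X: "X = {\<mu> \<in> ?N. \<forall>i\<in>{..<m}. emeasure \<mu> (B i) \<in> A i}" by (auto simp: E_def)
    have XN: "X \<in> sets \<N>" using XE sigma(1) by auto
    obtain n :: nat and C S where n: "0 < n" and C: "\<And>j. j < n \<Longrightarrow> C j \<in> sets M" and disj: "disjoint_family_on C {..<n}"
      and S: "\<And>i. i < m \<Longrightarrow> S i \<subseteq> {..<n}" and BS: "\<And>i. i < m \<Longrightarrow> B i = (\<Union>j\<in>S i. C j)"
      by (rule ex_disjoint_refinement[of m B, OF B]) (assumption, blast)
    let ?Pi = "PiM {..<n} (\<lambda>_. borel :: ennreal measure)"
    \<comment> \<open>The count of \<open>B i\<close> is the sum of the counts of its cells.\<close>
    define Y where "Y = {y \<in> space ?Pi. \<forall>i\<in>{..<m}. (\<Sum>j\<in>S i. y j) \<in> A i}"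
    have Y: "Y \<in> sets ?Pi"
      unfolding Y_def
    proof (rule sets.sets_Collect_finite_All)
      fix i assume "i \<in> {..<m}"
      then have [measurable]: "A i \<in> sets borel" and "S i \<subseteq> {..<n}" using A S by auto
      then have [measurable]: "(\<lambda>y. \<Sum>j\<in>S i. y j) \<in> borel_measurable ?Pi"
        by (intro borel_measurable_sum measurable_component_singleton) auto
      show "{y \<in> space ?Pi. (\<Sum>j\<in>S i. y j) \<in> A i} \<in> sets ?Pi"
        by measurable
    qed simp
    have em: "emeasure \<mu> (B i) = (\<Sum>j\<in>S i. emeasure \<mu> (C j))" if \<mu>: "\<mu> \<in> ?N" and i: "i < m" for \<mu> i
      unfolding BS[OF i]
    proof (rule sum_emeasure[symmetric])
      show "C ` S i \<subseteq> sets \<mu>" using S[OF i] C by (auto simp: sets_counting_space[OF \<mu>])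
      show "disjoint_family_on C (S i)" using disj S[OF i] by (rule disjoint_family_on_mono[rotated])
      show "finite (S i)" using S[OF i] finite_subset by blast
    qed
    have *: "emeasure (distr P \<N> \<eta>) X = emeasure (distr P ?Pi (\<lambda>\<omega>. \<lambda>j\<in>{..<n}. emeasure (\<eta> \<omega>) (C j))) Y"
      if \<eta>: "\<eta> \<in> measurable P \<N>" for P :: "'u measure" and \<eta>
    proof -
      have v: "(\<lambda>\<omega>. \<lambda>j\<in>{..<n}. emeasure (\<eta> \<omega>) (C j)) \<in> measurable P ?Pi"
        using C by (intro measurable_restrict) (auto intro: measurable_compose[OF \<eta> emeasure_measurable])
      have "\<eta> -` X \<inter> space P = (\<lambda>\<omega>. \<lambda>j\<in>{..<n}. emeasure (\<eta> \<omega>) (C j)) -` Y \<inter> space P"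
      proof -
        have "(\<Sum>j\<in>S i. (\<lambda>j\<in>{..<n}. emeasure (\<eta> \<omega>) (C j)) j) = emeasure (\<eta> \<omega>) (B i)" if "\<omega> \<in> space P" "i < m" for \<omega> i
          unfolding em[OF measurable_space[OF \<eta> that(1)] that(2)]
          using S[OF that(2)] by (intro sum.cong) auto
        then show ?thesis
          using measurable_space[OF \<eta>] by (auto simp: X Y_def space_PiM)
      qed
      then show ?thesis
        by (simp add: emeasure_distr[OF \<eta> XN] emeasure_distr[OF v Y])
    qed
    show "emeasure (distr P \<N> \<eta>) X = emeasure (distr P' \<N> \<eta>') X"
      using poisson_process_joint_law[OF P P' \<nu> C disj n] by (simp only: *[OF \<eta>] *[OF \<eta>'])
  qed simp
qed

lemma poisson_law_eq_pois:
  assumes \<nu>: "intens \<nu>"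
  shows "poisson_law \<nu> = pois \<nu>"
proof -
  have c: "counting_algebra \<nu> = \<N>" by (rule counting_algebra_cong[OF intens_sets[OF \<nu>]])
  have d: "distr (pois \<nu>) \<N> (\<lambda>\<mu>. \<mu>) = pois \<nu>"
    by (rule distr_id2) simp
  show ?thesis
    unfolding poisson_law_def c
  proof (rule the_equality)
    show "\<exists>(P :: 'a measure measure) \<eta>. poisson_process P \<eta> \<nu> \<and> pois \<nu> = distr P \<N> \<eta>"
      using poisson_process_pois[OF \<nu>] d by (intro exI[of _ "pois \<nu>"] exI[of _ "\<lambda>\<mu>. \<mu>"]) simp
    show "Q = pois \<nu>" if "\<exists>P \<eta>. poisson_process (P :: 'a measure measure) \<eta> \<nu> \<and> Q = distr P \<N> \<eta>" for Q
      using that poisson_process_law_unique[OF _ poisson_process_pois[OF \<nu>] \<nu>] d by metis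
  qed
qed

end

section \<open>Papangelou intensities satisfying the cocycle identity\<close>

text \<open>The extended nonnegative counterpart of \<open>kappa_list\<close>, which fits integrals;
  \<open>kappa_list_eq_klist\<close> links the two.\<close>

fun klist :: "('a \<Rightarrow> 'a measure \<Rightarrow> ennreal) \<Rightarrow> 'a list \<Rightarrow> 'a measure \<Rightarrow> ennreal" where
  "klist k [] \<psi> = 1"
| "klist k (x # xs) \<psi> = k x \<psi> * klist k xs (add_dirac \<psi> x)"

lemma klist_append: "klist k (xs @ ys) \<psi> = klist k xs \<psi> * klist k ys (adds \<psi> xs)"
  by (induction xs arbitrary: \<psi>) (auto simp: mult.assoc)

lemma (in borel_emb) adds_pts_add_dirac:
  assumes "\<sigma> \<in> space \<N>" "x \<in> space M"
  shows "mset (pts (add_dirac \<sigma> x)) = mset (pts \<sigma> @ [x])"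
proof (rule adds_mset_eq)
  have "add_dirac \<sigma> x \<in> space \<N>" using assms by auto
  then show "set (pts (add_dirac \<sigma> x)) \<subseteq> space M"
    "adds (null_measure M) (pts (add_dirac \<sigma> x)) = adds (null_measure M) (pts \<sigma> @ [x])"
    using assms by (auto simp: adds_append adds_pts set_pts dest: set_pts[THEN subsetD])
  show "set (pts \<sigma> @ [x]) \<subseteq> space M" using assms set_pts by auto
qed

context borel_emb
begin

text \<open>An extended threshold, so that one family covers both the sets (x, \<infinity>) and, at
  minus infinity, the whole space.\<close>

definition upset :: "ereal \<Rightarrow> 'a set" where
  "upset t = {z \<in> space M. t < ereal (\<phi> z)}"

lemma upset_sets[measurable, simp]: "upset t \<in> sets M"
  unfolding upset_def by measurable

lemma upset_MInf: "upset (- \<infinity>) = space M"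
  by (auto simp: upset_def)

text \<open>The integral of \<open>\<kappa>\<^sub>n\<close> over increasing tuples above \<open>t\<close>, and \<open>1 / n!\<close> times the integral over
  all tuples above \<open>t\<close>. Their sum over \<open>n\<close> is \<open>exp(\<lambda>(t, \<infinity>)) Z(\<psi>)\<close>.\<close>

fun ordv :: "('a \<Rightarrow> 'a measure \<Rightarrow> ennreal) \<Rightarrow> nat \<Rightarrow> ereal \<Rightarrow> 'a measure \<Rightarrow> ennreal" where
  "ordv k 0 t \<psi> = 1"
| "ordv k (Suc n) t \<psi> =
    (\<integral>\<^sup>+z. indicator (upset t) z * (k z \<psi> * ordv k n (ereal (\<phi> z)) (add_dirac \<psi> z)) \<partial>M)"

fun unordv :: "('a \<Rightarrow> 'a measure \<Rightarrow> ennreal) \<Rightarrow> nat \<Rightarrow> ereal \<Rightarrow> 'a measure \<Rightarrow> ennreal" where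
  "unordv k 0 t \<psi> = 1"
| "unordv k (Suc n) t \<psi> = inverse (of_nat (Suc n)) *
    (\<integral>\<^sup>+z. indicator (upset t) z * (k z \<psi> * unordv k n t (add_dirac \<psi> z)) \<partial>M)"

declare unordv.simps(2)[simp del] ordv.simps(2)[simp del]

definition gfun :: "('a \<Rightarrow> 'a measure \<Rightarrow> ennreal) \<Rightarrow> ereal \<Rightarrow> 'a measure \<Rightarrow> ennreal" where
  "gfun k t \<psi> = (\<Sum>n. ordv k n t \<psi>)"

text \<open>This is exp(-H(\<mu>, \<psi>)), with the measurable enumeration \<open>pts\<close> in
  place of an arbitrary one.\<close>

definition boltzmann :: "('a \<Rightarrow> 'a measure \<Rightarrow> ennreal) \<Rightarrow> 'a measure \<Rightarrow> 'a measure \<Rightarrow> ennreal" where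
  "boltzmann k \<mu> \<psi> = klist k (pts \<mu>) \<psi>"

end

text \<open>Kept general in \<open>k\<close>: it is used for \<kappa> and again, inside
  \<open>gfun_eq_exp\<close>, for a kernel that ignores the configuration.\<close>

locale cocycle_kernel = borel_emb M \<phi> for M :: "'a measure" and \<phi> +
  fixes k :: "'a \<Rightarrow> 'a measure \<Rightarrow> ennreal"
  assumes finM: "finite_measure M" and diffM: "diffuse M"
    and k_meas: "(\<lambda>(x, \<mu>). k x \<mu>) \<in> borel_measurable (M \<Otimes>\<^sub>M \<N>)"
    and k_cocycle: "\<And>x y \<mu>. x \<in> space M \<Longrightarrow> y \<in> space M \<Longrightarrow> \<mu> \<in> space \<N> \<Longrightarrow>
      k x \<mu> * k y (add_dirac \<mu> x) = k y \<mu> * k x (add_dirac \<mu> y)"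
begin

sublocale finM: finite_measure M by (rule finM)

lemma intens_M: "intens M"
  by (simp add: intens_def finM)

section \<open>Ordered and unordered integrals of a cocycle kernel\<close>

lemma k_measurable[measurable (raw)]:
  assumes "f \<in> measurable W M" "g \<in> measurable W \<N>"
  shows "(\<lambda>w. k (f w) (g w)) \<in> borel_measurable W"
  using measurable_compose[OF measurable_Pair[OF assms] k_meas] by simp

lemma indicator_upset_measurable[measurable (raw)]:
  assumes [measurable]: "h \<in> borel_measurable W" and [measurable]: "f \<in> measurable W M"
  shows "(\<lambda>w. indicator (upset (h w)) (f w) :: ennreal) \<in> borel_measurable W"
proof -
  have "(\<lambda>w. indicator {w \<in> space W. h w < ereal (\<phi> (f w))} w :: ennreal) \<in> borel_measurable W"
    by measurable
  then show ?thesis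
    by (rule measurable_cong[THEN iffD1, rotated])
       (use measurable_space[OF assms(2)] in \<open>auto simp: upset_def indicator_def\<close>)
qed

lemma ordv_measurable[measurable (raw)]:
  assumes "h \<in> borel_measurable W" "f \<in> measurable W \<N>"
  shows "(\<lambda>w. ordv k n (h w) (f w)) \<in> borel_measurable W"
proof -
  have "(\<lambda>w. ordv k n (fst w) (snd w)) \<in> borel_measurable (borel \<Otimes>\<^sub>M \<N>)"
  proof (induction n)
    case (Suc n)
    have "(\<lambda>w. (ereal (\<phi> (snd w)), add_dirac (snd (fst w)) (snd w))) \<in>
      measurable ((borel \<Otimes>\<^sub>M \<N>) \<Otimes>\<^sub>M M) (borel \<Otimes>\<^sub>M \<N>)"
      by measurable
    from measurable_compose[OF this Suc]
    have [measurable]: "(\<lambda>w. ordv k n (ereal (\<phi> (snd w))) (add_dirac (snd (fst w)) (snd w))) \<in>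
      borel_measurable (((borel :: ereal measure) \<Otimes>\<^sub>M \<N>) \<Otimes>\<^sub>M M)" by simp
    show ?case
      unfolding ordv.simps by measurable
  qed simp
  from measurable_compose[OF measurable_Pair[OF assms] this] show ?thesis by simp
qed

lemma unordv_measurable[measurable (raw)]:
  assumes "h \<in> borel_measurable W" "f \<in> measurable W \<N>"
  shows "(\<lambda>w. unordv k n (h w) (f w)) \<in> borel_measurable W"
proof -
  have "(\<lambda>w. unordv k n (fst w) (snd w)) \<in> borel_measurable (borel \<Otimes>\<^sub>M \<N>)"
  proof (induction n)
    case (Suc n)
    have "(\<lambda>w. (fst (fst w), add_dirac (snd (fst w)) (snd w))) \<in>
      measurable ((borel \<Otimes>\<^sub>M \<N>) \<Otimes>\<^sub>M M) ((borel :: ereal measure) \<Otimes>\<^sub>M \<N>)"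
      by measurable
    from measurable_compose[OF this Suc]
    have [measurable]: "(\<lambda>w. unordv k n (fst (fst w)) (add_dirac (snd (fst w)) (snd w))) \<in>
      borel_measurable (((borel :: ereal measure) \<Otimes>\<^sub>M \<N>) \<Otimes>\<^sub>M M)" by simp
    show ?case
      unfolding unordv.simps by measurable
  qed simp
  from measurable_compose[OF measurable_Pair[OF assms] this] show ?thesis by simp
qed

lemma gfun_measurable[measurable (raw)]:
  assumes "h \<in> borel_measurable W" "f \<in> measurable W \<N>"
  shows "(\<lambda>w. gfun k (h w) (f w)) \<in> borel_measurable W"
  unfolding gfun_def using assms by measurable

text \<open>Any of the \<open>n + 1\<close> ordered points may be the one that is singled out; moving it to the
  front is where the cocycle identity enters.\<close>

lemma ordv_insert:
  assumes "\<psi> \<in> space \<N>"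
  shows "(\<integral>\<^sup>+x. indicator (upset t) x * (k x \<psi> * ordv k n t (add_dirac \<psi> x)) \<partial>M) =
    of_nat (Suc n) * ordv k (Suc n) t \<psi>"
  using assms
proof (induction n arbitrary: t \<psi>)
  case 0
  then show ?case by (simp add: ordv.simps)
next
  case (Suc n)
  note \<psi>[measurable] = Suc.prems
  interpret P: pair_sigma_finite M M ..
  let ?T = "\<lambda>x z. k x \<psi> * (k z (add_dirac \<psi> x) * ordv k n (ereal (\<phi> z)) (add_dirac (add_dirac \<psi> x) z))"
  have "(\<integral>\<^sup>+x. indicator (upset t) x * (k x \<psi> * ordv k (Suc n) t (add_dirac \<psi> x)) \<partial>M) =
      (\<integral>\<^sup>+x. (\<integral>\<^sup>+z. indicator (upset t) x * (indicator (upset t) z * ?T x z) \<partial>M) \<partial>M)"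
  proof (rule nn_integral_cong)
    fix x assume [measurable]: "x \<in> space M"
    show "indicator (upset t) x * (k x \<psi> * ordv k (Suc n) t (add_dirac \<psi> x)) =
        (\<integral>\<^sup>+z. indicator (upset t) x * (indicator (upset t) z * ?T x z) \<partial>M)"
      unfolding ordv.simps by (simp add: nn_integral_cmult[symmetric] mult.left_commute)
  qed
  \<comment> \<open>The marked point \<open>x\<close> is either below or above the lowest ordered
    point \<open>z\<close>; ties are null since \<open>M\<close> is diffuse.\<close>
  also have "\<dots> = (\<integral>\<^sup>+x. (\<integral>\<^sup>+z. indicator (upset t) x * (indicator (upset (ereal (\<phi> x))) z * ?T x z) +
      indicator (upset t) z * (indicator (upset (ereal (\<phi> z))) x * ?T x z) \<partial>M) \<partial>M)"
  proof (rule nn_integral_cong, rule nn_integral_cong_AE)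
    fix x assume x: "x \<in> space M"
    have "AE z in M. z \<noteq> x"
      using x diffM by (intro AE_I'[of "{x}"]) (auto simp: null_sets_def diffuse_def)
    then show "AE z in M. indicator (upset t) x * (indicator (upset t) z * ?T x z) =
      indicator (upset t) x * (indicator (upset (ereal (\<phi> x))) z * ?T x z) +
      indicator (upset t) z * (indicator (upset (ereal (\<phi> z))) x * ?T x z)"
      using AE_space
    proof eventually_elim
      case (elim z)
      then have "\<phi> z \<noteq> \<phi> x" using x inj_phi by (auto simp: inj_on_def)
      then consider "\<phi> z < \<phi> x" | "\<phi> x < \<phi> z" by linarith
      then show ?case
      proof cases
        case 1
        then have "t < ereal (\<phi> x)" if "t < ereal (\<phi> z)"
          using that by (metis less_ereal.simps(1) less_trans)
        with 1 elim x show ?thesis by (auto simp: upset_def indicator_def)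
      next
        case 2
        then have "t < ereal (\<phi> z)" if "t < ereal (\<phi> x)"
          using that by (metis less_ereal.simps(1) less_trans)
        with 2 elim x show ?thesis by (auto simp: upset_def indicator_def)
      qed
    qed
  qed
  also have "\<dots> = (\<integral>\<^sup>+x. \<integral>\<^sup>+z. indicator (upset t) x * (indicator (upset (ereal (\<phi> x))) z * ?T x z) \<partial>M \<partial>M) +
      (\<integral>\<^sup>+x. \<integral>\<^sup>+z. indicator (upset t) z * (indicator (upset (ereal (\<phi> z))) x * ?T x z) \<partial>M \<partial>M)"
    by (subst nn_integral_add[symmetric]) (auto intro!: nn_integral_cong nn_integral_add)
  \<comment> \<open>If \<open>x\<close> is lowest, prepending it yields one ordered integral over n
    + 2 points.\<close>
  also have "(\<integral>\<^sup>+x. \<integral>\<^sup>+z. indicator (upset t) x * (indicator (upset (ereal (\<phi> x))) z * ?T x z) \<partial>M \<partial>M) =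
      ordv k (Suc (Suc n)) t \<psi>"
    unfolding ordv.simps
  proof (rule nn_integral_cong)
    fix x assume [measurable]: "x \<in> space M"
    show "(\<integral>\<^sup>+z. indicator (upset t) x * (indicator (upset (ereal (\<phi> x))) z * ?T x z) \<partial>M) =
        indicator (upset t) x * (k x \<psi> * (\<integral>\<^sup>+z. indicator (upset (ereal (\<phi> x))) z *
          (k z (add_dirac \<psi> x) * ordv k n (ereal (\<phi> z)) (add_dirac (add_dirac \<psi> x) z)) \<partial>M))"
      by (simp add: nn_integral_cmult[symmetric] mult.left_commute)
  qed
  also have "(\<integral>\<^sup>+x. \<integral>\<^sup>+z. indicator (upset t) z * (indicator (upset (ereal (\<phi> z))) x * ?T x z) \<partial>M \<partial>M) =
      (\<integral>\<^sup>+z. \<integral>\<^sup>+x. indicator (upset t) z * (indicator (upset (ereal (\<phi> z))) x * ?T x z) \<partial>M \<partial>M)"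
    by (rule P.Fubini'[symmetric]) measurable
  \<comment> \<open>If \<open>z\<close> is lowest, the cocycle identity moves it to the front, and
    the induction hypothesis above \<open>z\<close> gives the factor n + 1. With the other case this
    makes n + 2.\<close>
  also have "\<dots> = (\<integral>\<^sup>+z. indicator (upset t) z * (k z \<psi> * (of_nat (Suc n) * ordv k (Suc n) (ereal (\<phi> z)) (add_dirac \<psi> z))) \<partial>M)"
  proof (rule nn_integral_cong)
    fix z assume z[measurable]: "z \<in> space M"
    have "(\<integral>\<^sup>+x. indicator (upset t) z * (indicator (upset (ereal (\<phi> z))) x * ?T x z) \<partial>M) =
      (\<integral>\<^sup>+x. indicator (upset t) z * (k z \<psi> * (indicator (upset (ereal (\<phi> z))) x *
        (k x (add_dirac \<psi> z) * ordv k n (ereal (\<phi> z)) (add_dirac (add_dirac \<psi> z) x)))) \<partial>M)"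
    proof (rule nn_integral_cong)
      fix x assume x: "x \<in> space M"
      have "?T x z = (k x \<psi> * k z (add_dirac \<psi> x)) * ordv k n (ereal (\<phi> z)) (add_dirac (add_dirac \<psi> z) x)"
        by (simp add: mult.assoc add_dirac_commute[of \<psi> x z])
      also have "\<dots> = (k z \<psi> * k x (add_dirac \<psi> z)) * ordv k n (ereal (\<phi> z)) (add_dirac (add_dirac \<psi> z) x)"
        by (simp only: k_cocycle[OF x z \<psi>])
      finally show "indicator (upset t) z * (indicator (upset (ereal (\<phi> z))) x * ?T x z) =
          indicator (upset t) z * (k z \<psi> * (indicator (upset (ereal (\<phi> z))) x *
            (k x (add_dirac \<psi> z) * ordv k n (ereal (\<phi> z)) (add_dirac (add_dirac \<psi> z) x))))"
        by (simp add: mult_ac)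
    qed
    also have "\<dots> = indicator (upset t) z * (k z \<psi> * (\<integral>\<^sup>+x. indicator (upset (ereal (\<phi> z))) x *
        (k x (add_dirac \<psi> z) * ordv k n (ereal (\<phi> z)) (add_dirac (add_dirac \<psi> z) x)) \<partial>M))"
      by (simp add: nn_integral_cmult)
    finally show "(\<integral>\<^sup>+x. indicator (upset t) z * (indicator (upset (ereal (\<phi> z))) x * ?T x z) \<partial>M) =
       indicator (upset t) z * (k z \<psi> * (of_nat (Suc n) * ordv k (Suc n) (ereal (\<phi> z)) (add_dirac \<psi> z)))"
      by (simp only: Suc.IH[OF add_dirac_in_counting[OF \<psi>]])
  qed
  also have "\<dots> = of_nat (Suc n) * ordv k (Suc (Suc n)) t \<psi>"
    unfolding ordv.simps(2)[of k "Suc n"]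
    by (subst nn_integral_cmult[symmetric]) (auto simp: mult_ac simp del: of_nat_Suc)
  finally show ?case
    by (simp add: distrib_right)
qed

text \<open>By \<open>ordv_insert\<close>, \<open>ordv\<close> satisfies the recursion that defines
  \<open>unordv\<close>: symmetry makes n! orders contribute equally.\<close>

lemma unordv_eq_ordv:
  assumes "\<psi> \<in> space \<N>"
  shows "unordv k n t \<psi> = ordv k n t \<psi>"
  using assms
proof (induction n arbitrary: \<psi>)
  case (Suc n)
  have "unordv k (Suc n) t \<psi> = inverse (of_nat (Suc n)) *
      (\<integral>\<^sup>+z. indicator (upset t) z * (k z \<psi> * ordv k n t (add_dirac \<psi> z)) \<partial>M)"
    using Suc by (simp add: unordv.simps add_dirac_in_counting)
  also have "\<dots> = inverse (of_nat (Suc n)) * (of_nat (Suc n) * ordv k (Suc n) t \<psi>)"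
    by (simp only: ordv_insert[OF Suc.prems])
  also have "\<dots> = ordv k (Suc n) t \<psi>"
    by (subst mult.left_commute) (rule of_nat_Suc_inverse_cancel)
  finally show ?case .
qed simp

lemma gfun_eq:
  assumes \<psi>[measurable]: "\<psi> \<in> space \<N>"
  shows "gfun k t \<psi> = 1 + (\<integral>\<^sup>+z. indicator (upset t) z * (k z \<psi> * gfun k (ereal (\<phi> z)) (add_dirac \<psi> z)) \<partial>M)"
proof -
  have "gfun k t \<psi> = (\<Sum>n. ordv k (Suc n) t \<psi>) + 1"
    unfolding gfun_def using suminf_offset[OF summableI, of "\<lambda>n. ordv k n t \<psi>" 1] by simp
  also have "(\<Sum>n. ordv k (Suc n) t \<psi>) =
      (\<integral>\<^sup>+z. (\<Sum>n. indicator (upset t) z * (k z \<psi> * ordv k n (ereal (\<phi> z)) (add_dirac \<psi> z))) \<partial>M)"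
    unfolding ordv.simps by (rule nn_integral_suminf[symmetric]) measurable
  finally show ?thesis
    by (simp add: gfun_def add.commute)
qed

section \<open>The Boltzmann weight and its partition function\<close>

text \<open>The point travels to the front by adjacent transpositions, each of them one cocycle
  identity.\<close>

lemma klist_move:
  assumes "x \<in> space M" "set us \<subseteq> space M" "\<psi> \<in> space \<N>"
  shows "klist k (us @ x # vs) \<psi> = klist k (x # us @ vs) \<psi>"
  using assms
proof (induction us arbitrary: \<psi>)
  case (Cons u us)
  then have "klist k ((u # us) @ x # vs) \<psi> = k u \<psi> * klist k (x # us @ vs) (add_dirac \<psi> u)"
    using add_dirac_in_counting[of \<psi> M u] by simp
  also have "\<dots> = (k u \<psi> * k x (add_dirac \<psi> u)) * klist k (us @ vs) (add_dirac (add_dirac \<psi> x) u)"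
    by (simp add: mult.assoc add_dirac_commute[of \<psi> u x])
  also have "k u \<psi> * k x (add_dirac \<psi> u) = k x \<psi> * k u (add_dirac \<psi> x)"
    using Cons by (intro k_cocycle) auto
  finally show ?case by (simp add: mult.assoc)
qed simp

text \<open>The Hamiltonian is well defined: the enumeration chosen by SOME and the sorted one give
  the same weight.\<close>

lemma klist_mset:
  assumes "mset xs = mset ys" "set xs \<subseteq> space M" "\<psi> \<in> space \<N>"
  shows "klist k xs \<psi> = klist k ys \<psi>"
  using assms
proof (induction xs arbitrary: ys \<psi>)
  case (Cons x xs)
  have sy: "set ys \<subseteq> space M" using Cons.prems(1,2) by (metis set_mset_mset)
  have "x \<in> set ys" using Cons.prems(1) by (metis list.set_intros(1) set_mset_mset)
  then obtain us vs where ys: "ys = us @ x # vs" by (auto simp: in_set_conv_decomp)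
  have "mset xs = mset (us @ vs)" using Cons.prems(1) by (simp add: ys)
  then have "klist k (x # xs) \<psi> = klist k (x # us @ vs) \<psi>"
    using Cons.IH[of "us @ vs" "add_dirac \<psi> x"] Cons.prems add_dirac_in_counting[of \<psi> M x] by auto
  also have "\<dots> = klist k ys \<psi>"
    unfolding ys using sy Cons.prems by (intro klist_move[symmetric]) (auto simp: ys)
  finally show ?case .
qed simp

lemma boltzmann_adds:
  assumes "set xs \<subseteq> space M" "\<psi> \<in> space \<N>"
  shows "boltzmann k (adds (null_measure M) xs) \<psi> = klist k xs \<psi>"
proof -
  have N: "adds (null_measure M) xs \<in> space \<N>" by auto
  show ?thesis
    unfolding boltzmann_def
    using assms set_pts[OF N] adds_pts[OF N] by (intro klist_mset adds_mset_eq) auto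
qed

lemma boltzmann_null[simp]: "boltzmann k (null_measure M) \<psi> = 1"
  by (simp add: boltzmann_def)

text \<open>The new point may be put last, where its factor sees \<psi> and all of \<mu>. For \<psi>
  = 0 that factor is \<open>k x \<mu>\<close>, the Papangelou intensity needed after the Mecke
  equation.\<close>

lemma boltzmann_add_dirac:
  assumes "\<mu> \<in> space \<N>" "x \<in> space M" "\<psi> \<in> space \<N>"
  shows "boltzmann k (add_dirac \<mu> x) \<psi> = boltzmann k \<mu> \<psi> * k x (adds \<psi> (pts \<mu>))"
proof -
  have "set (pts (add_dirac \<mu> x)) \<subseteq> space M" using assms by (intro set_pts) auto
  then have "boltzmann k (add_dirac \<mu> x) \<psi> = klist k (pts \<mu> @ [x]) \<psi>"
    unfolding boltzmann_def using adds_pts_add_dirac[OF assms(1,2)] assms(3) by (intro klist_mset)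
  then show ?thesis by (simp add: klist_append boltzmann_def)
qed

lemma boltzmann_measurable[measurable (raw)]:
  assumes "f \<in> measurable W \<N>" "g \<in> measurable W \<N>"
  shows "(\<lambda>w. boltzmann k (f w) (g w)) \<in> borel_measurable W"
proof -
  have "(\<lambda>(\<psi>, \<mu>). klist k (pts \<mu>) \<psi>) \<in> borel_measurable (\<N> \<Otimes>\<^sub>M \<N>)"
  proof (rule measurable_pts)
    fix n :: nat
    have "(\<lambda>w. klist k (map (snd w) is) (f w)) \<in> borel_measurable (\<N> \<Otimes>\<^sub>M PiM {..<n} (\<lambda>_. M))"
      if "set is \<subseteq> {..<n}" "f \<in> measurable (\<N> \<Otimes>\<^sub>M PiM {..<n} (\<lambda>_. M)) \<N>" for "is" f
      using that
    proof (induction "is" arbitrary: f)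
      case (Cons i "is")
      have [measurable]: "i \<in> {..<n}" "f \<in> measurable (\<N> \<Otimes>\<^sub>M PiM {..<n} (\<lambda>_. M)) \<N>"
        using Cons.prems by auto
      have i[measurable]: "(\<lambda>w. snd w i) \<in> measurable (\<N> \<Otimes>\<^sub>M PiM {..<n} (\<lambda>_. M)) M"
        by measurable
      have "(\<lambda>w. klist k (map (snd w) is) (add_dirac (f w) (snd w i))) \<in> borel_measurable (\<N> \<Otimes>\<^sub>M PiM {..<n} (\<lambda>_. M))"
        using Cons.prems by (intro Cons.IH measurable_add_dirac i) auto
      then show ?case by simp
    qed simp
    from this[of "[0..<n]" fst]
    show "(\<lambda>(\<psi>, \<omega>). klist k (map \<omega> [0..<n]) \<psi>) \<in> borel_measurable (\<N> \<Otimes>\<^sub>M PiM {..<n} (\<lambda>_. M))"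
      by (simp add: case_prod_beta atLeast0LessThan)
  qed
  from measurable_compose[OF measurable_Pair[OF assms(2,1)] this] show ?thesis
    by (simp add: boltzmann_def)
qed

text \<open>\<open>pins\<close> accumulates points in the argument of the weight,
  \<open>unordv\<close> on top of the boundary \<psi>. Each new factor sees \<psi> together with the
  points already added, so the two recursions agree up to the weight of \<sigma>.\<close>

lemma pins_boltzmann:
  assumes \<psi>[measurable]: "\<psi> \<in> space \<N>" and \<sigma>: "\<sigma> \<in> space \<N>"
  shows "pins (restrict_meas M (upset t)) n (\<lambda>\<mu>. boltzmann k \<mu> \<psi>) \<sigma> = boltzmann k \<sigma> \<psi> * unordv k n t (adds \<psi> (pts \<sigma>))"
  using \<sigma>
proof (induction n arbitrary: \<sigma>)
  case (Suc n)
  note \<sigma>[measurable] = Suc.prems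
  let ?\<psi> = "adds \<psi> (pts \<sigma>)"
  have \<psi>'[measurable]: "?\<psi> \<in> space \<N>" using \<psi> by auto
  have s: "add_dirac \<sigma> x \<in> space \<N>" for x using \<sigma> by auto
  have a: "adds \<psi> (pts (add_dirac \<sigma> x)) = add_dirac ?\<psi> x" if "x \<in> space M" for x
    using adds_eq_mset[OF adds_pts_add_dirac[OF \<sigma> that]] by (simp add: adds_append)
  have "(\<lambda>x. pins (restrict_meas M (upset t)) n (\<lambda>\<mu>. boltzmann k \<mu> \<psi>) (add_dirac \<sigma> x)) \<in> borel_measurable M"
    by (rule add_dirac_measurable_nu[OF intens_M \<sigma>])
       (auto intro!: intens_restrict intens_M boltzmann_measurable \<psi>)
  then have "(\<integral>\<^sup>+x. pins (restrict_meas M (upset t)) n (\<lambda>\<mu>. boltzmann k \<mu> \<psi>) (add_dirac \<sigma> x) \<partial>restrict_meas M (upset t)) =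
      (\<integral>\<^sup>+x\<in>upset t. pins (restrict_meas M (upset t)) n (\<lambda>\<mu>. boltzmann k \<mu> \<psi>) (add_dirac \<sigma> x) \<partial>M)"
    by (intro nn_integral_restrict_meas) auto
  also have "\<dots> = (\<integral>\<^sup>+x. boltzmann k \<sigma> \<psi> * (indicator (upset t) x * (k x ?\<psi> * unordv k n t (add_dirac ?\<psi> x))) \<partial>M)"
    by (intro nn_integral_cong) (simp add: Suc.IH[OF s] a boltzmann_add_dirac[OF \<sigma> _ \<psi>] mult_ac)
  also have "\<dots> = boltzmann k \<sigma> \<psi> * (\<integral>\<^sup>+x. indicator (upset t) x * (k x ?\<psi> * unordv k n t (add_dirac ?\<psi> x)) \<partial>M)"
    by (intro nn_integral_cmult) measurable
  finally show ?case
    by (simp add: pins.simps unordv.simps mult_ac)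
qed simp

lemma pexp_boltzmann:
  assumes \<psi>: "\<psi> \<in> space \<N>"
  shows "pexp (restrict_meas M (upset t)) (\<lambda>\<mu>. boltzmann k \<mu> \<psi>) (null_measure M) = gfun k t \<psi>"
  unfolding pexp_def gfun_def
  by (intro suminf_cong) (simp add: pins_boltzmann[OF \<psi>] unordv_eq_ordv[OF \<psi>])

lemma gfun_ge_1: "1 \<le> gfun k t \<psi>"
  unfolding gfun_def using sum_le_suminf[OF summableI, of "{0}" "\<lambda>n. ordv k n t \<psi>"] by simp

end

section \<open>Bounds from domination, and the exponential formula for the partition
  function\<close>

locale dominated_kernel = cocycle_kernel M \<phi> k for M :: "'a measure" and \<phi> k +
  fixes a :: "'a \<Rightarrow> ennreal"
  assumes a_meas[measurable]: "a \<in> borel_measurable M" and a_int: "(\<integral>\<^sup>+x. a x \<partial>M) < \<infinity>"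
    and k_le: "\<And>x \<mu>. x \<in> space M \<Longrightarrow> \<mu> \<in> space \<N> \<Longrightarrow> k x \<mu> \<le> a x"
begin

definition alpha_total :: real where "alpha_total = enn2real (\<integral>\<^sup>+x. a x \<partial>M)"

lemma alpha_total: "(\<integral>\<^sup>+x. a x \<partial>M) = ennreal alpha_total" "0 \<le> alpha_total"
  using a_int by (simp_all add: alpha_total_def less_top)

lemma gfun_eq_unordv: "\<psi> \<in> space \<N> \<Longrightarrow> gfun k t \<psi> = (\<Sum>n. unordv k n t \<psi>)"
  by (simp add: gfun_def unordv_eq_ordv)

text \<open>Each factor is at most \<open>a\<close>, whose integral is \<open>alpha_total\<close>.
  The unordered form has the 1 / n! explicit, which makes the sum over n finite.\<close>

lemma unordv_le:
  assumes "\<psi> \<in> space \<N>"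
  shows "unordv k n t \<psi> \<le> ennreal (alpha_total ^ n / fact n)"
  using assms
proof (induction n arbitrary: \<psi>)
  case (Suc n)
  have "(\<integral>\<^sup>+z. indicator (upset t) z * (k z \<psi> * unordv k n t (add_dirac \<psi> z)) \<partial>M) \<le>
      (\<integral>\<^sup>+z. a z * ennreal (alpha_total ^ n / fact n) \<partial>M)"
  proof (rule nn_integral_mono)
    fix z assume z: "z \<in> space M"
    have "k z \<psi> * unordv k n t (add_dirac \<psi> z) \<le> a z * ennreal (alpha_total ^ n / fact n)"
      by (intro mult_mono k_le z Suc add_dirac_in_counting) auto
    then show "indicator (upset t) z * (k z \<psi> * unordv k n t (add_dirac \<psi> z)) \<le> a z * ennreal (alpha_total ^ n / fact n)"
      by (auto simp: indicator_def)
  qed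
  also have "\<dots> = ennreal alpha_total * ennreal (alpha_total ^ n / fact n)"
    by (simp add: nn_integral_multc alpha_total)
  finally have "unordv k (Suc n) t \<psi> \<le> inverse (of_nat (Suc n)) * (ennreal alpha_total * ennreal (alpha_total ^ n / fact n))"
    unfolding unordv.simps by (rule mult_left_mono) simp
  also have "\<dots> = ennreal (alpha_total ^ Suc n / fact (Suc n))"
    by (rule ennreal_mult_power_fact[OF alpha_total(2)])
  finally show ?case .
qed simp

lemma gfun_le:
  assumes "\<psi> \<in> space \<N>"
  shows "gfun k t \<psi> \<le> ennreal (exp alpha_total)"
proof -
  have "gfun k t \<psi> \<le> (\<Sum>n. ennreal (alpha_total ^ n / fact n))"
    unfolding gfun_eq_unordv[OF assms] by (intro suminf_le unordv_le assms summableI)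
  then show ?thesis by (simp only: suminf_ennreal_exp[OF alpha_total(2)])
qed

lemma gfun_less_top: "\<psi> \<in> space \<N> \<Longrightarrow> gfun k t \<psi> < \<infinity>"
  using gfun_le[of \<psi> t] by (auto intro: le_less_trans)

lemma gfun_pos: "0 < gfun k t \<psi>"
  using zero_less_one gfun_ge_1[of t \<psi>] by (rule less_le_trans)

text \<open>The cocycle identity lets \<open>x\<close> be added after the integrated points, where
  its factor is at most \<open>a x\<close>. Summed over n and divided by \<open>gfun\<close>, this
  gives p \<le> \<alpha>.\<close>

lemma k_unordv_le:
  assumes "\<psi> \<in> space \<N>" and x: "x \<in> space M"
  shows "k x \<psi> * unordv k n t (add_dirac \<psi> x) \<le> a x * unordv k n t \<psi>"
  using assms(1)
proof (induction n arbitrary: \<psi>)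
  case 0
  then show ?case using x by (simp add: k_le)
next
  case (Suc n)
  note \<psi>[measurable] = Suc.prems
  have [measurable]: "x \<in> space M" by (rule x)
  have "k x \<psi> * (\<integral>\<^sup>+z. indicator (upset t) z * (k z (add_dirac \<psi> x) * unordv k n t (add_dirac (add_dirac \<psi> x) z)) \<partial>M) =
      (\<integral>\<^sup>+z. k x \<psi> * (indicator (upset t) z * (k z (add_dirac \<psi> x) * unordv k n t (add_dirac (add_dirac \<psi> x) z))) \<partial>M)"
    by (rule nn_integral_cmult[symmetric]) measurable
  also have "\<dots> \<le> (\<integral>\<^sup>+z. a x * (indicator (upset t) z * (k z \<psi> * unordv k n t (add_dirac \<psi> z))) \<partial>M)"
  proof (rule nn_integral_mono)
    fix z assume z: "z \<in> space M"
    have "k x \<psi> * (k z (add_dirac \<psi> x) * unordv k n t (add_dirac (add_dirac \<psi> x) z)) =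
        (k x \<psi> * k z (add_dirac \<psi> x)) * unordv k n t (add_dirac (add_dirac \<psi> z) x)"
      by (simp add: mult.assoc add_dirac_commute[of \<psi> x z])
    also have "\<dots> = k z \<psi> * (k x (add_dirac \<psi> z) * unordv k n t (add_dirac (add_dirac \<psi> z) x))"
      unfolding k_cocycle[OF x z \<psi>] by (simp add: mult.assoc)
    also have "\<dots> \<le> k z \<psi> * (a x * unordv k n t (add_dirac \<psi> z))"
      by (intro mult_left_mono Suc.IH add_dirac_in_counting \<psi>) simp
    finally show "k x \<psi> * (indicator (upset t) z * (k z (add_dirac \<psi> x) * unordv k n t (add_dirac (add_dirac \<psi> x) z))) \<le>
        a x * (indicator (upset t) z * (k z \<psi> * unordv k n t (add_dirac \<psi> z)))"
      by (simp add: indicator_def mult.left_commute)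
  qed
  also have "\<dots> = a x * (\<integral>\<^sup>+z. indicator (upset t) z * (k z \<psi> * unordv k n t (add_dirac \<psi> z)) \<partial>M)"
    by (rule nn_integral_cmult) measurable
  finally show ?case
    unfolding unordv.simps by (simp add: mult.left_commute[of _ "inverse _"] mult_left_mono)
qed

lemma k_gfun_le:
  assumes "\<psi> \<in> space \<N>" and x: "x \<in> space M"
  shows "k x \<psi> * gfun k t (add_dirac \<psi> x) \<le> a x * gfun k t \<psi>"
proof -
  have "k x \<psi> * gfun k t (add_dirac \<psi> x) = (\<Sum>n. k x \<psi> * unordv k n t (add_dirac \<psi> x))"
    using assms by (simp add: gfun_eq_unordv add_dirac_in_counting)
  also have "\<dots> \<le> (\<Sum>n. a x * unordv k n t \<psi>)"
    by (intro suminf_le k_unordv_le assms summableI)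
  finally show ?thesis using assms by (simp add: gfun_eq_unordv)
qed

text \<open>\<open>gfun\<close> stands for the partition function of (z, \<infinity>): their common
  factor exp(-\<lambda>(z, \<infinity>)) cancels in the ratio.\<close>

definition retain :: "'a \<Rightarrow> 'a measure \<Rightarrow> ennreal" where
  "retain z \<psi> = k z \<psi> * (gfun k (ereal (\<phi> z)) (add_dirac \<psi> z) / gfun k (ereal (\<phi> z)) \<psi>)"

lemma retain_measurable[measurable (raw)]:
  assumes [measurable]: "f \<in> measurable W M" "g \<in> measurable W \<N>"
  shows "(\<lambda>w. retain (f w) (g w)) \<in> borel_measurable W"
  unfolding retain_def by measurable

lemma retain_mult_gfun:
  assumes "\<psi> \<in> space \<N>"
  shows "retain z \<psi> * gfun k (ereal (\<phi> z)) \<psi> = k z \<psi> * gfun k (ereal (\<phi> z)) (add_dirac \<psi> z)"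
proof -
  have "gfun k (ereal (\<phi> z)) \<psi> / gfun k (ereal (\<phi> z)) \<psi> = 1"
    using gfun_less_top[OF assms, of "ereal (\<phi> z)"] gfun_pos[of "ereal (\<phi> z)" \<psi>]
    by (intro ennreal_divide_self) auto
  then show ?thesis
    unfolding retain_def by (simp add: mult.assoc ennreal_divide_times)
qed

lemma retain_le:
  assumes "\<psi> \<in> space \<N>" "z \<in> space M"
  shows "retain z \<psi> \<le> a z"
  unfolding retain_def ennreal_times_divide
  using k_gfun_le[OF assms] gfun_pos by (intro divide_le_posI_ennreal) (auto simp: mult.commute)

definition retain_integral :: "ereal \<Rightarrow> 'a measure \<Rightarrow> real" where
  "retain_integral t \<psi> = enn2real (\<integral>\<^sup>+z. indicator (upset t) z * retain z \<psi> \<partial>M)"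

lemma nn_integral_le_alpha_total:
  assumes "\<And>z. z \<in> space M \<Longrightarrow> f z \<le> a z"
  shows "(\<integral>\<^sup>+z. indicator B z * f z \<partial>M) < \<infinity>"
proof -
  have "(\<integral>\<^sup>+z. indicator B z * f z \<partial>M) \<le> (\<integral>\<^sup>+z. a z \<partial>M)"
    by (rule nn_integral_mono) (use assms in \<open>auto simp: indicator_def\<close>)
  then show ?thesis using a_int by (rule le_less_trans)
qed

lemma ennreal_retain_integral:
  assumes "\<psi> \<in> space \<N>"
  shows "ennreal (retain_integral t \<psi>) = (\<integral>\<^sup>+z. indicator (upset t) z * retain z \<psi> \<partial>M)"
  unfolding retain_integral_def using nn_integral_le_alpha_total[of "\<lambda>z. retain z \<psi>"] retain_le[OF assms]
  by (simp add: less_top)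

lemma retain_integral_nonneg: "0 \<le> retain_integral t \<psi>"
  by (simp add: retain_integral_def)

text \<open>Iterating \<open>G(t) = 1 + \<integral> 1{z > t} p(z) G(z) \<lambda>(dz)\<close> produces the ordered integrals of the
  kernel \<open>p\<close>, which does not depend on the configuration, so that these are the terms of
  an exponential series.\<close>

lemma gfun_eq_exp:
  assumes \<psi>[measurable]: "\<psi> \<in> space \<N>"
  shows "gfun k t \<psi> = ennreal (exp (retain_integral t \<psi>))"
proof -
  \<comment> \<open>The kernel at fixed \<psi>, as a function of a further configuration that it
    ignores. Its cocycle identity is commutativity, so the ordered integrals equal the unordered
    ones, which are plain powers.\<close>
  define q where "q z (\<mu> :: 'a measure) = retain z \<psi>" for z \<mu>
  define v where "v n t = ennreal (retain_integral t \<psi> ^ n / fact n)" for n t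
  define G where "G t = gfun k t \<psi>" for t
  have retain\<psi>[measurable]: "(\<lambda>z. retain z \<psi>) \<in> borel_measurable M" by measurable
  have Gm[measurable]: "(\<lambda>z. G (ereal (\<phi> z))) \<in> borel_measurable M" unfolding G_def by measurable
  interpret Q: cocycle_kernel M \<phi> q
  proof
    have "(\<lambda>w. retain (fst w) \<psi>) \<in> borel_measurable (M \<Otimes>\<^sub>M \<N>)" by measurable
    then show "(\<lambda>(x, \<mu>). q x \<mu>) \<in> borel_measurable (M \<Otimes>\<^sub>M \<N>)"
      by (simp add: q_def case_prod_beta)
  qed (simp_all add: finM diffM q_def mult.commute)
  have "unordv q n t \<mu> = v n t" for n t \<mu>
  proof (induction n arbitrary: \<mu>)
    case (Suc n)
    have "(\<integral>\<^sup>+z. indicator (upset t) z * (q z \<mu> * unordv q n t (add_dirac \<mu> z)) \<partial>M) =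
        (\<integral>\<^sup>+z. indicator (upset t) z * retain z \<psi> * v n t \<partial>M)"
      unfolding q_def Suc[unfolded q_def] by (simp add: mult.assoc)
    also have "\<dots> = ennreal (retain_integral t \<psi>) * v n t"
      by (simp add: nn_integral_multc ennreal_retain_integral[OF \<psi>])
    finally show ?case
      unfolding unordv.simps v_def using ennreal_mult_power_fact[OF retain_integral_nonneg] by simp
  qed (simp add: v_def)
  then have v_ordv: "ordv q n t \<mu> = v n t" if "\<mu> \<in> space \<N>" for n t \<mu>
    using Q.unordv_eq_ordv[OF that] by simp
  have v_Suc: "v (Suc n) t = (\<integral>\<^sup>+z. indicator (upset t) z * (retain z \<psi> * v n (ereal (\<phi> z))) \<partial>M)" for n t
    using v_ordv[OF \<psi>, of "Suc n" t] by (simp add: ordv.simps v_ordv add_dirac_in_counting[OF \<psi>] q_def)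
  have vm[measurable]: "(\<lambda>z. v n (ereal (\<phi> z))) \<in> borel_measurable M" for n
  proof -
    have "(\<lambda>z. ordv q n (ereal (\<phi> z)) \<psi>) \<in> borel_measurable M"
      by (rule Q.ordv_measurable) measurable
    then show ?thesis by (simp add: v_ordv[OF \<psi>])
  qed
  have G_eq: "G t = 1 + (\<integral>\<^sup>+z. indicator (upset t) z * (retain z \<psi> * G (ereal (\<phi> z))) \<partial>M)" for t
    unfolding G_def by (subst gfun_eq[OF \<psi>]) (simp add: retain_mult_gfun[OF \<psi>])
  \<comment> \<open>The integral equation applied to a partial sum plus a multiple of the next term:
    \<open>c = 0\<close> gives the lower bound, \<open>c = exp alpha_total\<close> the upper
    one.\<close>
  have step: "1 + (\<integral>\<^sup>+z. indicator (upset t) z * (retain z \<psi> * ((\<Sum>j<n. v j (ereal (\<phi> z))) + c * v n (ereal (\<phi> z)))) \<partial>M) =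
      (\<Sum>j<Suc n. v j t) + c * v (Suc n) t" for n t c
  proof -
    define F where "F j z = indicator (upset t) z * (retain z \<psi> * v j (ereal (\<phi> z)))" for j z
    have [measurable]: "F j \<in> borel_measurable M" for j unfolding F_def by measurable
    have "(\<integral>\<^sup>+z. indicator (upset t) z * (retain z \<psi> * ((\<Sum>j<n. v j (ereal (\<phi> z))) + c * v n (ereal (\<phi> z)))) \<partial>M) =
        (\<integral>\<^sup>+z. (\<Sum>j<n. F j z) + c * F n z \<partial>M)"
      unfolding F_def sum_distrib_left[symmetric]
      by (intro nn_integral_cong) (simp only: distrib_left mult.left_commute)
    also have "\<dots> = (\<Sum>j<n. v (Suc j) t) + c * v (Suc n) t"
      by (simp add: nn_integral_add nn_integral_sum nn_integral_cmult v_Suc F_def[symmetric])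
    also have "1 + \<dots> = (\<Sum>j<Suc n. v j t) + c * v (Suc n) t"
      unfolding sum.lessThan_Suc_shift by (simp add: v_def add.assoc)
    finally show ?thesis .
  qed
  have lower: "(\<Sum>j<n. v j t) \<le> G t" for n t
  proof (induction n arbitrary: t)
    case (Suc n)
    have "(\<Sum>j<Suc n. v j t) = 1 + (\<integral>\<^sup>+z. indicator (upset t) z * (retain z \<psi> * (\<Sum>j<n. v j (ereal (\<phi> z)))) \<partial>M)"
      using step[of t n 0] by simp
    also have "\<dots> \<le> 1 + (\<integral>\<^sup>+z. indicator (upset t) z * (retain z \<psi> * G (ereal (\<phi> z))) \<partial>M)"
      by (intro add_left_mono nn_integral_mono mult_left_mono Suc) auto
    finally show ?case by (simp add: G_eq[symmetric])
  qed simp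
  \<comment> \<open>The start is the uniform bound on \<open>gfun\<close>; each iteration moves the
    remainder one term along the exponential series, and these terms tend to 0.\<close>
  have upper: "G t \<le> (\<Sum>j<n. v j t) + ennreal (exp alpha_total) * v n t" for n t
  proof (induction n arbitrary: t)
    case 0
    then show ?case using gfun_le[OF \<psi>] by (simp add: G_def v_def)
  next
    case (Suc n)
    have "G t \<le> 1 + (\<integral>\<^sup>+z. indicator (upset t) z * (retain z \<psi> * ((\<Sum>j<n. v j (ereal (\<phi> z))) + ennreal (exp alpha_total) * v n (ereal (\<phi> z)))) \<partial>M)"
      by (subst G_eq) (intro add_left_mono nn_integral_mono mult_left_mono Suc, auto)
    then show ?case by (simp only: step)
  qed
  have sum: "(\<Sum>n. v n t) = ennreal (exp (retain_integral t \<psi>))"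
    unfolding v_def by (rule suminf_ennreal_exp[OF retain_integral_nonneg])
  have "G t \<le> (\<Sum>n. v n t) + 0"
  proof (rule LIMSEQ_le_const)
    have "(\<lambda>n. exp alpha_total * (retain_integral t \<psi> ^ n / fact n)) \<longlonglongrightarrow> exp alpha_total * 0"
      using summable_LIMSEQ_zero[OF summable_exp[of "retain_integral t \<psi>"]]
      by (intro tendsto_mult tendsto_const) (simp add: divide_inverse mult.commute)
    then have "(\<lambda>n. ennreal (exp alpha_total * (retain_integral t \<psi> ^ n / fact n))) \<longlonglongrightarrow> ennreal 0"
      by (intro tendsto_ennrealI) simp
    moreover have "ennreal (exp alpha_total * (retain_integral t \<psi> ^ n / fact n)) = ennreal (exp alpha_total) * v n t" for n
      unfolding v_def by (rule ennreal_mult) (simp_all add: retain_integral_nonneg)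
    ultimately have "(\<lambda>n. ennreal (exp alpha_total) * v n t) \<longlonglongrightarrow> 0"
      by simp
    then show "(\<lambda>n. (\<Sum>j<n. v j t) + ennreal (exp alpha_total) * v n t) \<longlonglongrightarrow> (\<Sum>n. v n t) + 0"
      by (intro tendsto_add summable_LIMSEQ summableI)
  qed (use upper in auto)
  moreover have "(\<Sum>n. v n t) \<le> G t"
    by (intro suminf_le_const summableI lower)
  ultimately show ?thesis by (simp add: sum G_def)
qed

text \<open>\<open>retain_below\<close> is the function \<open>p\<close>, whereas \<open>retain\<close> does not discard the points above \<open>z\<close>.\<close>

definition retain_below :: "'a \<Rightarrow> 'a measure \<Rightarrow> ennreal" where
  "retain_below z \<psi> = retain z (restrict_meas \<psi> (below M \<phi> z))"

lemma below_sets[measurable, simp]: "below M \<phi> x \<in> sets M"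
  unfolding below_def by measurable

lemma restrict_below_measurable[measurable (raw)]:
  assumes "f \<in> measurable W M" "g \<in> measurable W \<N>"
  shows "(\<lambda>w. restrict_meas (g w) (below M \<phi> (f w))) \<in> measurable W \<N>"
proof -
  have "{w \<in> space (M \<Otimes>\<^sub>M M). snd w \<in> below M \<phi> (fst w)} = {w \<in> space (M \<Otimes>\<^sub>M M). \<phi> (snd w) < \<phi> (fst w)}"
    by (auto simp: below_def space_pair_measure)
  also have "\<dots> \<in> sets (M \<Otimes>\<^sub>M M)" by measurable
  finally have "(\<lambda>(y, \<mu>). restrict_meas \<mu> (below M \<phi> y)) \<in> measurable (M \<Otimes>\<^sub>M \<N>) \<N>"
    by (intro measurable_restrict_meas) auto
  from measurable_compose[OF measurable_Pair[OF assms] this] show ?thesis by simp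
qed

lemma retain_below_measurable[measurable (raw)]:
  assumes [measurable]: "f \<in> measurable W M" "g \<in> measurable W \<N>"
  shows "(\<lambda>w. retain_below (f w) (g w)) \<in> borel_measurable W"
  unfolding retain_below_def by measurable

lemma retain_below_le:
  assumes "\<psi> \<in> space \<N>" "z \<in> space M"
  shows "retain_below z \<psi> \<le> a z"
  unfolding retain_below_def using assms by (intro retain_le) auto

definition retain_below_integral :: "ereal \<Rightarrow> 'a measure \<Rightarrow> real" where
  "retain_below_integral t \<psi> = enn2real (\<integral>\<^sup>+z. indicator (upset t) z * retain_below z \<psi> \<partial>M)"

lemma ennreal_retain_below_integral:
  assumes "\<psi> \<in> space \<N>"
  shows "ennreal (retain_below_integral t \<psi>) = (\<integral>\<^sup>+z. indicator (upset t) z * retain_below z \<psi> \<partial>M)"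
  unfolding retain_below_integral_def using nn_integral_le_alpha_total[of "\<lambda>z. retain_below z \<psi>"] retain_below_le[OF assms]
  by (simp add: less_top)

lemma retain_below_integral_nonneg: "0 \<le> retain_below_integral t \<psi>"
  by (simp add: retain_below_integral_def)

section \<open>The telescoping identity\<close>

text \<open>Up to a null set \<sigma> lives at or below t, hence strictly below z, while no point of
  \<open>xs\<close> is strictly below z; z itself may be one of them.\<close>

lemma restrict_adds_below:
  assumes \<sigma>: "\<sigma> \<in> space \<N>" and z: "z \<in> upset t" and "emeasure \<sigma> (upset t) = 0"
    and "\<And>x. x \<in> set xs \<Longrightarrow> \<phi> z \<le> \<phi> x"
  shows "restrict_meas (adds \<sigma> xs) (below M \<phi> z) = \<sigma>"
proof (rule measure_eqI)
  note s\<sigma> = sets_counting_space[OF \<sigma>]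
  show "sets (restrict_meas (adds \<sigma> xs) (below M \<phi> z)) = sets \<sigma>" by simp
  fix A assume "A \<in> sets (restrict_meas (adds \<sigma> xs) (below M \<phi> z))"
  then have A: "A \<in> sets M" by (simp add: s\<sigma>)
  have no: "filter (\<lambda>x. x \<in> A \<and> x \<in> below M \<phi> z) xs = []"
    using assms(4) by (force simp: filter_empty_conv below_def)
  have "emeasure \<sigma> A = emeasure \<sigma> (A \<inter> below M \<phi> z)"
  proof (rule emeasure_eq_AE)
    have "AE x in \<sigma>. x \<notin> upset t"
      using assms(3) s\<sigma> by (intro AE_I'[of "upset t"]) (auto simp: null_sets_def)
    then show "AE x in \<sigma>. x \<in> A \<longleftrightarrow> x \<in> A \<inter> below M \<phi> z"
      using AE_space
    proof eventually_elim
      case (elim x)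
      have "t < ereal (\<phi> z)" using z by (simp add: upset_def)
      moreover have "ereal (\<phi> x) \<le> t" using elim by (auto simp: upset_def space_counting_space[OF \<sigma>])
      ultimately have "\<phi> x < \<phi> z" by (metis le_less_trans less_ereal.simps(1))
      then show ?case using elim by (auto simp: below_def space_counting_space[OF \<sigma>])
    qed
  qed (use A s\<sigma> in auto)
  then show "emeasure (restrict_meas (adds \<sigma> xs) (below M \<phi> z)) A = emeasure \<sigma> A"
    using A by (simp add: emeasure_restrict_meas emeasure_adds s\<sigma> no)
qed

text \<open>The telescoping product: between two consecutive points the exponent is the logarithm of a
  ratio of partition functions, and these cancel against the ratios in the factors \<open>p(x, \<psi>)\<close>.\<close>

lemma exp_retain_below_integral_klist:
  assumes "\<sigma> \<in> space \<N>" "emeasure \<sigma> (upset t) = 0"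
    and "sorted_wrt (\<lambda>x y. \<phi> x < \<phi> y) xs" "set xs \<subseteq> upset t"
  shows "ennreal (exp (retain_below_integral t (adds \<sigma> xs))) * klist k xs \<sigma> =
    (\<Prod>x\<leftarrow>xs. retain_below x (adds \<sigma> xs)) * gfun k t \<sigma>"
  using assms
proof (induction xs arbitrary: t \<sigma>)
  case Nil
  note \<sigma>[measurable] = Nil.prems(1)
  have "retain_below z \<sigma> = retain z \<sigma>" if "z \<in> upset t" for z
    using restrict_adds_below[OF \<sigma> that Nil.prems(2), of "[]"] by (simp add: retain_below_def)
  then have "retain_below_integral t \<sigma> = retain_integral t \<sigma>"
    unfolding retain_below_integral_def retain_integral_def by (intro arg_cong[where f=enn2real] nn_integral_cong) (auto simp: indicator_def)
  then show ?case using gfun_eq_exp[OF \<sigma>] by simp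
next
  case (Cons x ys)
  note \<sigma>[measurable] = Cons.prems(1)
  define \<psi> where "\<psi> = adds \<sigma> (x # ys)"
  have \<psi>[measurable]: "\<psi> \<in> space \<N>" unfolding \<psi>_def using \<sigma> by auto
  define s where "s = ereal (\<phi> x)"
  have x: "x \<in> space M" "t < s" using Cons.prems(4) by (auto simp: upset_def s_def)
  have xt: "x \<in> upset t" using Cons.prems by simp
  have sub: "upset s \<subseteq> upset t" using x(2) by (auto simp: upset_def intro: less_trans)
  \<comment> \<open>The integral over the gap t < z \<le> \<phi> x, in which only \<sigma> is
    visible below z.\<close>
  define I where "I = (\<integral>\<^sup>+z. indicator (upset t - upset s) z * retain z \<sigma> \<partial>M)"
  have I_fin: "I < \<infinity>" unfolding I_def by (intro nn_integral_le_alpha_total retain_le \<sigma>)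
  define i where "i = enn2real I"
  have Ii: "I = ennreal i" "0 \<le> i" using I_fin by (simp_all add: i_def less_top)
  have r\<sigma>: "retain_below z \<psi> = retain z \<sigma>" if "z \<in> upset t - upset s" for z
  proof -
    have "\<phi> z \<le> \<phi> x" using that by (auto simp: upset_def s_def)
    then have "restrict_meas \<psi> (below M \<phi> z) = \<sigma>"
      unfolding \<psi>_def using Cons.prems that by (intro restrict_adds_below) force+
    then show ?thesis by (simp add: retain_below_def)
  qed
  have split: "(\<integral>\<^sup>+z. indicator (upset t) z * h z \<partial>M) =
      (\<integral>\<^sup>+z. indicator (upset t - upset s) z * h z \<partial>M) + (\<integral>\<^sup>+z. indicator (upset s) z * h z \<partial>M)"
    if [measurable]: "h \<in> borel_measurable M" for h
    using sub by (subst nn_integral_add[symmetric]) (auto intro!: nn_integral_cong simp: indicator_def)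
  have "ennreal (retain_below_integral t \<psi>) = I + ennreal (retain_below_integral s \<psi>)"
    unfolding ennreal_retain_below_integral[OF \<psi>] I_def
    by (subst split) (auto intro!: arg_cong2[where f="(+)"] nn_integral_cong simp: r\<sigma> indicator_def)
  then have rt: "retain_below_integral t \<psi> = i + retain_below_integral s \<psi>"
    using Ii retain_below_integral_nonneg by (simp flip: ennreal_plus)
  have "ennreal (retain_integral t \<sigma>) = I + ennreal (retain_integral s \<sigma>)"
    unfolding ennreal_retain_integral[OF \<sigma>] I_def by (rule split) measurable
  then have "retain_integral t \<sigma> = i + retain_integral s \<sigma>"
    using Ii retain_integral_nonneg by (simp flip: ennreal_plus)
  then have G: "gfun k t \<sigma> = ennreal (exp i) * gfun k s \<sigma>"
    by (simp add: gfun_eq_exp[OF \<sigma>] exp_add ennreal_mult)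
  have "emeasure (add_dirac \<sigma> x) (upset s) = 0"
  proof -
    have "emeasure \<sigma> (upset s) \<le> emeasure \<sigma> (upset t)"
      using sub by (intro emeasure_mono) (auto simp: sets_counting_space[OF \<sigma>])
    then show ?thesis
      using Cons.prems(2) by (simp add: emeasure_add_dirac sets_counting_space[OF \<sigma>]) (simp add: upset_def s_def)
  qed
  moreover have "set ys \<subseteq> upset s" "sorted_wrt (\<lambda>x y. \<phi> x < \<phi> y) ys"
    using Cons.prems by (auto simp: upset_def s_def)
  ultimately have IH: "ennreal (exp (retain_below_integral s \<psi>)) * klist k ys (add_dirac \<sigma> x) =
      (\<Prod>y\<leftarrow>ys. retain_below y \<psi>) * gfun k s (add_dirac \<sigma> x)"
    unfolding \<psi>_def using Cons.IH[of "add_dirac \<sigma> x" s] \<sigma> by auto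
  \<comment> \<open>\<open>x\<close> is the closed end of the gap, so its own factor also sees just
    \<sigma>.\<close>
  have "x \<notin> upset s" by (simp add: upset_def s_def)
  then have rx: "retain_below x \<psi> = retain x \<sigma>" using xt by (intro r\<sigma>) simp
  have "ennreal (exp (retain_below_integral t \<psi>)) * klist k (x # ys) \<sigma> =
      ennreal (exp i) * k x \<sigma> * (ennreal (exp (retain_below_integral s \<psi>)) * klist k ys (add_dirac \<sigma> x))"
    by (simp add: rt exp_add ennreal_mult mult_ac)
  also have "\<dots> = ennreal (exp i) * (\<Prod>y\<leftarrow>ys. retain_below y \<psi>) * (k x \<sigma> * gfun k s (add_dirac \<sigma> x))"
    unfolding IH by (simp add: mult_ac)
  \<comment> \<open>Exchanges the partition function with \<open>x\<close> added for the one without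
    it; the factor of the gap then carries the latter from \<open>s\<close> down to
    \<open>t\<close>.\<close>
  also have "k x \<sigma> * gfun k s (add_dirac \<sigma> x) = retain x \<sigma> * gfun k s \<sigma>"
    unfolding s_def by (rule retain_mult_gfun[OF \<sigma>, symmetric])
  also have "ennreal (exp i) * (\<Prod>y\<leftarrow>ys. retain_below y \<psi>) * (retain x \<sigma> * gfun k s \<sigma>) =
      (\<Prod>y\<leftarrow>x # ys. retain_below y \<psi>) * gfun k t \<sigma>"
    by (simp add: G rx mult_ac)
  finally show ?case by (simp add: \<psi>_def)
qed

text \<open>The telescoping identity started from the empty configuration at minus infinity.
  Simplicity makes the sorted points strictly increasing and the list product a product over
  atoms.\<close>

lemma exp_retain_below_integral_boltzmann:
  assumes \<psi>: "\<psi> \<in> simple"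
  shows "(\<Prod>x\<in>atoms \<psi>. retain_below x \<psi>) * ennreal (exp (- retain_below_integral (- \<infinity>) \<psi>)) * gfun k (- \<infinity>) (null_measure M) =
    boltzmann k \<psi> (null_measure M)"
proof -
  note N = simple_in_counting[OF \<psi>]
  have d: "distinct (pts \<psi>)" using \<psi> N by (simp add: simple_iff_distinct)
  have "sorted_wrt (<) (map \<phi> (pts \<psi>))"
    using sorted_pts[OF N] d set_pts[OF N] inj_phi
    by (auto simp: strict_sorted_iff distinct_map intro: inj_on_subset)
  then have "sorted_wrt (\<lambda>x y. \<phi> x < \<phi> y) (pts \<psi>)" by (simp add: sorted_wrt_map)
  with exp_retain_below_integral_klist[of "null_measure M" "- \<infinity>" "pts \<psi>"] set_pts[OF N]
  have "ennreal (exp (retain_below_integral (- \<infinity>) \<psi>)) * boltzmann k \<psi> (null_measure M) =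
      (\<Prod>x\<leftarrow>pts \<psi>. retain_below x \<psi>) * gfun k (- \<infinity>) (null_measure M)"
    by (simp add: adds_pts[OF N] upset_MInf boltzmann_def)
  also have "(\<Prod>x\<leftarrow>pts \<psi>. retain_below x \<psi>) = (\<Prod>x\<in>atoms \<psi>. retain_below x \<psi>)"
    using d by (simp add: atoms_eq[OF N] prod.distinct_set_conv_list)
  finally have "ennreal (exp (- retain_below_integral (- \<infinity>) \<psi>)) * (ennreal (exp (retain_below_integral (- \<infinity>) \<psi>)) * boltzmann k \<psi> (null_measure M)) =
      ennreal (exp (- retain_below_integral (- \<infinity>) \<psi>)) * ((\<Prod>x\<in>atoms \<psi>. retain_below x \<psi>) * gfun k (- \<infinity>) (null_measure M))"
    by simp
  moreover have "ennreal (exp (- retain_below_integral (- \<infinity>) \<psi>)) * ennreal (exp (retain_below_integral (- \<infinity>) \<psi>)) = 1"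
    by (simp add: ennreal_mult[symmetric] mult_exp_exp)
  ultimately show ?thesis
    by (simp add: mult.assoc[symmetric]) (simp add: mult_ac)
qed

end

section \<open>Splitting a Poisson process\<close>

text \<open>The sum over all assignments of the entries of the list to \<sigma> or \<tau>, one entry
  at a time; this recursion is what makes sums over subconfigurations measurable.\<close>

fun lsplit :: "'a list \<Rightarrow> ('a measure \<Rightarrow> 'a measure \<Rightarrow> ennreal) \<Rightarrow> 'a measure \<Rightarrow> 'a measure \<Rightarrow> ennreal" where
  "lsplit [] g \<sigma> \<tau> = g \<sigma> \<tau>"
| "lsplit (x # xs) g \<sigma> \<tau> = lsplit xs g (add_dirac \<sigma> x) \<tau> + lsplit xs g \<sigma> (add_dirac \<tau> x)"

lemma lsplit_shift:
  "lsplit xs (\<lambda>\<sigma> \<tau>. g (add_dirac \<sigma> x) \<tau>) \<sigma> \<tau> = lsplit xs g (add_dirac \<sigma> x) \<tau>"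
  "lsplit xs (\<lambda>\<sigma> \<tau>. g \<sigma> (add_dirac \<tau> x)) \<sigma> \<tau> = lsplit xs g \<sigma> (add_dirac \<tau> x)"
  by (induction xs arbitrary: \<sigma> \<tau>) (auto simp: add_dirac_commute[of _ x])

context borel_emb
begin

section \<open>Subconfigurations and the splitting of a simple configuration\<close>

lemma emeasure_simple:
  assumes "\<mu> \<in> simple" "A \<in> sets M"
  shows "emeasure \<mu> A = of_nat (card (A \<inter> atoms \<mu>))"
proof -
  note N = simple_in_counting[OF assms(1)]
  have "distinct (filter (\<lambda>x. x \<in> A) (pts \<mu>))"
    using assms(1) N by (simp add: simple_iff_distinct)
  then have "length (filter (\<lambda>x. x \<in> A) (pts \<mu>)) = card (A \<inter> atoms \<mu>)"
    unfolding atoms_eq[OF N] by (simp flip: distinct_card) (metis Int_commute Int_def Collect_mem_eq)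
  then show ?thesis using emeasure_pts[OF N assms(2)] by simp
qed

lemma restrict_simple:
  assumes "\<mu> \<in> simple" "B \<in> sets M"
  shows "restrict_meas \<mu> B \<in> simple" "atoms (restrict_meas \<mu> B) = atoms \<mu> \<inter> B"
proof -
  note N = simple_in_counting[OF assms(1)]
  have e: "emeasure (restrict_meas \<mu> B) {x} = (if x \<in> B then emeasure \<mu> {x} else 0)" if "x \<in> space M" for x
    using that assms(2) by (simp add: emeasure_restrict_meas sets_counting_space[OF N])
  show "restrict_meas \<mu> B \<in> simple"
    using assms N e by (auto simp: simple_def)
  show "atoms (restrict_meas \<mu> B) = atoms \<mu> \<inter> B"
    using e by (auto simp: atoms_def space_counting_space[OF N] split: if_splits)
qed

lemma finite_sets: "finite I \<Longrightarrow> I \<subseteq> space M \<Longrightarrow> I \<in> sets M"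
proof (induction I rule: finite_induct)
  case (insert x I)
  then show ?case using sets.Un[of "{x}" M I] by simp
qed simp

lemma atoms_subset: "\<mu> \<in> space \<N> \<Longrightarrow> atoms \<mu> \<subseteq> space M"
  by (auto simp: atoms_def space_counting_space)

lemma diff_restrict:
  assumes N: "\<mu> \<in> space \<N>" and B: "B \<in> sets M"
  shows "diff_measure \<mu> (restrict_meas \<mu> B) = restrict_meas \<mu> (space M - B)"
proof (rule measure_eqI)
  interpret finite_measure \<mu> using N by (rule finite_measure_counting)
  note s = sets_counting_space[OF N]
  show "sets (diff_measure \<mu> (restrict_meas \<mu> B)) = sets (restrict_meas \<mu> (space M - B))" by simp
  fix A assume "A \<in> sets (diff_measure \<mu> (restrict_meas \<mu> B))"
  then have A: "A \<in> sets M" by (simp add: s)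
  have fr: "finite_measure (restrict_meas \<mu> B)"
    using N B by (intro finite_measure_counting) auto
  have "emeasure (diff_measure \<mu> (restrict_meas \<mu> B)) A = emeasure \<mu> A - emeasure (restrict_meas \<mu> B) A"
    using A B s by (intro emeasure_diff_measure finite_measure_axioms fr)
      (auto simp: emeasure_restrict_meas intro!: emeasure_mono)
  also have "\<dots> = emeasure \<mu> A - emeasure \<mu> (A \<inter> B)"
    using A B s by (simp add: emeasure_restrict_meas)
  also have "\<dots> = emeasure \<mu> (A - A \<inter> B)"
    using A B s emeasure_finite by (intro emeasure_Diff[symmetric]) auto
  also have "A - A \<inter> B = A \<inter> (space M - B)"
    using sets.sets_into_space[OF A] by auto
  finally show "emeasure (diff_measure \<mu> (restrict_meas \<mu> B)) A = emeasure (restrict_meas \<mu> (space M - B)) A"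
    using A B s by (simp add: emeasure_restrict_meas)
qed

lemma le_measure_counting_iff:
  assumes "\<psi> \<in> space \<N>" "\<mu> \<in> space \<N>"
  shows "\<psi> \<le> \<mu> \<longleftrightarrow> (\<forall>A\<in>sets M. emeasure \<psi> A \<le> emeasure \<mu> A)"
proof -
  have "\<psi> \<le> \<mu> \<longleftrightarrow> emeasure \<psi> \<le> emeasure \<mu>"
    using assms by (simp add: le_measure_iff space_counting_space sets_counting_space)
  also have "\<dots> \<longleftrightarrow> (\<forall>A\<in>sets M. emeasure \<psi> A \<le> emeasure \<mu> A)"
    using assms by (metis emeasure_notin_sets le_funD le_funI sets_counting_space zero_le)
  finally show ?thesis .
qed

text \<open>A simple configuration is determined by its atoms. In particular the sum in the thinning
  kernel is finite, so it does not fall under the default value 0 of sums over infinite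
  sets.\<close>

lemma subconfigurations:
  assumes \<mu>: "\<mu> \<in> simple"
  shows "bij_betw (restrict_meas \<mu>) (Pow (atoms \<mu>)) {\<psi>. \<psi> \<in> simple \<and> \<psi> \<le> \<mu>}"
proof -
  note N = simple_in_counting[OF \<mu>]
  have Is: "I \<in> sets M" if "I \<subseteq> atoms \<mu>" for I
    using that finite_atoms[OF N] atoms_subset[OF N] by (intro finite_sets) (auto intro: finite_subset)
  have at: "atoms (restrict_meas \<mu> I) = I" if "I \<subseteq> atoms \<mu>" for I
    using restrict_simple(2)[OF \<mu> Is[OF that]] that by auto
  show ?thesis
  proof (rule bij_betw_byWitness[where f' = atoms])
    show "\<forall>I\<in>Pow (atoms \<mu>). atoms (restrict_meas \<mu> I) = I" using at by auto
    show "restrict_meas \<mu> ` Pow (atoms \<mu>) \<subseteq> {\<psi>. \<psi> \<in> simple \<and> \<psi> \<le> \<mu>}"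
    proof safe
      fix I assume I: "I \<subseteq> atoms \<mu>"
      show "restrict_meas \<mu> I \<in> simple" by (rule restrict_simple(1)[OF \<mu> Is[OF I]])
      show "restrict_meas \<mu> I \<le> \<mu>"
        using Is[OF I] N
        by (subst le_measure_counting_iff)
           (auto simp: emeasure_restrict_meas sets_counting_space[OF N] intro!: emeasure_mono)
    qed
    have sub: "atoms \<psi> \<subseteq> atoms \<mu>" if "\<psi> \<in> simple" "\<psi> \<le> \<mu>" for \<psi>
    proof
      fix x assume x: "x \<in> atoms \<psi>"
      then have xM: "x \<in> space M" using atoms_subset[OF simple_in_counting[OF that(1)]] by auto
      then have "emeasure \<psi> {x} \<le> emeasure \<mu> {x}"
        using that le_measure_counting_iff[OF simple_in_counting[OF that(1)] N] by auto
      with x show "x \<in> atoms \<mu>"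
        using xM by (auto simp: atoms_def space_counting_space[OF N] intro: less_le_trans)
    qed
    then show "atoms ` {\<psi>. \<psi> \<in> simple \<and> \<psi> \<le> \<mu>} \<subseteq> Pow (atoms \<mu>)" by auto
    show "\<forall>\<psi>\<in>{\<psi>. \<psi> \<in> simple \<and> \<psi> \<le> \<mu>}. restrict_meas \<mu> (atoms \<psi>) = \<psi>"
    proof safe
      fix \<psi> assume \<psi>: "\<psi> \<in> simple" "\<psi> \<le> \<mu>"
      note N\<psi> = simple_in_counting[OF \<psi>(1)]
      show "restrict_meas \<mu> (atoms \<psi>) = \<psi>"
      proof (rule measure_eqI)
        show "sets (restrict_meas \<mu> (atoms \<psi>)) = sets \<psi>"
          by (simp add: sets_counting_space[OF N] sets_counting_space[OF N\<psi>])
        fix A assume "A \<in> sets (restrict_meas \<mu> (atoms \<psi>))"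
        then have A: "A \<in> sets M" by (simp add: sets_counting_space[OF N])
        have "A \<inter> atoms \<psi> \<inter> atoms \<mu> = A \<inter> atoms \<psi>" using sub[OF \<psi>] by auto
        then show "emeasure (restrict_meas \<mu> (atoms \<psi>)) A = emeasure \<psi> A"
          using A Is[OF sub[OF \<psi>]]
          by (simp add: emeasure_restrict_meas sets_counting_space[OF N] emeasure_simple[OF \<mu>] emeasure_simple[OF \<psi>(1)])
      qed
    qed
  qed
qed

text \<open>The shape of the thinning kernel: a sum over retained parts of a function of the
  retained and the deleted points.\<close>

definition split_sum :: "('a measure \<Rightarrow> 'a measure \<Rightarrow> ennreal) \<Rightarrow> 'a measure \<Rightarrow> ennreal" where
  "split_sum g \<mu> = (\<Sum>\<psi> | \<psi> \<in> simple \<and> \<psi> \<le> \<mu>. g \<psi> (diff_measure \<mu> \<psi>))"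

lemma subset_atoms_sets:
  "\<mu> \<in> space \<N> \<Longrightarrow> I \<subseteq> atoms \<mu> \<Longrightarrow> I \<in> sets M"
  using finite_atoms[of \<mu>] atoms_subset[of \<mu>] by (intro finite_sets) (auto intro: finite_subset)

lemma split_sum_eq:
  assumes \<mu>: "\<mu> \<in> simple"
  shows "split_sum g \<mu> = (\<Sum>I\<in>Pow (atoms \<mu>). g (restrict_meas \<mu> I) (restrict_meas \<mu> (space M - I)))"
  unfolding split_sum_def
  using simple_in_counting[OF \<mu>]
  by (subst sum.reindex_bij_betw[OF subconfigurations[OF \<mu>], symmetric])
     (auto intro!: sum.cong simp: diff_restrict subset_atoms_sets)

lemma atoms_null[simp]: "atoms (null_measure M) = {}"
  by (simp add: atoms_def)

lemma split_sum_null: "split_sum g (null_measure M) = g (null_measure M) (null_measure M)"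
  by (simp add: split_sum_eq)

lemma restrict_meas_cong_null:
  assumes N: "\<mu> \<in> space \<N>" and "B \<in> sets M" "C \<in> sets M"
    and "emeasure \<mu> (B - C) = 0" "emeasure \<mu> (C - B) = 0"
  shows "restrict_meas \<mu> B = restrict_meas \<mu> C"
proof (rule measure_eqI)
  note s = sets_counting_space[OF N]
  fix A assume "A \<in> sets (restrict_meas \<mu> B)"
  then have A: "A \<in> sets M" by (simp add: s)
  have n: "B - C \<in> null_sets \<mu>" "C - B \<in> null_sets \<mu>" using assms s by (auto simp: null_sets_def)
  from AE_not_in[OF n(1)] AE_not_in[OF n(2)]
  have "AE x in \<mu>. x \<in> A \<inter> B \<longleftrightarrow> x \<in> A \<inter> C" by eventually_elim auto
  then have "emeasure \<mu> (A \<inter> B) = emeasure \<mu> (A \<inter> C)"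
    using A assms s by (intro emeasure_eq_AE) auto
  then show "emeasure (restrict_meas \<mu> B) A = emeasure (restrict_meas \<mu> C) A"
    using A assms s by (simp add: emeasure_restrict_meas)
qed simp

text \<open>The subsets of the enlarged set of atoms are those without \<open>x\<close>, where it is
  deleted, and those with it, where it is retained.\<close>

lemma split_sum_add_dirac:
  assumes \<mu>: "\<mu> \<in> simple" and x: "x \<in> space M" "x \<notin> atoms \<mu>"
  shows "split_sum g (add_dirac \<mu> x) = split_sum (\<lambda>\<sigma> \<tau>. g (add_dirac \<sigma> x) \<tau>) \<mu> + split_sum (\<lambda>\<sigma> \<tau>. g \<sigma> (add_dirac \<tau> x)) \<mu>"
proof -
  note N = simple_in_counting[OF \<mu>]
  note s = sets_counting_space[OF N]
  have x0: "emeasure \<mu> {x} = 0"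
    using x by (auto simp: atoms_def space_counting_space[OF N] zero_less_iff_neq_zero)
  have x0': "emeasure \<mu> C = 0" if "C \<subseteq> {x}" for C
    using that x0 by (metis emeasure_empty subset_singletonD)
  have Is: "I \<in> sets M" "insert x I \<in> sets M" if "I \<subseteq> atoms \<mu>" for I
    using subset_atoms_sets[OF N that] sets.Un[OF singleton_sets[OF x(1)] subset_atoms_sets[OF N that]] by auto
  \<comment> \<open>The added mass goes to the side that contains \<open>x\<close>; \<mu> does not
    charge \<open>x\<close> and is cut in the same way in all four cases.\<close>
  have r1: "restrict_meas (add_dirac \<mu> x) I = restrict_meas \<mu> I" if "I \<subseteq> atoms \<mu>" for I
    using that x s Is by (auto simp: restrict_meas_add_dirac)
  have r2: "restrict_meas (add_dirac \<mu> x) (space M - I) = add_dirac (restrict_meas \<mu> (space M - I)) x" if "I \<subseteq> atoms \<mu>" for I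
    using that x s Is by (auto simp: restrict_meas_add_dirac)
  have r3: "restrict_meas (add_dirac \<mu> x) (insert x I) = add_dirac (restrict_meas \<mu> I) x" if "I \<subseteq> atoms \<mu>" for I
  proof -
    have "restrict_meas \<mu> (insert x I) = restrict_meas \<mu> I"
      using Is[OF that] by (intro restrict_meas_cong_null[OF N] x0') auto
    then show ?thesis using s Is[OF that] by (simp add: restrict_meas_add_dirac)
  qed
  have r4: "restrict_meas (add_dirac \<mu> x) (space M - insert x I) = restrict_meas \<mu> (space M - I)" if "I \<subseteq> atoms \<mu>" for I
  proof -
    have "restrict_meas \<mu> (space M - insert x I) = restrict_meas \<mu> (space M - I)"
      using Is[OF that] by (intro restrict_meas_cong_null[OF N] x0') auto
    then show ?thesis using s Is[OF that] sets.compl_sets[OF Is(2)[OF that]] by (subst restrict_meas_add_dirac) auto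
  qed
  have fin: "finite (atoms \<mu>)" by (rule finite_atoms[OF N])
  let ?h = "\<lambda>I. g (restrict_meas (add_dirac \<mu> x) I) (restrict_meas (add_dirac \<mu> x) (space M - I))"
  have "split_sum g (add_dirac \<mu> x) = (\<Sum>I\<in>Pow (insert x (atoms \<mu>)). ?h I)"
    using split_sum_eq[OF add_dirac_simple[OF \<mu> x]] atoms_add_dirac[OF N x(1)] by simp
  also have "Pow (insert x (atoms \<mu>)) = Pow (atoms \<mu>) \<union> insert x ` Pow (atoms \<mu>)"
    by (rule Pow_insert)
  also have "(\<Sum>I\<in>Pow (atoms \<mu>) \<union> insert x ` Pow (atoms \<mu>). ?h I) =
      (\<Sum>I\<in>Pow (atoms \<mu>). ?h I) + (\<Sum>I\<in>insert x ` Pow (atoms \<mu>). ?h I)"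
    using fin x by (intro sum.union_disjoint) auto
  also have "(\<Sum>I\<in>insert x ` Pow (atoms \<mu>). ?h I) = (\<Sum>I\<in>Pow (atoms \<mu>). ?h (insert x I))"
    using x by (subst sum.reindex) (auto simp: inj_on_def o_def)
  also have "(\<Sum>I\<in>Pow (atoms \<mu>). ?h (insert x I)) = split_sum (\<lambda>\<sigma> \<tau>. g (add_dirac \<sigma> x) \<tau>) \<mu>"
    unfolding split_sum_eq[OF \<mu>] by (intro sum.cong refl) (simp add: r3 r4)
  also have "(\<Sum>I\<in>Pow (atoms \<mu>). ?h I) = split_sum (\<lambda>\<sigma> \<tau>. g \<sigma> (add_dirac \<tau> x)) \<mu>"
    unfolding split_sum_eq[OF \<mu>] by (intro sum.cong refl) (simp add: r1 r2)
  finally show ?thesis by (simp add: add.commute)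
qed

lemma adds_simple:
  assumes "distinct xs" "set xs \<subseteq> space M"
  shows "adds (null_measure M) xs \<in> simple" "atoms (adds (null_measure M) xs) = set xs"
proof -
  have N: "adds (null_measure M) xs \<in> space \<N>" by auto
  have m: "mset (pts (adds (null_measure M) xs)) = mset xs"
    using assms set_pts[OF N] adds_pts[OF N] by (intro adds_mset_eq)
  show "adds (null_measure M) xs \<in> simple"
    using assms(1) N m by (metis simple_iff_distinct distinct_count_atmost_1 set_mset_mset)
  show "atoms (adds (null_measure M) xs) = set xs"
    using m by (metis atoms_eq[OF N] set_mset_mset)
qed

lemma split_sum_adds:
  assumes "distinct xs" "set xs \<subseteq> space M"
  shows "split_sum g (adds (null_measure M) xs) = lsplit xs g (null_measure M) (null_measure M)"
  using assms
proof (induction xs arbitrary: g)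
  case (Cons x xs)
  \<comment> \<open>\<open>lsplit\<close> consumes \<open>x\<close> first,
    \<open>split_sum_add_dirac\<close> needs it last; the order of additions is immaterial.\<close>
  have "adds (null_measure M) (x # xs) = adds (null_measure M) (xs @ [x])"
    by (rule adds_eq_mset) simp
  then have "adds (null_measure M) (x # xs) = add_dirac (adds (null_measure M) xs) x"
    by (simp add: adds_append)
  moreover have "split_sum g (add_dirac (adds (null_measure M) xs) x) = lsplit (x # xs) g (null_measure M) (null_measure M)"
    using Cons adds_simple[of xs] by (subst split_sum_add_dirac) (auto simp: lsplit_shift)
  ultimately show ?case by (simp only:)
qed (simp add: split_sum_null)

text \<open>A measurable extension of \<open>split_sum g\<close> to configurations with multiple points.\<close>

definition split_list :: "('a measure \<Rightarrow> 'a measure \<Rightarrow> ennreal) \<Rightarrow> 'a measure \<Rightarrow> ennreal" where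
  "split_list g \<mu> = lsplit (pts \<mu>) g (null_measure M) (null_measure M)"

lemma split_list_eq_split_sum: "\<mu> \<in> simple \<Longrightarrow> split_list g \<mu> = split_sum g \<mu>"
  using split_sum_adds[of "pts \<mu>" g] set_pts[of \<mu>] simple_in_counting[of \<mu>] simple_iff_distinct[of \<mu>]
  by (simp add: split_list_def adds_pts)

lemma split_list_measurable[measurable (raw)]:
  assumes g: "(\<lambda>(\<sigma>, \<tau>). g \<sigma> \<tau>) \<in> borel_measurable (\<N> \<Otimes>\<^sub>M \<N>)"
  shows "split_list g \<in> borel_measurable \<N>"
proof -
  let ?U = "count_space (UNIV :: unit set)"
  have "(\<lambda>(u, \<mu>). lsplit (pts \<mu>) g (null_measure M) (null_measure M)) \<in> borel_measurable (?U \<Otimes>\<^sub>M \<N>)"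
  proof (rule measurable_pts)
    fix n :: nat
    let ?P = "?U \<Otimes>\<^sub>M PiM {..<n} (\<lambda>_. M)"
    have "(\<lambda>w. lsplit (map (snd w) is) g (f w) (h w)) \<in> borel_measurable ?P"
      if "set is \<subseteq> {..<n}" "f \<in> measurable ?P \<N>" "h \<in> measurable ?P \<N>" for "is" f h
      using that
    proof (induction "is" arbitrary: f h)
      case Nil
      from measurable_compose[OF measurable_Pair[OF Nil(2,3)] g] show ?case by simp
    next
      case (Cons i "is")
      have [measurable]: "i \<in> {..<n}" using Cons.prems by auto
      have i: "(\<lambda>w. snd w i) \<in> measurable ?P M" by measurable
      have "(\<lambda>w. lsplit (map (snd w) is) g (add_dirac (f w) (snd w i)) (h w)) \<in> borel_measurable ?P"
        "(\<lambda>w. lsplit (map (snd w) is) g (f w) (add_dirac (h w) (snd w i))) \<in> borel_measurable ?P"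
        using Cons.prems by (auto intro!: Cons.IH measurable_add_dirac i)
      then show ?case by simp
    qed
    from this[of "[0..<n]" "\<lambda>_. null_measure M" "\<lambda>_. null_measure M"]
    show "(\<lambda>(u, \<omega>). lsplit (map \<omega> [0..<n]) g (null_measure M) (null_measure M)) \<in> borel_measurable ?P"
      by (simp add: case_prod_beta atLeast0LessThan)
  qed
  from measurable_compose[OF measurable_Pair1' this, of "()"] show ?thesis
    by (simp add: split_list_def[abs_def])
qed

text \<open>Splitting turns the addition of a point into its addition to either part: if S is the
  splitting sum, then T S = S (T1 + T2), and the powers follow.\<close>

lemma pins_split_list:
  assumes \<nu>: "intens \<nu>" "diffuse \<nu>"
    and g: "(\<lambda>(\<sigma>, \<tau>). g \<sigma> \<tau>) \<in> borel_measurable (\<N> \<Otimes>\<^sub>M \<N>)"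
    and \<psi>: "\<psi> \<in> simple"
  shows "pins \<nu> n (split_list g) \<psi> = split_sum (pins2 \<nu> \<nu> n g) \<psi>"
  using \<psi>
proof (induction n arbitrary: \<psi>)
  case 0
  then show ?case by (simp add: split_list_eq_split_sum split_sum_def)
next
  case (Suc n)
  note \<psi> = Suc.prems
  note N = simple_in_counting[OF \<psi>]
  have ad: "(\<lambda>x. add_dirac \<mu> x) \<in> measurable \<nu> \<N>" if "\<mu> \<in> space \<N>" for \<mu>
    using that by (intro measurable_add_dirac measurable_ident_sets intens_sets \<nu>) auto
  have r: "restrict_meas \<psi> I \<in> space \<N>" "restrict_meas \<psi> (space M - I) \<in> space \<N>"
    if "I \<in> Pow (atoms \<psi>)" for I
    using that subset_atoms_sets[OF N, of I] N by auto
  have m: "(\<lambda>x. pins2 \<nu> \<nu> n g (add_dirac \<sigma> x) \<tau>) \<in> borel_measurable \<nu>"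
    "(\<lambda>x. pins2 \<nu> \<nu> n g \<sigma> (add_dirac \<tau> x)) \<in> borel_measurable \<nu>"
    if "\<sigma> \<in> space \<N>" "\<tau> \<in> space \<N>" for \<sigma> \<tau>
    using that by (auto intro!: pins2_measurable[OF \<nu>(1) \<nu>(1) g] ad)
  have "(\<integral>\<^sup>+x. pins \<nu> n (split_list g) (add_dirac \<psi> x) \<partial>\<nu>) =
      (\<integral>\<^sup>+x. split_sum (\<lambda>\<sigma> \<tau>. pins2 \<nu> \<nu> n g (add_dirac \<sigma> x) \<tau>) \<psi> + split_sum (\<lambda>\<sigma> \<tau>. pins2 \<nu> \<nu> n g \<sigma> (add_dirac \<tau> x)) \<psi> \<partial>\<nu>)"
  proof (rule nn_integral_cong_AE)
    have "AE x in \<nu>. x \<in> space M"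
      using AE_space[of \<nu>] by (simp add: intens_space[OF \<nu>(1)])
    then show "AE x in \<nu>. pins \<nu> n (split_list g) (add_dirac \<psi> x) =
        split_sum (\<lambda>\<sigma> \<tau>. pins2 \<nu> \<nu> n g (add_dirac \<sigma> x) \<tau>) \<psi> + split_sum (\<lambda>\<sigma> \<tau>. pins2 \<nu> \<nu> n g \<sigma> (add_dirac \<tau> x)) \<psi>"
      using AE_add_dirac_simple[OF \<nu> \<psi>]
    proof eventually_elim
      case (elim x)
      \<comment> \<open>An atom of \<psi> would get multiplicity two, although the enlarged
        configuration is simple.\<close>
      have "x \<notin> atoms \<psi>"
      proof
        assume "x \<in> atoms \<psi>"
        then have "1 \<le> emeasure \<psi> {x}" using emeasure_ge_1[OF N, of "{x}"] by (auto simp: atoms_def)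
        then have "1 + 1 \<le> emeasure (add_dirac \<psi> x) {x}"
          using elim by (simp add: emeasure_add_dirac sets_counting_space[OF N] add_mono del: one_add_one)
        also have "\<dots> \<le> 1" using elim by (auto simp: simple_def)
        finally show False by simp
      qed
      then show ?case
        using elim by (simp add: Suc.IH split_sum_add_dirac[OF \<psi>])
    qed
  qed
  also have "\<dots> = (\<integral>\<^sup>+x. (\<Sum>I\<in>Pow (atoms \<psi>). pins2 \<nu> \<nu> n g (add_dirac (restrict_meas \<psi> I) x) (restrict_meas \<psi> (space M - I)) +
      pins2 \<nu> \<nu> n g (restrict_meas \<psi> I) (add_dirac (restrict_meas \<psi> (space M - I)) x)) \<partial>\<nu>)"
    by (simp add: split_sum_eq[OF \<psi>] sum.distrib)
  also have "\<dots> = (\<Sum>I\<in>Pow (atoms \<psi>). of_nat (Suc n) * pins2 \<nu> \<nu> (Suc n) g (restrict_meas \<psi> I) (restrict_meas \<psi> (space M - I)))"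
    unfolding pins2_Suc_mult
    by (subst nn_integral_sum) (auto intro!: borel_measurable_add m r sum.cong nn_integral_add)
  also have "\<dots> = of_nat (Suc n) * split_sum (pins2 \<nu> \<nu> (Suc n) g) \<psi>"
    unfolding split_sum_eq[OF \<psi>] by (rule sum_distrib_left[symmetric])
  finally have "of_nat (Suc n) * pins \<nu> (Suc n) (split_list g) \<psi> = of_nat (Suc n) * split_sum (pins2 \<nu> \<nu> (Suc n) g) \<psi>"
    by (simp only: pins_Suc_mult)
  then show ?case by (rule of_nat_Suc_cancel)
qed

text \<open>The empty configuration has one splitting, so exp(T1 + T2) remains. Both copies carry
  the full intensity: n points have 2^n splittings, which sum to the square of
  exp(\<nu>(X)).\<close>

lemma pexp_split_list:
  assumes \<nu>: "intens \<nu>" "diffuse \<nu>"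
    and g: "(\<lambda>(\<sigma>, \<tau>). g \<sigma> \<tau>) \<in> borel_measurable (\<N> \<Otimes>\<^sub>M \<N>)"
  shows "pexp \<nu> (split_list g) (null_measure M) = pexp \<nu> (\<lambda>\<sigma>. pexp \<nu> (g \<sigma>) (null_measure M)) (null_measure M)"
proof -
  have "pexp \<nu> (split_list g) (null_measure M) = (\<Sum>n. pins2 \<nu> \<nu> n g (null_measure M) (null_measure M))"
    unfolding pexp_def by (simp add: pins_split_list[OF \<nu> g] split_sum_null)
  also have "\<dots> = pexp \<nu> (\<lambda>\<sigma>. pexp \<nu> (g \<sigma>) (null_measure M)) (null_measure M)"
    by (rule suminf_pins2[OF \<nu>(1) \<nu>(1) g]) auto
  finally show ?thesis .
qed

section \<open>Products over the points of a configuration\<close>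

text \<open>A list product, so that \<open>measurable_pts\<close> applies; on simple configurations
  it is the product over the atoms in the kernel.\<close>

definition lprod :: "('a \<Rightarrow> ennreal) \<Rightarrow> 'a measure \<Rightarrow> ennreal" where
  "lprod q \<mu> = (\<Prod>x\<leftarrow>pts \<mu>. q x)"

lemma lprod_eq_prod: "\<mu> \<in> simple \<Longrightarrow> lprod q \<mu> = (\<Prod>x\<in>atoms \<mu>. q x)"
  using simple_in_counting[of \<mu>] simple_iff_distinct[of \<mu>]
  by (simp add: lprod_def atoms_eq prod.distinct_set_conv_list)

lemma lprod_null[simp]: "lprod q (null_measure M) = 1"
  by (simp add: lprod_def)

lemma lprod_add_dirac:
  assumes "\<mu> \<in> space \<N>" "x \<in> space M"
  shows "lprod q (add_dirac \<mu> x) = lprod q \<mu> * q x"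
proof -
  have "prod_mset (image_mset q (mset (pts (add_dirac \<mu> x)))) = prod_mset (image_mset q (mset (pts \<mu> @ [x])))"
    by (simp only: adds_pts_add_dirac[OF assms])
  then show ?thesis by (simp add: lprod_def prod_mset_prod_list[symmetric] mult.commute)
qed

lemma lprod_measurable:
  assumes q: "(\<lambda>(y, x). q y x) \<in> borel_measurable (Y \<Otimes>\<^sub>M M)"
  shows "(\<lambda>(y, \<mu>). lprod (q y) \<mu>) \<in> borel_measurable (Y \<Otimes>\<^sub>M \<N>)"
  unfolding lprod_def
proof (rule measurable_pts)
  fix n :: nat
  let ?P = "Y \<Otimes>\<^sub>M PiM {..<n} (\<lambda>_. M)"
  have "(\<lambda>w. \<Prod>x\<leftarrow>map (snd w) is. q (fst w) x) \<in> borel_measurable ?P" if "set is \<subseteq> {..<n}" for "is"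
    using that
  proof (induction "is")
    case (Cons i "is")
    have [measurable]: "i \<in> {..<n}" using Cons.prems by auto
    have "(\<lambda>w. (fst w, snd w i)) \<in> measurable ?P (Y \<Otimes>\<^sub>M M)" by measurable
    from measurable_compose[OF this q] have "(\<lambda>w. q (fst w) (snd w i)) \<in> borel_measurable ?P" by simp
    with Cons show ?case by (simp add: o_def)
  qed simp
  from this[of "[0..<n]"]
  show "(\<lambda>(y, \<omega>). \<Prod>x\<leftarrow>map \<omega> [0..<n]. q y x) \<in> borel_measurable ?P"
    by (simp add: case_prod_beta atLeast0LessThan)
qed

text \<open>The exponential formula for Poisson processes without its normalisation: every added
  point contributes one factor, which integrates to c.\<close>

lemma pexp_lprod:
  assumes \<nu>: "intens \<nu>" and q: "q \<in> borel_measurable M" and c: "(\<integral>\<^sup>+x. q x \<partial>\<nu>) = ennreal c" "0 \<le> c"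
  shows "pexp \<nu> (lprod q) (null_measure M) = ennreal (exp c)"
proof -
  have q': "q \<in> borel_measurable \<nu>" using q measurable_cong_sets[OF intens_sets[OF \<nu>] refl] by blast
  have "pins \<nu> n (lprod q) \<psi> = lprod q \<psi> * ennreal (c ^ n / fact n)" if "\<psi> \<in> space \<N>" for n \<psi>
    using that
  proof (induction n arbitrary: \<psi>)
    case (Suc n)
    have "(\<integral>\<^sup>+x. pins \<nu> n (lprod q) (add_dirac \<psi> x) \<partial>\<nu>) = (\<integral>\<^sup>+x. (lprod q \<psi> * ennreal (c ^ n / fact n)) * q x \<partial>\<nu>)"
      using Suc.prems by (intro nn_integral_cong)
        (simp add: Suc.IH add_dirac_in_counting lprod_add_dirac intens_space[OF \<nu>] mult_ac)
    also have "\<dots> = lprod q \<psi> * (ennreal c * ennreal (c ^ n / fact n))"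
      by (subst nn_integral_cmult[OF q']) (simp add: c mult_ac)
    finally show ?case
      by (simp only: pins.simps mult.left_commute[of "inverse _" "lprod q \<psi>"] ennreal_mult_power_fact[OF c(2)])
  qed simp
  then show ?thesis by (simp add: pexp_def suminf_ennreal_exp[OF c(2), simplified])
qed

text \<open>A point added under \<open>density M a\<close> brings the factor \<open>a x\<close>,
  which \<open>inverse (a x)\<close> undoes. So the factors 1 / \<alpha> of the retained points
  change the intensity \<alpha>\<lambda> into \<lambda>.\<close>

lemma pexp_density:
  assumes M: "intens M" and \<nu>: "intens (density M a)" and a[measurable]: "a \<in> borel_measurable M"
    and a_pos: "\<And>x. x \<in> space M \<Longrightarrow> 0 < a x" "\<And>x. x \<in> space M \<Longrightarrow> a x < \<infinity>"
    and h: "h \<in> borel_measurable \<N>"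
  shows "pexp (density M a) (\<lambda>\<mu>. lprod (\<lambda>x. inverse (a x)) \<mu> * h \<mu>) (null_measure M) = pexp M h (null_measure M)"
proof -
  let ?\<nu> = "density M a" and ?w = "lprod (\<lambda>x. inverse (a x))"
  have aa: "a x * inverse (a x) = 1" if "x \<in> space M" for x
    using a_pos[OF that] ennreal_divide_self[of "a x"] by (simp add: divide_ennreal_def)
  have wm: "?w \<in> borel_measurable \<N>"
  proof -
    have "(\<lambda>(y, x). inverse (a x)) \<in> borel_measurable (count_space (UNIV :: unit set) \<Otimes>\<^sub>M M)" by measurable
    from measurable_compose[OF measurable_Pair1' lprod_measurable[OF this], of "()"] show ?thesis by simp
  qed
  have whm: "(\<lambda>\<mu>. ?w \<mu> * h \<mu>) \<in> borel_measurable \<N>" using wm h by measurable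
  have "pins ?\<nu> n (\<lambda>\<mu>. ?w \<mu> * h \<mu>) \<psi> = ?w \<psi> * pins M n h \<psi>" if "\<psi> \<in> space \<N>" for n \<psi>
    using that
  proof (induction n arbitrary: \<psi>)
    case (Suc n)
    note \<psi> = Suc.prems
    have "(\<integral>\<^sup>+x. pins ?\<nu> n (\<lambda>\<mu>. ?w \<mu> * h \<mu>) (add_dirac \<psi> x) \<partial>?\<nu>) =
        (\<integral>\<^sup>+x. a x * pins ?\<nu> n (\<lambda>\<mu>. ?w \<mu> * h \<mu>) (add_dirac \<psi> x) \<partial>M)"
      by (rule nn_integral_density[OF a add_dirac_measurable_nu[OF M \<psi> whm \<nu>]])
    also have "\<dots> = (\<integral>\<^sup>+x. ?w \<psi> * pins M n h (add_dirac \<psi> x) \<partial>M)"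
    proof (rule nn_integral_cong)
      fix x assume x: "x \<in> space M"
      have "a x * pins ?\<nu> n (\<lambda>\<mu>. ?w \<mu> * h \<mu>) (add_dirac \<psi> x) = (a x * inverse (a x)) * (?w \<psi> * pins M n h (add_dirac \<psi> x))"
        unfolding Suc.IH[OF add_dirac_in_counting[OF \<psi>]] lprod_add_dirac[OF \<psi> x] by (simp add: mult_ac)
      then show "a x * pins ?\<nu> n (\<lambda>\<mu>. ?w \<mu> * h \<mu>) (add_dirac \<psi> x) = ?w \<psi> * pins M n h (add_dirac \<psi> x)"
        by (simp add: aa[OF x])
    qed
    also have "\<dots> = ?w \<psi> * (\<integral>\<^sup>+x. pins M n h (add_dirac \<psi> x) \<partial>M)"
      by (rule nn_integral_cmult[OF add_dirac_measurable_nu[OF M \<psi> h M]])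
    finally show ?case by (simp add: pins.simps mult.left_commute)
  qed simp
  then show ?thesis by (simp add: pexp_def)
qed

end

section \<open>The Gibbs model and the law of the thinned process\<close>

locale gibbs_model = borel_emb M \<phi> for M :: "'a measure" and \<phi> +
  fixes \<kappa> :: "'a \<Rightarrow> 'a measure \<Rightarrow> real" and \<alpha> :: "'a \<Rightarrow> real"
  assumes finite_M: "finite_measure M" and diffuse_M: "diffuse M"
    and kappa_meas[measurable]: "(\<lambda>(x, \<mu>). \<kappa> x \<mu>) \<in> borel_measurable (M \<Otimes>\<^sub>M \<N>)"
    and kappa_nonneg: "\<And>x \<mu>. x \<in> space M \<Longrightarrow> \<mu> \<in> space \<N> \<Longrightarrow> 0 \<le> \<kappa> x \<mu>"
    and kappa_cocycle: "\<And>x y \<mu>. x \<in> space M \<Longrightarrow> y \<in> space M \<Longrightarrow> \<mu> \<in> space \<N> \<Longrightarrow>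
      \<kappa> x \<mu> * \<kappa> y (add_dirac \<mu> x) = \<kappa> y \<mu> * \<kappa> x (add_dirac \<mu> y)"
    and alpha_meas[measurable]: "\<alpha> \<in> borel_measurable M"
    and alpha_pos: "\<And>x. x \<in> space M \<Longrightarrow> 0 < \<alpha> x"
    and alpha_int: "(\<integral>\<^sup>+x. ennreal (\<alpha> x) \<partial>M) < \<infinity>"
    and kappa_le: "\<And>x \<mu>. x \<in> space M \<Longrightarrow> \<mu> \<in> space \<N> \<Longrightarrow> \<kappa> x \<mu> \<le> \<alpha> x"
begin

abbreviation "k \<equiv> \<lambda>x \<mu>. ennreal (\<kappa> x \<mu>)"
abbreviation "a \<equiv> \<lambda>x. ennreal (\<alpha> x)"

sublocale dominated_kernel M \<phi> k a
proof (intro dominated_kernel.intro cocycle_kernel.intro cocycle_kernel_axioms.intro dominated_kernel_axioms.intro)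
  show "(\<lambda>(x, \<mu>). ennreal (\<kappa> x \<mu>)) \<in> borel_measurable (M \<Otimes>\<^sub>M \<N>)"
    using measurable_compose[OF kappa_meas measurable_ennreal] by (simp add: case_prod_beta)
  show "k x \<mu> * k y (add_dirac \<mu> x) = k y \<mu> * k x (add_dirac \<mu> y)"
    if "x \<in> space M" "y \<in> space M" "\<mu> \<in> space \<N>" for x y \<mu>
    using that kappa_nonneg kappa_cocycle[OF that]
    by (simp add: ennreal_mult[symmetric] add_dirac_in_counting)
  show "a \<in> borel_measurable M" by measurable
  show "k x \<mu> \<le> a x" if "x \<in> space M" "\<mu> \<in> space \<N>" for x \<mu>
    by (intro ennreal_leI kappa_le that)
qed (fact borel_emb_axioms finite_M diffuse_M alpha_int)+

abbreviation "zm \<equiv> null_measure M"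
abbreviation "\<nu> \<equiv> density M a"

lemma intens_density: "intens \<nu>"
  unfolding intens_def using alpha_int
  by (auto intro!: finite_measureI simp: emeasure_density cong: nn_integral_cong)

lemma diffuse_density: "diffuse \<nu>"
  unfolding diffuse_def
proof
  fix x assume "x \<in> space \<nu>"
  then have x: "x \<in> space M" by simp
  then have "{x} \<in> null_sets M" using diffM by (auto simp: null_sets_def diffuse_def)
  then show "emeasure \<nu> {x} = 0"
    using x by (subst emeasure_density) (auto intro: nn_integral_null_set)
qed

lemma measure_density_space: "measure \<nu> (space M) = alpha_total"
  by (simp add: measure_def emeasure_density alpha_total_def cong: nn_integral_cong)

lemma kappa_list_eq_klist:
  assumes "set xs \<subseteq> space M" "\<psi> \<in> space \<N>"
  shows "0 \<le> kappa_list \<kappa> xs \<psi> \<and> ennreal (kappa_list \<kappa> xs \<psi>) = klist k xs \<psi>"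
  using assms
proof (induction xs arbitrary: \<psi>)
  case (Cons x xs)
  then have "0 \<le> kappa_list \<kappa> xs (add_dirac \<psi> x) \<and> ennreal (kappa_list \<kappa> xs (add_dirac \<psi> x)) = klist k xs (add_dirac \<psi> x)"
    by (intro Cons.IH) auto
  with Cons.prems kappa_nonneg[of x \<psi>] show ?case by (simp add: ennreal_mult)
qed simp

lemma exp_minus_infinity: "exp_minus \<infinity> = 0"
  unfolding infinity_ereal_def by (rule exp_minus.simps)

text \<open>The enumeration chosen inside \<open>hamiltonian\<close> is immaterial by
  \<open>boltzmann_adds\<close>; weight 0 is energy \<infinity>, which \<open>exp_minus\<close>
  sends back to 0.\<close>

lemma exp_minus_hamiltonian:
  assumes \<mu>: "\<mu> \<in> space \<N>" and \<psi>: "\<psi> \<in> space \<N>"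
  shows "exp_minus (hamiltonian \<kappa> \<mu> \<psi>) = boltzmann k \<mu> \<psi>"
proof -
  define xs where "xs = (SOME xs. enumerates xs \<mu>)"
  have "\<exists>xs. enumerates xs \<mu>"
    using ex_enumeration[OF \<mu>] enumerates_iff[OF \<mu>] by auto
  then have "enumerates xs \<mu>" unfolding xs_def by (rule someI_ex)
  then have xs: "set xs \<subseteq> space M" "\<mu> = adds (null_measure M) xs"
    using enumerates_iff[OF \<mu>] by auto
  have "exp_minus (hamiltonian \<kappa> \<mu> \<psi>) = ennreal (kappa_list \<kappa> xs \<psi>)"
    using kappa_list_eq_klist[OF xs(1) \<psi>]
    unfolding hamiltonian_def xs_def[symmetric] Let_def
    by (cases "kappa_list \<kappa> xs \<psi> = 0") (simp_all add: exp_minus_infinity)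
  then show ?thesis
    using kappa_list_eq_klist[OF xs(1) \<psi>] boltzmann_adds[OF xs(1) \<psi>] xs(2) by simp
qed

lemma partition_fun_eq:
  assumes \<psi>: "\<psi> \<in> space \<N>"
  shows "partition_fun M \<kappa> (upset t) \<psi> = ennreal (exp (- measure (restrict_meas M (upset t)) (space M))) * gfun k t \<psi>"
proof -
  have i: "intens (restrict_meas M (upset t))" by (intro intens_restrict intens_M) simp
  have "partition_fun M \<kappa> (upset t) \<psi> = (\<integral>\<^sup>+\<mu>. boltzmann k \<mu> \<psi> \<partial>pois (restrict_meas M (upset t)))"
    unfolding partition_fun_def poisson_law_eq_pois[OF i]
    using \<psi> by (intro nn_integral_cong) (simp add: exp_minus_hamiltonian)
  also have "\<dots> = ennreal (exp (- measure (restrict_meas M (upset t)) (space M))) * pexp (restrict_meas M (upset t)) (\<lambda>\<mu>. boltzmann k \<mu> \<psi>) (null_measure M)"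
    by (rule nn_integral_pois[OF i]) (intro boltzmann_measurable measurable_ident_sets[OF refl] measurable_const \<psi>)
  finally show ?thesis by (simp only: pexp_boltzmann[OF \<psi>])
qed

lemma retention_eq:
  assumes \<psi>: "\<psi> \<in> space \<N>" and x: "x \<in> space M"
  shows "retention M \<kappa> \<phi> x \<psi> = retain_below x \<psi>"
proof -
  define \<sigma> where "\<sigma> = restrict_meas \<psi> (below M \<phi> x)"
  have \<sigma>: "\<sigma> \<in> space \<N>" "add_dirac \<sigma> x \<in> space \<N>"
    unfolding \<sigma>_def using \<psi> by (auto intro!: add_dirac_in_counting)
  have ab: "above M \<phi> x = upset (ereal (\<phi> x))" by (simp add: above_def upset_def)
  \<comment> \<open>\<open>c\<close> is -\<lambda>(x, \<infinity>), common to both partition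
    functions. By \<open>gfun_eq_exp\<close> all factors are exponentials of reals, so the
    cancellation is legitimate.\<close>
  have "(ennreal (exp c) * ennreal (exp g)) / (ennreal (exp c) * ennreal (exp h)) = ennreal (exp g) / ennreal (exp h)" for c g h
    by (simp add: divide_ennreal ennreal_mult[symmetric] exp_diff[symmetric] mult_exp_exp)
  then show ?thesis
    unfolding retention_def Let_def \<sigma>_def[symmetric] ab partition_fun_eq[OF \<sigma>(1)] partition_fun_eq[OF \<sigma>(2)]
    unfolding retain_below_def retain_def \<sigma>_def[symmetric] gfun_eq_exp[OF \<sigma>(1)] gfun_eq_exp[OF \<sigma>(2)] by simp
qed

text \<open>The kernel weight as a function of retained points \<sigma> and deleted points \<tau>,
  the form that \<open>split_sum\<close> expects; the deletion factors also look at
  \<sigma>.\<close>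

definition thin_weight :: "'a measure set \<Rightarrow> 'a measure \<Rightarrow> 'a measure \<Rightarrow> ennreal" where
  "thin_weight A \<sigma> \<tau> = indicator A \<sigma> * (lprod (\<lambda>x. inverse (a x)) \<sigma> * lprod (\<lambda>x. retain_below x \<sigma>) \<sigma> *
     lprod (\<lambda>x. 1 - inverse (a x) * retain_below x \<sigma>) \<tau>)"

lemma lprod_measurable2[measurable (raw)]:
  assumes q: "(\<lambda>(w, x). q w x) \<in> borel_measurable (W \<Otimes>\<^sub>M M)" and f: "f \<in> measurable W \<N>"
  shows "(\<lambda>w. lprod (q w) (f w)) \<in> borel_measurable W"
  using measurable_compose[OF measurable_Pair[OF measurable_ident f] lprod_measurable[OF q]] by simp

lemma thin_weight_measurable:
  assumes [measurable]: "A \<in> sets \<N>"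
  shows "(\<lambda>(\<sigma>, \<tau>). thin_weight A \<sigma> \<tau>) \<in> borel_measurable (\<N> \<Otimes>\<^sub>M \<N>)"
  unfolding thin_weight_def case_prod_beta by measurable

lemma thinning_weight_eq:
  assumes \<mu>: "\<mu> \<in> simple" and \<psi>: "\<psi> \<in> simple" "\<psi> \<le> \<mu>"
  shows "indicator A \<psi> * thinning_weight M \<kappa> \<alpha> \<phi> \<mu> \<psi> = thin_weight A \<psi> (diff_measure \<mu> \<psi>)"
proof -
  note N = simple_in_counting[OF \<mu>] and N\<psi> = simple_in_counting[OF \<psi>(1)]
  have "\<psi> \<in> restrict_meas \<mu> ` Pow (atoms \<mu>)"
    using bij_betw_imp_surj_on[OF subconfigurations[OF \<mu>]] \<psi> by auto
  then obtain I where I: "I \<subseteq> atoms \<mu>" "\<psi> = restrict_meas \<mu> I" by auto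
  then have "diff_measure \<mu> \<psi> = restrict_meas \<mu> (space M - I)"
    using subset_atoms_sets[OF N] by (simp add: diff_restrict[OF N])
  then have d: "diff_measure \<mu> \<psi> \<in> simple"
    using subset_atoms_sets[OF N I(1)] restrict_simple(1)[OF \<mu>] by simp
  have "retention M \<kappa> \<phi> x \<psi> = retain_below x \<psi>" if "x \<in> atoms \<psi> \<or> x \<in> atoms (diff_measure \<mu> \<psi>)" for x
    using that atoms_subset[OF N\<psi>] atoms_subset[OF simple_in_counting[OF d]]
    by (intro retention_eq[OF N\<psi>]) auto
  then show ?thesis
    unfolding thinning_weight_def thin_weight_def
    by (simp add: lprod_eq_prod[OF \<psi>(1)] lprod_eq_prod[OF d] prod.distrib cong: prod.cong)
qed

lemma emeasure_thinning_kernel_eq: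
  assumes \<mu>: "\<mu> \<in> simple" and A: "A \<in> sets (simple_counting_algebra M)"
  shows "emeasure (thinning_kernel M \<kappa> \<alpha> \<phi> \<mu>) A = split_list (thin_weight A) \<mu>"
  unfolding emeasure_thinning_kernel[OF A] split_list_eq_split_sum[OF \<mu>] split_sum_def space_simple
  by (intro sum.cong refl thinning_weight_eq \<mu>) auto

lemma simple_counting_algebra_eq: "simple_counting_algebra M = restrict_space \<N> simple"
  unfolding simple_counting_algebra_def restrict_space_def
  by (intro arg_cong2[where f="\<lambda>x y. measure_of x y _"] image_cong refl)
     (auto simp: simple_def dest: sets.sets_into_space)

lemma sets_simple_counting: "A \<in> sets (simple_counting_algebra M) \<longleftrightarrow> A \<in> sets \<N> \<and> A \<subseteq> simple"
  unfolding simple_counting_algebra_eq by (subst sets_restrict_space_iff) auto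

lemma sets_thinning_kernel: "sets (thinning_kernel M \<kappa> \<alpha> \<phi> \<mu>) = sets (simple_counting_algebra M)"
  unfolding thinning_kernel_def by simp

text \<open>On simple configurations the kernel is a \<open>split_list\<close>, whose measurability
  comes from the recursion along \<open>pts\<close>.\<close>

lemma measure_kernel_thinning:
  "measure_kernel (simple_counting_algebra M) (simple_counting_algebra M) (thinning_kernel M \<kappa> \<alpha> \<phi>)"
  unfolding measure_kernel_def
proof (intro conjI ballI)
  fix A assume A: "A \<in> sets (simple_counting_algebra M)"
  then have "A \<in> sets \<N>" by (simp add: sets_simple_counting)
  then have "split_list (thin_weight A) \<in> borel_measurable \<N>"
    by (intro split_list_measurable thin_weight_measurable)
  then have "split_list (thin_weight A) \<in> borel_measurable (simple_counting_algebra M)"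
    unfolding simple_counting_algebra_eq by (rule measurable_restrict_space1)
  then show "(\<lambda>\<mu>. emeasure (thinning_kernel M \<kappa> \<alpha> \<phi> \<mu>) A) \<in> borel_measurable (simple_counting_algebra M)"
    by (rule measurable_cong[THEN iffD1, rotated])
       (simp add: emeasure_thinning_kernel_eq[OF _ A] space_simple)
qed (rule sets_thinning_kernel)

text \<open>Given \<sigma>, the deletion factors form a product over \<tau>, so the exponential
  formula applies with \<integral> (1 - p / \<alpha>) \<alpha> d\<lambda> =
  \<open>alpha_total\<close> - \<integral> p d\<lambda>. The subtraction is exact because p \<le>
  \<alpha>.\<close>

lemma pexp_thin_weight:
  assumes A: "A \<in> sets \<N>" and \<sigma>: "\<sigma> \<in> space \<N>"
  shows "pexp \<nu> (thin_weight A \<sigma>) zm = ennreal (exp alpha_total) * (lprod (\<lambda>x. inverse (a x)) \<sigma> *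
    (indicator A \<sigma> * (lprod (\<lambda>x. retain_below x \<sigma>) \<sigma> * ennreal (exp (- retain_below_integral (- \<infinity>) \<sigma>)))))"
proof -
  have [measurable]: "\<sigma> \<in> space \<N>" by (rule \<sigma>)
  let ?q = "\<lambda>x. 1 - inverse (a x) * retain_below x \<sigma>"
  let ?c = "indicator A \<sigma> * (lprod (\<lambda>x. inverse (a x)) \<sigma> * lprod (\<lambda>x. retain_below x \<sigma>) \<sigma>)"
  have q[measurable]: "?q \<in> borel_measurable M" by measurable
  have rm[measurable]: "(\<lambda>x. retain_below x \<sigma>) \<in> borel_measurable M" by measurable
  have r: "(\<integral>\<^sup>+x. retain_below x \<sigma> \<partial>M) = ennreal (retain_below_integral (- \<infinity>) \<sigma>)"
    by (simp add: ennreal_retain_below_integral[OF \<sigma>] upset_MInf cong: nn_integral_cong)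
  have "ennreal (retain_below_integral (- \<infinity>) \<sigma>) \<le> ennreal alpha_total"
    unfolding r[symmetric] alpha_total(1)[symmetric] by (intro nn_integral_mono retain_below_le \<sigma>)
  then have le: "retain_below_integral (- \<infinity>) \<sigma> \<le> alpha_total" using alpha_total(2) by simp
  have "(\<integral>\<^sup>+x. ?q x \<partial>\<nu>) = (\<integral>\<^sup>+x. a x * ?q x \<partial>M)"
    by (rule nn_integral_density) measurable
  also have "\<dots> = (\<integral>\<^sup>+x. a x - retain_below x \<sigma> \<partial>M)"
  proof (rule nn_integral_cong)
    fix x assume x: "x \<in> space M"
    have "a x * inverse (a x) = 1"
      using alpha_pos[OF x] ennreal_divide_self[of "a x"] by (simp add: divide_ennreal_def)
    then have "a x * (inverse (a x) * retain_below x \<sigma>) = retain_below x \<sigma>" by (simp add: mult.assoc[symmetric])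
    then show "a x * ?q x = a x - retain_below x \<sigma>" by (simp add: ennreal_diff_le_mono_left ennreal_right_diff_distrib)
  qed
  also have "\<dots> = (\<integral>\<^sup>+x. a x \<partial>M) - (\<integral>\<^sup>+x. retain_below x \<sigma> \<partial>M)"
    using retain_below_le[OF \<sigma>] by (intro nn_integral_diff) (auto simp: r)
  also have "\<dots> = ennreal (alpha_total - retain_below_integral (- \<infinity>) \<sigma>)"
    unfolding r alpha_total(1) by (rule ennreal_minus[OF retain_below_integral_nonneg])
  finally have i: "(\<integral>\<^sup>+x. ?q x \<partial>\<nu>) = ennreal (alpha_total - retain_below_integral (- \<infinity>) \<sigma>)" .
  have m: "lprod ?q \<in> borel_measurable \<N>" by measurable
  have "pexp \<nu> (thin_weight A \<sigma>) zm = pexp \<nu> (\<lambda>\<tau>. ?c * lprod ?q \<tau>) zm"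
    by (simp add: thin_weight_def[abs_def] mult.assoc)
  also have "\<dots> = ?c * pexp \<nu> (lprod ?q) zm"
    by (rule pexp_cmult[OF intens_density m]) simp
  also have "pexp \<nu> (lprod ?q) zm = ennreal (exp (alpha_total - retain_below_integral (- \<infinity>) \<sigma>))"
    using le by (intro pexp_lprod intens_density q i) simp
  also have "\<dots> = ennreal (exp alpha_total) * ennreal (exp (- retain_below_integral (- \<infinity>) \<sigma>))"
    by (simp add: ennreal_mult[symmetric] mult_exp_exp)
  finally show ?thesis by (simp add: mult_ac)
qed

abbreviation "G \<equiv> gfun k (- \<infinity>) zm"

lemma G_finite: "0 < G" "G < \<infinity>"
  by (rule gfun_pos, rule gfun_less_top) simp

text \<open>As \<open>G\<close> is exp(\<lambda>(X)) times the partition function Z(0) of the whole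
  space, the density is exp(-H(\<mu>, 0)) / Z(0).\<close>

definition qlaw :: "'a measure measure" where
  "qlaw = density (pois M) (\<lambda>\<mu>. ennreal (exp (measure M (space M))) / G * boltzmann k \<mu> zm)"

lemma sets_qlaw[simp, measurable_cong]: "sets qlaw = sets \<N>"
  and space_qlaw[simp]: "space qlaw = space \<N>"
  by (simp_all add: qlaw_def)

lemma nn_integral_qlaw:
  assumes [measurable]: "f \<in> borel_measurable \<N>"
  shows "(\<integral>\<^sup>+\<mu>. f \<mu> \<partial>qlaw) = inverse G * pexp M (\<lambda>\<mu>. boltzmann k \<mu> zm * f \<mu>) zm"
proof -
  have "(\<integral>\<^sup>+\<mu>. f \<mu> \<partial>qlaw) = (\<integral>\<^sup>+\<mu>. ennreal (exp (measure M (space M))) / G * boltzmann k \<mu> zm * f \<mu> \<partial>pois M)"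
    unfolding qlaw_def by (rule nn_integral_density) measurable
  also have "\<dots> = (\<integral>\<^sup>+\<mu>. (ennreal (exp (measure M (space M))) / G) * (boltzmann k \<mu> zm * f \<mu>) \<partial>pois M)"
    by (simp add: mult.assoc)
  also have "\<dots> = ennreal (exp (measure M (space M))) / G * (\<integral>\<^sup>+\<mu>. boltzmann k \<mu> zm * f \<mu> \<partial>pois M)"
    by (rule nn_integral_cmult) measurable
  also have "(\<integral>\<^sup>+\<mu>. boltzmann k \<mu> zm * f \<mu> \<partial>pois M) = ennreal (exp (- measure M (space M))) * pexp M (\<lambda>\<mu>. boltzmann k \<mu> zm * f \<mu>) zm"
    by (rule nn_integral_pois[OF intens_M]) measurable
  also have "ennreal (exp (measure M (space M))) / G * \<dots> =
      (ennreal (exp (measure M (space M))) * ennreal (exp (- measure M (space M)))) * (inverse G * pexp M (\<lambda>\<mu>. boltzmann k \<mu> zm * f \<mu>) zm)"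
    unfolding divide_ennreal_def by (simp only: mult_ac)
  also have "ennreal (exp (measure M (space M))) * ennreal (exp (- measure M (space M))) = 1"
    by (simp add: ennreal_mult[symmetric] mult_exp_exp)
  finally show ?thesis by simp
qed

lemma restrict_meas_space: "restrict_meas M (space M) = M"
  by (rule measure_eqI) (auto simp: emeasure_restrict_meas)

lemma prob_space_qlaw: "prob_space qlaw"
proof (rule prob_spaceI)
  have "pexp M (\<lambda>\<mu>. boltzmann k \<mu> zm) zm = G"
    using pexp_boltzmann[of zm "- \<infinity>"] by (simp add: upset_MInf restrict_meas_space)
  then show "emeasure qlaw (space qlaw) = 1"
    using nn_integral_qlaw[of "\<lambda>_. 1"] G_finite ennreal_divide_self[of G]
    by (simp add: divide_ennreal_def mult.commute)
qed

lemma thinned_law_eq_qlaw: "thinned_law M \<kappa> \<alpha> \<phi> = qlaw"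
proof -
  have *: "(\<integral>\<^sup>+\<mu>\<in>space (simple_counting_algebra M). (\<integral>\<^sup>+\<psi>. indicator A \<psi> \<partial>thinning_kernel M \<kappa> \<alpha> \<phi> \<mu>) \<partial>poisson_law \<nu>) =
      emeasure qlaw A" if A[measurable]: "A \<in> sets \<N>" for A
  proof -
    \<comment> \<open>The kernel lives on simple configurations, so only this part of
      \<open>A\<close> is seen.\<close>
    define B where "B = A \<inter> simple"
    have B: "B \<in> sets (simple_counting_algebra M)" and BN[measurable]: "B \<in> sets \<N>"
      unfolding B_def by (auto simp: sets_simple_counting)
    have gm: "split_list (thin_weight B) \<in> borel_measurable \<N>"
      by (intro split_list_measurable thin_weight_measurable BN)
    have gm': "(\<lambda>\<mu>. split_list (thin_weight B) \<mu> * indicator simple \<mu>) \<in> borel_measurable \<N>"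
      using gm by measurable
    let ?h = "\<lambda>\<sigma>. indicator B \<sigma> * (lprod (\<lambda>x. retain_below x \<sigma>) \<sigma> * ennreal (exp (- retain_below_integral (- \<infinity>) \<sigma>)))"
    have rsm[measurable]: "retain_below_integral (- \<infinity>) \<in> borel_measurable \<N>"
      unfolding retain_below_integral_def[abs_def] by measurable
    have hm: "?h \<in> borel_measurable \<N>" by measurable
    have km: "(\<lambda>\<mu>. boltzmann k \<mu> zm * indicator A \<mu>) \<in> borel_measurable \<N>" by measurable
    have wm: "lprod (\<lambda>x. inverse (a x)) \<in> borel_measurable \<N>" by measurable
    have K: "(\<integral>\<^sup>+\<psi>. indicator A \<psi> \<partial>thinning_kernel M \<kappa> \<alpha> \<phi> \<mu>) = split_list (thin_weight B) \<mu>" if \<mu>: "\<mu> \<in> simple" for \<mu>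
    proof -
      have sp: "space (thinning_kernel M \<kappa> \<alpha> \<phi> \<mu>) = simple"
        using sets_eq_imp_space_eq[OF sets_thinning_kernel] by (simp add: space_simple)
      have "(\<integral>\<^sup>+\<psi>. indicator A \<psi> \<partial>thinning_kernel M \<kappa> \<alpha> \<phi> \<mu>) = (\<integral>\<^sup>+\<psi>. indicator B \<psi> \<partial>thinning_kernel M \<kappa> \<alpha> \<phi> \<mu>)"
        by (intro nn_integral_cong) (simp add: sp B_def indicator_def)
      also have "\<dots> = emeasure (thinning_kernel M \<kappa> \<alpha> \<phi> \<mu>) B"
        using B by (intro nn_integral_indicator) (simp add: sets_thinning_kernel)
      finally show ?thesis by (simp add: emeasure_thinning_kernel_eq[OF \<mu> B])
    qed
    have "(\<integral>\<^sup>+\<mu>\<in>space (simple_counting_algebra M). (\<integral>\<^sup>+\<psi>. indicator A \<psi> \<partial>thinning_kernel M \<kappa> \<alpha> \<phi> \<mu>) \<partial>poisson_law \<nu>) =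
        (\<integral>\<^sup>+\<mu>. split_list (thin_weight B) \<mu> * indicator simple \<mu> \<partial>pois \<nu>)"
      unfolding poisson_law_eq_pois[OF intens_density] space_simple
    proof (rule nn_integral_cong)
      show "(\<integral>\<^sup>+\<psi>. indicator A \<psi> \<partial>thinning_kernel M \<kappa> \<alpha> \<phi> \<mu>) * indicator simple \<mu> = split_list (thin_weight B) \<mu> * indicator simple \<mu>" for \<mu>
        by (cases "\<mu> \<in> simple") (simp_all add: K)
    qed
    also have "\<dots> = ennreal (exp (- alpha_total)) * pexp \<nu> (\<lambda>\<mu>. split_list (thin_weight B) \<mu> * indicator simple \<mu>) zm"
      using nn_integral_pois[OF intens_density gm'] by (simp add: measure_density_space)
    \<comment> \<open>The restriction to simple configurations drops out, as the intensity
      \<alpha>\<lambda> is diffuse.\<close>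
    also have "pexp \<nu> (\<lambda>\<mu>. split_list (thin_weight B) \<mu> * indicator simple \<mu>) zm = pexp \<nu> (split_list (thin_weight B)) zm"
      by (rule pexp_cong[OF AE_add_dirac_simple[OF intens_density diffuse_density]]) auto
    also have "\<dots> = pexp \<nu> (\<lambda>\<sigma>. pexp \<nu> (thin_weight B \<sigma>) zm) zm"
      by (rule pexp_split_list[OF intens_density diffuse_density thin_weight_measurable[OF BN]])
    also have "\<dots> = pexp \<nu> (\<lambda>\<sigma>. ennreal (exp alpha_total) * (lprod (\<lambda>x. inverse (a x)) \<sigma> * ?h \<sigma>)) zm"
      by (rule pexp_cong[OF AE_add_dirac_counting]) (auto simp: pexp_thin_weight[OF BN])
    also have "\<dots> = ennreal (exp alpha_total) * pexp \<nu> (\<lambda>\<sigma>. lprod (\<lambda>x. inverse (a x)) \<sigma> * ?h \<sigma>) zm"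
      using wm hm by (intro pexp_cmult[OF intens_density] borel_measurable_times) auto
    also have "pexp \<nu> (\<lambda>\<sigma>. lprod (\<lambda>x. inverse (a x)) \<sigma> * ?h \<sigma>) zm = pexp M ?h zm"
      using alpha_pos by (intro pexp_density[OF intens_M intens_density _ _ _ hm]) auto
    \<comment> \<open>The telescoping identity holds for simple configurations, and the diffuse
      intensity \<lambda> produces no others up to null sets.\<close>
    also have "pexp M ?h zm = pexp M (\<lambda>\<sigma>. inverse G * (boltzmann k \<sigma> zm * indicator A \<sigma>)) zm"
    proof (rule pexp_cong[OF AE_add_dirac_simple[OF intens_M diffM]])
      fix \<sigma> assume \<sigma>: "\<sigma> \<in> simple"
      have "boltzmann k \<sigma> zm * inverse G =
          (\<Prod>x\<in>atoms \<sigma>. retain_below x \<sigma>) * ennreal (exp (- retain_below_integral (- \<infinity>) \<sigma>)) * (G * inverse G)"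
        unfolding exp_retain_below_integral_boltzmann[OF \<sigma>, symmetric] by (simp add: mult_ac)
      also have "G * inverse G = 1"
        using G_finite ennreal_divide_self[of G] by (simp add: divide_ennreal_def)
      finally have "lprod (\<lambda>x. retain_below x \<sigma>) \<sigma> * ennreal (exp (- retain_below_integral (- \<infinity>) \<sigma>)) = inverse G * boltzmann k \<sigma> zm"
        by (simp add: lprod_eq_prod[OF \<sigma>] mult.commute)
      then show "?h \<sigma> = inverse G * (boltzmann k \<sigma> zm * indicator A \<sigma>)"
        using \<sigma> by (simp add: B_def indicator_def)
    qed simp_all
    also have "\<dots> = inverse G * pexp M (\<lambda>\<sigma>. boltzmann k \<sigma> zm * indicator A \<sigma>) zm"
      by (rule pexp_cmult[OF intens_M km]) simp
    \<comment> \<open>The normalisation of the Poisson law with intensity \<alpha>\<lambda> meets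
      the constant left by the deleted points.\<close>
    also have "ennreal (exp (- alpha_total)) * (ennreal (exp alpha_total) * \<dots>) =
        (ennreal (exp (- alpha_total)) * ennreal (exp alpha_total)) * \<dots>"
      by (simp only: mult.assoc)
    also have "ennreal (exp (- alpha_total)) * ennreal (exp alpha_total) = 1"
      by (simp add: ennreal_mult[symmetric] mult_exp_exp)
    also have "1 * (inverse G * pexp M (\<lambda>\<sigma>. boltzmann k \<sigma> zm * indicator A \<sigma>) zm) = (\<integral>\<^sup>+\<mu>. indicator A \<mu> \<partial>qlaw)"
      by (subst nn_integral_qlaw) simp_all
    also have "\<dots> = emeasure qlaw A" by simp
    finally show ?thesis .
  qed
  have "thinned_law M \<kappa> \<alpha> \<phi> = measure_of (space qlaw) (sets qlaw) (emeasure qlaw)"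
    unfolding thinned_law_def space_qlaw sets_qlaw
    by (rule measure_of_eq[OF sets.space_closed]) (simp add: * sets.sigma_sets_eq)
  then show ?thesis by (simp only: measure_of_of_measure)
qed

text \<open>The Mecke equation is applied to f(x, \<mu>) exp(-H(\<mu>, 0)) under intensity
  \<lambda>; the constant 1 / \<open>G\<close> is carried along on both sides.\<close>

lemma gibbs_process_qlaw: "gibbs_process qlaw (\<lambda>\<mu>. \<mu>) M \<kappa>"
  unfolding gibbs_process_def point_process_def
proof (intro conjI allI impI prob_space_qlaw)
  show "(\<lambda>\<mu>. \<mu>) \<in> measurable qlaw \<N>" by measurable
  fix f :: "'a \<times> 'a measure \<Rightarrow> real"
  assume f: "f \<in> borel_measurable (M \<Otimes>\<^sub>M \<N>)"
  have f': "(\<lambda>(x, \<mu>). ennreal (f (x, \<mu>))) \<in> borel_measurable (M \<Otimes>\<^sub>M \<N>)"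
    using measurable_compose[OF f measurable_ennreal] by (simp add: case_prod_beta)
  note fm[measurable (raw)] = measurable_compose[OF measurable_Pair f]
  have fk: "(\<lambda>(x, \<mu>). ennreal (f (x, \<mu>)) * boltzmann k \<mu> zm) \<in> borel_measurable (M \<Otimes>\<^sub>M \<N>)"
    unfolding case_prod_beta by measurable
  have I1: "(\<lambda>\<mu>. \<integral>\<^sup>+x. ennreal (f (x, \<mu>)) \<partial>\<mu>) \<in> borel_measurable \<N>"
  proof -
    have "(\<lambda>(\<mu>, x). ennreal (f (x, \<mu>))) \<in> borel_measurable (\<N> \<Otimes>\<^sub>M M)"
      unfolding case_prod_beta by measurable
    from measurable_compose[OF measurable_Pair[OF measurable_ident measurable_ident] measurable_nn_integral_counting[OF this]]
    show ?thesis by simp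
  qed
  have I2: "(\<lambda>(x, \<mu>). ennreal (f (x, add_dirac \<mu> x)) * k x \<mu>) \<in> borel_measurable (M \<Otimes>\<^sub>M \<N>)"
    unfolding case_prod_beta by measurable
  have I4: "(\<lambda>(x, \<mu>). boltzmann k \<mu> zm * (ennreal (f (x, add_dirac \<mu> x)) * k x \<mu>)) \<in> borel_measurable (M \<Otimes>\<^sub>M \<N>)"
    unfolding case_prod_beta by measurable
  have I3: "(\<lambda>\<mu>. \<integral>\<^sup>+x. ennreal (f (x, add_dirac \<mu> x)) * k x \<mu> \<partial>M) \<in> borel_measurable \<N>"
    by measurable
  have "(\<integral>\<^sup>+\<mu>. (\<integral>\<^sup>+x. ennreal (f (x, \<mu>)) \<partial>\<mu>) \<partial>qlaw) = inverse G * pexp M (\<lambda>\<mu>. boltzmann k \<mu> zm * (\<integral>\<^sup>+x. ennreal (f (x, \<mu>)) \<partial>\<mu>)) zm"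
    by (rule nn_integral_qlaw[OF I1])
  also have "pexp M (\<lambda>\<mu>. boltzmann k \<mu> zm * (\<integral>\<^sup>+x. ennreal (f (x, \<mu>)) \<partial>\<mu>)) zm = pexp M (\<lambda>\<mu>. \<integral>\<^sup>+x. ennreal (f (x, \<mu>)) * boltzmann k \<mu> zm \<partial>\<mu>) zm"
  proof (rule pexp_cong[OF AE_add_dirac_counting])
    fix \<mu> assume \<mu>[measurable]: "\<mu> \<in> space \<N>"
    have "(\<lambda>x. ennreal (f (x, \<mu>))) \<in> borel_measurable M" by measurable
    then have "(\<lambda>x. ennreal (f (x, \<mu>))) \<in> borel_measurable \<mu>"
      using measurable_cong_sets[OF sets_counting_space[OF \<mu>] refl] by blast
    then show "boltzmann k \<mu> zm * (\<integral>\<^sup>+x. ennreal (f (x, \<mu>)) \<partial>\<mu>) = (\<integral>\<^sup>+x. ennreal (f (x, \<mu>)) * boltzmann k \<mu> zm \<partial>\<mu>)"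
      by (simp add: nn_integral_multc mult.commute)
  qed auto
  also have "\<dots> = (\<integral>\<^sup>+x. pexp M (\<lambda>\<mu>. ennreal (f (x, add_dirac \<mu> x)) * boltzmann k (add_dirac \<mu> x) zm) zm \<partial>M)"
    by (rule pexp_Mecke[OF intens_M fk])
  \<comment> \<open>The weight of \<mu> + \<delta>_x is the weight of \<mu> times
    \<open>k x \<mu>\<close>, since adding the points of \<mu> to the empty configuration recovers
    \<mu>.\<close>
  also have "\<dots> = (\<integral>\<^sup>+x. pexp M (\<lambda>\<mu>. boltzmann k \<mu> zm * (ennreal (f (x, add_dirac \<mu> x)) * k x \<mu>)) zm \<partial>M)"
  proof (rule nn_integral_cong)
    fix x assume x: "x \<in> space M"
    show "pexp M (\<lambda>\<mu>. ennreal (f (x, add_dirac \<mu> x)) * boltzmann k (add_dirac \<mu> x) zm) zm =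
        pexp M (\<lambda>\<mu>. boltzmann k \<mu> zm * (ennreal (f (x, add_dirac \<mu> x)) * k x \<mu>)) zm"
      by (rule pexp_cong[OF AE_add_dirac_counting]) (auto simp: boltzmann_add_dirac[OF _ x] adds_pts mult_ac)
  qed
  also have "\<dots> = pexp M (\<lambda>\<mu>. \<integral>\<^sup>+x. boltzmann k \<mu> zm * (ennreal (f (x, add_dirac \<mu> x)) * k x \<mu>) \<partial>M) zm"
    by (rule pexp_nn_integral[OF intens_M intens_sigma_finite[OF intens_M] I4]) simp
  also have "\<dots> = pexp M (\<lambda>\<mu>. boltzmann k \<mu> zm * (\<integral>\<^sup>+x. ennreal (f (x, add_dirac \<mu> x)) * k x \<mu> \<partial>M)) zm"
    by (rule pexp_cong[OF AE_add_dirac_counting]) (auto intro!: nn_integral_cmult)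
  also have "inverse G * \<dots> = (\<integral>\<^sup>+\<mu>. (\<integral>\<^sup>+x. ennreal (f (x, add_dirac \<mu> x)) * k x \<mu> \<partial>M) \<partial>qlaw)"
    by (rule nn_integral_qlaw[OF I3, symmetric])
  finally show "(\<integral>\<^sup>+\<mu>. (\<integral>\<^sup>+x. ennreal (f (x, \<mu>)) \<partial>\<mu>) \<partial>qlaw) =
      (\<integral>\<^sup>+\<mu>. (\<integral>\<^sup>+x. ennreal (f (x, add_dirac \<mu> x)) * ennreal (\<kappa> x \<mu>) \<partial>M) \<partial>qlaw)" .
qed

lemma gibbs_distribution_thinned_law: "gibbs_distribution (thinned_law M \<kappa> \<alpha> \<phi>) M \<kappa>"
  unfolding gibbs_distribution_def thinned_law_eq_qlaw
  using gibbs_process_qlaw distr_id2[of "\<N>" qlaw]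
  by (intro exI[of _ qlaw] exI[of _ "\<lambda>\<mu>. \<mu>"]) simp

end

theorem theorem4p3:
  fixes lam :: "'a measure"
    and \<kappa> :: "'a \<Rightarrow> 'a measure \<Rightarrow> real"
    and \<alpha> \<phi> :: "'a \<Rightarrow> real"
  assumes "borel_space lam"
    and "finite_measure lam"
    and "diffuse lam"
    and "(\<lambda>(x, \<mu>). \<kappa> x \<mu>) \<in> borel_measurable (lam \<Otimes>\<^sub>M counting_algebra lam)"
    and "\<And>x \<mu>. x \<in> space lam \<Longrightarrow> \<mu> \<in> space (counting_algebra lam) \<Longrightarrow> 0 \<le> \<kappa> x \<mu>"
    and "\<And>x y \<mu>. x \<in> space lam \<Longrightarrow> y \<in> space lam \<Longrightarrow> \<mu> \<in> space (counting_algebra lam) \<Longrightarrow>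
           \<kappa> x \<mu> * \<kappa> y (add_dirac \<mu> x) = \<kappa> y \<mu> * \<kappa> x (add_dirac \<mu> y)"
    and "\<alpha> \<in> borel_measurable lam"
    and "\<And>x. x \<in> space lam \<Longrightarrow> 0 < \<alpha> x"
    and "(\<integral>\<^sup>+x. ennreal (\<alpha> x) \<partial>lam) < \<infinity>"
    and "\<And>x \<mu>. x \<in> space lam \<Longrightarrow> \<mu> \<in> space (counting_algebra lam) \<Longrightarrow> \<kappa> x \<mu> \<le> \<alpha> x"
    and "borel_embedding lam \<phi>"
  shows "measure_kernel (simple_counting_algebra lam) (simple_counting_algebra lam)
           (thinning_kernel lam \<kappa> \<alpha> \<phi>) \<and>
         gibbs_distribution (thinned_law lam \<kappa> \<alpha> \<phi>) lam \<kappa>"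
proof -
  interpret gibbs_model lam \<phi> \<kappa> \<alpha>
    by (intro gibbs_model.intro borel_emb.intro gibbs_model_axioms.intro) (fact assms)+
  show ?thesis
    using measure_kernel_thinning gibbs_distribution_thinned_law by blast
qed

end
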